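(* Let $r>0$ be real and $q=e^{-\pi\sqrt r}$. Put $$a_r=\left(\frac{k'_r}{k'_{25r}}\right)^2\sqrt{\frac{k_r}{k_{25r}}}\;M_5(r)^{-3},$$ where $M_5(r)=K(k_{25r})/K(k_r)$, which is a root $x$ of $(5x-1)^5(1-x)=256\,k_r^2\,(k'_r)^2\,x$. Then $$R(q)=\left(-\frac{11}{2}-\frac{a_r}{2}+\frac12\sqrt{125+22a_r+a_r^2}\right)^{1/5}.$$
   Context: $K(x)=\int_0^{\pi/2}\frac{dt}{\sqrt{1-x^2\sin^2 t}}$ for $0\le x<1$ (argument is the modulus). For real $r>0$, $k_r\in(0,1)$ is the unique solution $k$ of $K(\sqrt{1-k^2})/K(k)=\sqrt r$, and $k'_r=\sqrt{1-k_r^2}$. The Rogers-Ramanujan continued fraction is, for $0<q<1$, $$R(q)=\cfrac{q^{1/5}}{1+\cfrac{q}{1+\cfrac{q^2}{1+\cfrac{q^3}{1+\cdots}}}}.$$ All roots and fractional powers are the positive real ones. *)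

theory Defs
  imports "HOL-Analysis.Analysis"
begin

text \<open>Complete elliptic integral of the first kind; the argument is the modulus,
  intended for \<open>0 \<le> x < 1\<close>.\<close>

definition ellK :: "real \<Rightarrow> real" where
  "ellK x = integral {0..pi/2} (\<lambda>t. 1 / sqrt (1 - x\<^sup>2 * (sin t)\<^sup>2))"

text \<open>The singular modulus \<open>k\<^sub>r\<close> and its complement \<open>k'\<^sub>r\<close>, intended for \<open>r > 0\<close>.\<close>

definition sing_mod :: "real \<Rightarrow> real" where
  "sing_mod r = (THE k. 0 < k \<and> k < 1 \<and> ellK (sqrt (1 - k\<^sup>2)) / ellK k = sqrt r)"

definition sing_mod' :: "real \<Rightarrow> real" where
  "sing_mod' r = sqrt (1 - (sing_mod r)\<^sup>2)"

definition M5 :: "real \<Rightarrow> real" where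
  "M5 r = ellK (sing_mod (25 * r)) / ellK (sing_mod r)"

definition a_r :: "real \<Rightarrow> real" where
  "a_r r = (sing_mod' r / sing_mod' (25 * r))\<^sup>2
             * sqrt (sing_mod r / sing_mod (25 * r)) * M5 r powi (-3)"

text \<open>\<open>rr_denom q j n = 1 + q^(j+1) / (1 + q^(j+2) / (\<dots> / (1 + q^(j+n))))\<close>, so that
  \<open>q powr (1/5) / rr_denom q 0 n\<close> is the \<open>n\<close>-th approximant of the Rogers-Ramanujan
  continued fraction; the value of the infinite fraction is the limit of its approximants.\<close>

primrec rr_denom :: "real \<Rightarrow> nat \<Rightarrow> nat \<Rightarrow> real" where
  "rr_denom q j 0 = 1"
| "rr_denom q j (Suc n) = 1 + q ^ (j + 1) / rr_denom q (j + 1) n"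

definition rr_cfrac :: "real \<Rightarrow> real" where
  "rr_cfrac q = lim (\<lambda>n. q powr (1/5) / rr_denom q 0 n)"

end

theory Submission
  imports Defs
begin

text \<open>
  Write \<open>f(a, b)\<close> for Ramanujan's theta series, \<open>E(q) = (q; q)\<^sub>\<infinity>\<close>, \<open>A = f(- q\<^sup>3, - q\<^sup>2)\<close> and
  \<open>B = f(- q\<^sup>4, - q)\<close>. The three-term recurrence of the Rogers-Selberg series shows that the continued
  fraction equals \<open>q powr (1/5) * B / A\<close>. Regrouping a double series over the Gaussian integers expresses
  \<open>E(p) E(p\<^sup>5)\<close>, where \<open>p\<^sup>5 = q\<close>, as the quadratic form \<open>A\<^sup>2 - p A B - p\<^sup>2 B\<^sup>2\<close>; multiplying over the five
  roots \<open>p\<close> gives \<open>1/x - 11 - x = E(q)\<^sup>6 / (q E(q\<^sup>5)\<^sup>6)\<close> for the fifth power \<open>x\<close> of the fraction.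
  Landen's transformation corresponds to \<open>q \<mapsto> q\<^sup>2\<close> on theta functions, which identifies the singular
  modulus with a theta quotient at \<open>q\<close> and turns \<open>a\<^sub>r\<close> into the eta quotient above. The modular equation
  for the multiplier comes from product formulas for \<open>\<phi>(q)\<^sup>2 - \<phi>(q\<^sup>5)\<^sup>2\<close> and \<open>5 \<phi>(q\<^sup>5)\<^sup>2 - \<phi>(q)\<^sup>2\<close>: both
  are read off from the sums of \<open>q\<close> to the norm over the cosets of the ideal \<open>(2 + \<i>)\<close> of the Gaussian
  integers, together with the triple product.
\<close>

section \<open>Theta series in two variables\<close>

text \<open>Theta series and products are set up over any complete normed field because two facts
  about real \<open>q\<close> need primitive fifth roots of unity: the quintic for the continued
  fraction and the product for \<open>5 * (phi (q ^ 5))\<^sup>2 - (phi q)\<^sup>2\<close>. Both are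
  obtained over the complex numbers and carried back by \<open>of_real\<close>. The singular modulus
  is not found by an intermediate value argument: the theta quotient \<open>kmod q\<close> solves
  its equation, and monotonicity of the ratio of the integrals makes it the only solution. Once
  \<open>ellK (kmod q)\<close> is known to be \<open>pi / 2 * (phi q)\<^sup>2\<close>, the
  multiplier is \<open>(phi (q ^ 5))\<^sup>2 / (phi q)\<^sup>2\<close>. Then
  \<open>1 - M5 r\<close>, \<open>5 * M5 r - 1\<close> and both moduli are monomials in
  \<open>q\<close> (or its square root) and values of \<open>eul\<close>, so the modular equation is
  a comparison of exponents. The constant comes from 4^6 = 256 * 2^4: each of the six factors on the
  left carries a 4, and the squared modulus carries the 2^4. The number 11 is the sum of the fifth
  powers of the golden ratio and its conjugate, and 125 = 11^2 + 4 is the constant term of a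
  discriminant.\<close>

definition tri :: "int \<Rightarrow> nat" where
  "tri n = nat (n * (n + 1) div 2)"

text \<open>As \<open>tri (- n) = n (n - 1) / 2\<close>, the series \<open>ftheta a b\<close> is Ramanujan's \<open>f(a, b)\<close>.\<close>

definition theta_term :: "'a::monoid_mult \<Rightarrow> 'a \<Rightarrow> int \<Rightarrow> 'a" where
  "theta_term a b n = a ^ tri n * b ^ tri (- n)"

definition ftheta :: "'a::{real_normed_field,banach} \<Rightarrow> 'a \<Rightarrow> 'a" where
  "ftheta a b = infsum (theta_term a b) UNIV"

text \<open>The \<open>q\<close>-Pochhammer symbol \<open>(a; q)\<^sub>\<infinity>\<close>.\<close>

definition qp :: "'a::{real_normed_field,banach} \<Rightarrow> 'a \<Rightarrow> 'a" where
  "qp a q = prodinf (\<lambda>k. 1 - a * q ^ k)"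

lemma two_tri: "2 * int (tri n) = n * (n + 1)"
proof -
  have "even (n * (n + 1))" by simp
  moreover have "0 \<le> n * (n + 1)"
    by (cases "n \<ge> 0") (auto simp: mult_nonneg_nonneg intro: mult_nonpos_nonpos)
  ultimately show ?thesis by (simp add: tri_def)
qed

lemma tri_simps [simp]: "tri 0 = 0" "tri (- 1) = 0" "tri 1 = 1"
  by (simp_all add: tri_def)

lemma theta_term_swap: "theta_term a b (- n) = theta_term b a n" for a b :: "'a::comm_monoid_mult"
  by (simp add: theta_term_def mult.commute)

text \<open>Formally the ratio of consecutive terms is \<open>a\<close> times the power of
  \<open>a * b\<close> with exponent \<open>n - 1\<close>. As \<open>n\<close> may be negative,
  powers of \<open>a * b\<close> are spread over both sides until every exponent is natural; the
  offset \<open>m\<close> is the one that occurs in Pascal's rule for \<open>qbin\<close>.\<close>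

lemma theta_term_shift:
  fixes a b :: "'a::comm_monoid_mult"
  assumes "n \<le> int m + 1"
  shows "a * (a * b) ^ m * theta_term a b (n - 1) = (a * b) ^ nat (int m + 1 - n) * theta_term a b n"
proof -
  define k where "k = nat (int m + 1 - n)"
  have k: "int k = int m + 1 - n" using assms by (simp add: k_def)
  have e1: "1 + m + tri (n - 1) = k + tri n"
    using two_tri[of n] two_tri[of "n-1"] k
    by (simp add: algebra_simps flip: of_nat_eq_iff[where ?'a = int])
  have e2: "m + tri (1 - n) = k + tri (- n)"
    using two_tri[of "-n"] two_tri[of "1-n"] k
    by (simp add: algebra_simps flip: of_nat_eq_iff[where ?'a = int])
  have "a * (a * b) ^ m * theta_term a b (n - 1) = a ^ (1 + m + tri (n - 1)) * b ^ (m + tri (1 - n))"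
    by (simp add: theta_term_def power_mult_distrib power_add mult_ac)
  also have "\<dots> = (a * b) ^ k * theta_term a b n"
    unfolding e1 e2 by (simp add: theta_term_def power_mult_distrib power_add mult_ac)
  finally show ?thesis by (simp add: k_def)
qed

lemma theta_term_Suc:
  fixes a b :: "'a::comm_monoid_mult"
  shows "theta_term a b (int (Suc n)) = a * (a * b) ^ n * theta_term a b (int n)"
  using theta_term_shift[of "int (Suc n)" n a b] by simp

text \<open>The ratio of consecutive terms is \<open>a * (a * b) ^ n\<close>, which tends to 0
  however large \<open>a\<close> is.\<close>

lemma summable_theta_term_nat:
  fixes a b :: "'a::{real_normed_field,banach}"
  assumes "norm (a * b) < 1"
  shows "summable (\<lambda>n. norm (theta_term a b (int n)))"
proof -
  have "(\<lambda>n. norm a * norm (a * b) ^ n) \<longlonglongrightarrow> norm a * 0"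
    by (intro tendsto_intros LIMSEQ_power_zero) (use assms in auto)
  hence "eventually (\<lambda>n. norm a * norm (a * b) ^ n < 1/2) sequentially"
    by (rule order_tendstoD) simp
  then obtain N where N: "\<And>n. n \<ge> N \<Longrightarrow> norm a * norm (a * b) ^ n < 1/2"
    by (auto simp: eventually_sequentially)
  show ?thesis
  proof (rule summable_ratio_test[where c = "1/2" and N = N])
    fix n assume "N \<le> n"
    hence "norm a * norm (a * b) ^ n * norm (theta_term a b (int n)) \<le> 1/2 * norm (theta_term a b (int n))"
      using N[of n] by (intro mult_right_mono) auto
    thus "norm (norm (theta_term a b (int (Suc n)))) \<le> 1/2 * norm (norm (theta_term a b (int n)))"
      unfolding theta_term_Suc by (simp add: norm_mult norm_power)
  qed simp
qed

lemma summable_on_int_iff_halves: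
  fixes f :: "int \<Rightarrow> 'b::{topological_comm_monoid_add}"
  assumes "(\<lambda>n. f (int n)) summable_on UNIV" "(\<lambda>n. f (- int n - 1)) summable_on UNIV"
  shows "f summable_on UNIV"
proof -
  have 1: "f summable_on {0..}"
    using assms(1) by (subst summable_on_reindex_bij_witness[of _ int nat UNIV "\<lambda>n. f (int n)"]) auto
  have 2: "f summable_on {..<0}"
    using assms(2)
    by (subst summable_on_reindex_bij_witness[of _ "\<lambda>n. - int n - 1" "\<lambda>n. nat (- n - 1)" UNIV "\<lambda>n. f (- int n - 1)"]) auto
  have "f summable_on ({0..} \<union> {..<0})"
    by (rule summable_on_Un_disjoint[OF 1 2]) auto
  moreover have "{0..} \<union> {..<0} = (UNIV :: int set)" by auto
  ultimately show ?thesis by simp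
qed

lemma theta_term_abs_summable:
  fixes a b :: "'a::{real_normed_field,banach}"
  assumes "norm (a * b) < 1"
  shows "theta_term a b abs_summable_on UNIV"
proof (rule summable_on_int_iff_halves)
  show "(\<lambda>n. norm (theta_term a b (int n))) summable_on UNIV"
    using summable_theta_term_nat[OF assms] by (intro norm_summable_imp_summable_on) simp
  have "summable (\<lambda>n. norm (theta_term b a (int (Suc n))))"
    using summable_theta_term_nat[of b a] assms
    by (subst summable_Suc_iff) (simp add: mult.commute)
  thus "(\<lambda>n. norm (theta_term a b (- int n - 1))) summable_on UNIV"
  proof (intro norm_summable_imp_summable_on)
    have "theta_term a b (- int n - 1) = theta_term b a (int (Suc n))" for n
    proof -
      have "- int n - 1 = - int (Suc n)" by simp
      thus ?thesis by (simp only: theta_term_swap)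
    qed
    thus "summable (\<lambda>n. norm (norm (theta_term a b (- int n - 1))))"
      using \<open>summable _\<close> by simp
  qed
qed

lemma theta_term_summable:
  fixes a b :: "'a::{real_normed_field,banach}"
  assumes "norm (a * b) < 1"
  shows "theta_term a b summable_on UNIV"
  using theta_term_abs_summable[OF assms] by (rule abs_summable_summable)

lemma ftheta_has_sum:
  fixes a b :: "'a::{real_normed_field,banach}"
  assumes "norm (a * b) < 1"
  shows "(theta_term a b has_sum ftheta a b) UNIV"
  using theta_term_summable[OF assms] by (simp add: ftheta_def)

lemma of_real_ftheta:
  assumes "norm (a * b) < 1"
  shows "ftheta (of_real a) (of_real b) = (of_real (ftheta a b) :: 'a::{real_normed_field,banach})"
proof -
  have "((\<lambda>n. of_real (theta_term a b n) :: 'a) has_sum of_real (ftheta a b)) UNIV"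
    by (intro has_sum_of_real ftheta_has_sum assms)
  moreover have "(\<lambda>n. of_real (theta_term a b n) :: 'a) = theta_term (of_real a) (of_real b)"
    by (auto simp: theta_term_def)
  ultimately show ?thesis by (simp add: ftheta_def infsumI)
qed

text \<open>Dominated convergence for two-sided sums, from Tannery's theorem along the enumeration
  \<open>int_decode\<close>. It serves the triple product and the limits of theta series at nome
  0.\<close>

lemma tannery_int:
  fixes f :: "nat \<Rightarrow> int \<Rightarrow> 'a::{real_normed_field,banach}"
  assumes "\<And>n. (\<lambda>N. f N n) \<longlonglongrightarrow> g n" "\<And>N n. norm (f N n) \<le> M n" "M summable_on UNIV"
  shows "(\<lambda>N. infsum (f N) UNIV) \<longlonglongrightarrow> infsum g UNIV"
proof -
  have bij: "bij_betw int_decode UNIV UNIV" by (rule bij_int_decode)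
  have sM: "summable (\<lambda>k. M (int_decode k))"
    using assms(3) summable_on_reindex_bij_betw[OF bij, of M]
    by (intro summable_on_imp_summable) simp
  have T: "eventually (\<lambda>N. summable (\<lambda>k. norm (f N (int_decode k)))) sequentially \<and>
           summable (\<lambda>n. norm (g (int_decode n))) \<and>
           ((\<lambda>N. suminf (\<lambda>k. f N (int_decode k))) \<longlonglongrightarrow> suminf (\<lambda>k. g (int_decode k)))"
    by (rule tannerys_theorem[where M = "\<lambda>k. M (int_decode k)"])
       (use assms sM in \<open>auto intro!: always_eventually\<close>)
  have eq: "infsum h UNIV = (\<Sum>k. h (int_decode k))"
    if "summable (\<lambda>k. norm (h (int_decode k)))" for h :: "int \<Rightarrow> 'a"
  proof -
    have "infsum h UNIV = infsum (\<lambda>k. h (int_decode k)) UNIV"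
      using infsum_reindex_bij_betw[OF bij, of h] by simp
    also have "((\<lambda>k. h (int_decode k)) has_sum (\<Sum>k. h (int_decode k))) UNIV"
      using that by (intro norm_summable_imp_has_sum) (auto dest: summable_norm_cancel simp: summable_sums)
    hence "infsum (\<lambda>k. h (int_decode k)) UNIV = (\<Sum>k. h (int_decode k))" by (rule infsumI)
    finally show ?thesis .
  qed
  have "eventually (\<lambda>N. (\<Sum>k. f N (int_decode k)) = infsum (f N) UNIV) sequentially"
    using T by (auto elim!: eventually_mono simp: eq)
  moreover have "(\<lambda>N. suminf (\<lambda>k. f N (int_decode k))) \<longlonglongrightarrow> infsum g UNIV"
    using T by (simp add: eq)
  ultimately show ?thesis by (rule Lim_transform_eventually[rotated])
qed

section \<open>Infinite products\<close>

lemma one_minus_power_neq_0: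
  fixes q :: "'a::real_normed_field"
  assumes "norm q < 1"
  shows "1 - q ^ Suc k \<noteq> 0"
proof
  assume "1 - q ^ Suc k = 0"
  hence "norm (q ^ Suc k) = 1" by simp
  moreover have "norm q ^ Suc k \<le> norm q ^ 1" using assms by (intro power_decreasing) auto
  ultimately show False using assms by (simp add: norm_power norm_mult)
qed

lemma convergent_qp:
  fixes a q :: "'a::{real_normed_field,banach}"
  assumes "norm q < 1"
  shows "convergent_prod (\<lambda>k. 1 - a * q ^ k)"
proof -
  have "summable (\<lambda>k. norm a * norm q ^ k)"
    using assms by (intro summable_mult summable_geometric) auto
  thus ?thesis
    by (intro abs_convergent_prod_imp_convergent_prod summable_imp_abs_convergent_prod)
       (simp add: norm_mult norm_power)
qed

lemma qp_LIMSEQ: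
  fixes a q :: "'a::{real_normed_field,banach}"
  assumes "norm q < 1"
  shows "(\<lambda>n. \<Prod>k<n. 1 - a * q ^ k) \<longlonglongrightarrow> qp a q"
proof -
  have "(\<lambda>n. \<Prod>k\<le>n. 1 - a * q ^ k) \<longlonglongrightarrow> qp a q"
    unfolding qp_def by (rule convergent_prod_LIMSEQ[OF convergent_qp[OF assms]])
  thus ?thesis
    by (subst filterlim_sequentially_Suc [symmetric]) (simp add: lessThan_Suc_atMost)
qed

lemma qp_nonzero:
  fixes a q :: "'a::{real_normed_field,banach}"
  assumes "norm q < 1" "\<And>k. a * q ^ k \<noteq> 1"
  shows "qp a q \<noteq> 0"
  unfolding qp_def using convergent_qp[OF assms(1), of a] assms(2)
  by (intro prodinf_nonzero) auto

lemma qp_nonzero':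
  fixes a q :: "'a::{real_normed_field,banach}"
  assumes "norm q < 1" "norm a < 1"
  shows "qp a q \<noteq> 0"
proof (rule qp_nonzero[OF assms(1)])
  fix k
  have "norm (a * q ^ k) \<le> norm a * 1"
    unfolding norm_mult norm_power using assms by (intro mult_left_mono power_le_one) auto
  thus "a * q ^ k \<noteq> 1" using assms by auto
qed

lemma qp_ge_0:
  fixes a q :: real
  assumes "\<bar>q\<bar> < 1" "\<bar>a\<bar> \<le> 1"
  shows "qp a q \<ge> 0"
proof (rule tendsto_lowerbound[OF qp_LIMSEQ[of q a]])
  have "a * q ^ k \<le> 1" for k
  proof -
    have "\<bar>a\<bar> * \<bar>q\<bar> ^ k \<le> 1 * 1" using assms by (intro mult_mono power_le_one) auto
    hence "\<bar>a * q ^ k\<bar> \<le> 1" by (simp add: abs_mult power_abs)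
    thus ?thesis by linarith
  qed
  thus "\<forall>\<^sub>F n in sequentially. 0 \<le> (\<Prod>k<n. 1 - a * q ^ k)"
    by (intro always_eventually allI prod_nonneg) auto
qed (use assms in auto)

lemma qp_pos:
  fixes a q :: real
  assumes "\<bar>q\<bar> < 1" "\<bar>a\<bar> < 1"
  shows "qp a q > 0"
  using qp_ge_0[of q a] qp_nonzero'[of q a] assms by auto

lemma of_real_qp:
  assumes "\<bar>q\<bar> < 1"
  shows "qp (of_real a) (of_real q) = (of_real (qp a q) :: 'a::{real_normed_field,banach})"
proof -
  have "(\<lambda>n. of_real (\<Prod>k<n. 1 - a * q ^ k) :: 'a) \<longlonglongrightarrow> of_real (qp a q)"
    by (intro tendsto_of_real qp_LIMSEQ) (use assms in auto)
  moreover have "(\<lambda>n. \<Prod>k<n. 1 - of_real a * of_real q ^ k :: 'a) \<longlonglongrightarrow> qp (of_real a) (of_real q)"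
    by (intro qp_LIMSEQ) (use assms in auto)
  ultimately show ?thesis by (simp add: LIMSEQ_unique)
qed

section \<open>The triple product\<close>

definition qfact :: "'a::comm_ring_1 \<Rightarrow> nat \<Rightarrow> 'a" where
  "qfact q n = (\<Prod>k<n. 1 - q ^ Suc k)"

text \<open>Gaussian binomial coefficients. The integer index and the value 0 outside the range let
  sums be shifted and extended without boundary terms.\<close>

definition qbin :: "'a::field \<Rightarrow> nat \<Rightarrow> int \<Rightarrow> 'a" where
  "qbin q K i = (if 0 \<le> i \<and> i \<le> int K then qfact q K / (qfact q (nat i) * qfact q (nat (int K - i))) else 0)"

lemma qfact_nonzero:
  fixes q :: "'a::real_normed_field"
  assumes "norm q < 1"
  shows "qfact q n \<noteq> 0"
  using one_minus_power_neq_0[OF assms] by (simp add: qfact_def)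

lemma qfact_Suc: "qfact q (Suc n) = qfact q n * (1 - q ^ Suc n)"
  by (simp add: qfact_def)

lemma qfact_LIMSEQ:
  fixes q :: "'a::{real_normed_field,banach}"
  assumes "norm q < 1"
  shows "qfact q \<longlonglongrightarrow> qp q q"
  using qp_LIMSEQ[OF assms, of q] by (simp add: qfact_def[abs_def])

lemma qbin_Suc:
  fixes q :: "'a::real_normed_field"
  assumes "norm q < 1" "i \<le> int K + 1"
  shows "qbin q (Suc K) i = qbin q K i + q ^ nat (int K + 1 - i) * qbin q K (i - 1)"
proof -
  note nz = qfact_nonzero[OF assms(1)]
  consider "i < 0" | "i = 0" | "i = int K + 1" | "0 < i" "i \<le> int K" using assms(2) by linarith
  thus ?thesis
  proof cases
    case 4
    define j where "j = nat i - 1"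
    define l where "l = K - nat i"
    have j: "i = int (Suc j)" "K = Suc (j + l)" using 4 by (auto simp: j_def l_def)
    have nz': "1 - q ^ Suc j \<noteq> 0" "1 - q ^ Suc l \<noteq> 0" using one_minus_power_neq_0[OF assms(1)] by blast+
    define x y where "x = q ^ Suc j" "y = q ^ Suc l"
    have p: "q ^ Suc (Suc (j + l)) = x * y" by (simp add: x_y_def power_add)
    have "qbin q (Suc K) i = qfact q K * (1 - x * y) / (qfact q j * (1 - x) * (qfact q l * (1 - y)))"
      using 4 j by (simp add: qbin_def nat_add_distrib qfact_Suc p x_y_def power_add mult_ac)
    moreover have "qbin q K i = qfact q K / (qfact q j * (1 - x) * qfact q l)"
      using 4 j by (simp add: qbin_def qfact_Suc x_y_def nat_add_distrib)
    moreover have "qbin q K (i - 1) = qfact q K / (qfact q j * (qfact q l * (1 - y)))"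
    proof -
      have "int K - (i - 1) = int (Suc l)" using j by simp
      hence "nat (int K - (i - 1)) = Suc l" by (metis nat_int)
      thus ?thesis using 4 j by (simp add: qbin_def qfact_Suc x_y_def)
    qed
    moreover have "nat (int K + 1 - i) = Suc l" using j by simp
    hence "q ^ nat (int K + 1 - i) = y" by (simp add: x_y_def)
    \<comment> \<open>Over a common denominator this is
      \<open>1 - x * y = (1 - y) + y * (1 - x)\<close>.\<close>
    moreover have "qfact q K * (1 - x * y) / (qfact q j * (1 - x) * (qfact q l * (1 - y))) =
         qfact q K / (qfact q j * (1 - x) * qfact q l) + y * (qfact q K / (qfact q j * (qfact q l * (1 - y))))"
      using nz[of j] nz[of l] nz' unfolding x_y_def[symmetric] by (simp add: divide_simps) (simp add: algebra_simps)
    ultimately show ?thesis by presburger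
  qed (use nz in \<open>auto simp: qbin_def qfact_def nat_add_distrib\<close>)
qed

lemma qbin_sym: "qbin q K (int K - i) = qbin q K i"
  by (auto simp: qbin_def mult_ac)

text \<open>Pascal's rule splits each coefficient in two; by \<open>theta_term_shift\<close> the
  second parts add up to the old sum times \<open>a * (a * b) ^ m\<close>, which is the effect of
  the new factor.\<close>

lemma theta_finite_step:
  fixes a b :: "'a::real_normed_field"
  assumes "norm (a * b) < 1"
    and "(\<Prod>k<m. 1 + a * (a * b) ^ k) * (\<Prod>k<l. 1 + b * (a * b) ^ k) =
         (\<Sum>n=-int l..int m. qbin (a * b) (m + l) (int l + n) * theta_term a b n)"
  shows "(\<Prod>k<Suc m. 1 + a * (a * b) ^ k) * (\<Prod>k<l. 1 + b * (a * b) ^ k) =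
         (\<Sum>n=-int l..int (Suc m). qbin (a * b) (Suc m + l) (int l + n) * theta_term a b n)"
proof -
  let ?t = "theta_term a b" and ?Q = "a * b"
  have "(\<Sum>n=-int l..int (Suc m). qbin ?Q (Suc m + l) (int l + n) * ?t n) =
        (\<Sum>n=-int l..int (Suc m). qbin ?Q (m + l) (int l + n) * ?t n) +
        (\<Sum>n=-int l..int (Suc m). a * ?Q ^ m * (qbin ?Q (m + l) (int l + (n - 1)) * ?t (n - 1)))"
    unfolding sum.distrib[symmetric]
  proof (rule sum.cong[OF refl])
    fix n assume n: "n \<in> {-int l..int (Suc m)}"
    have "qbin ?Q (Suc m + l) (int l + n) = 
        qbin ?Q (m + l) (int l + n) + ?Q ^ nat (int m + 1 - n) * qbin ?Q (m + l) (int l + (n - 1))"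
      using qbin_Suc[OF assms(1), of "int l + n" "m + l"] n by (simp add: algebra_simps)
    thus "qbin ?Q (Suc m + l) (int l + n) * ?t n = qbin ?Q (m + l) (int l + n) * ?t n +
         a * ?Q ^ m * (qbin ?Q (m + l) (int l + (n - 1)) * ?t (n - 1))"
      using theta_term_shift[of n m a b] n by (simp add: algebra_simps)
  qed
  also have "(\<Sum>n=-int l..int (Suc m). qbin ?Q (m + l) (int l + n) * ?t n) =
             (\<Sum>n=-int l..int m. qbin ?Q (m + l) (int l + n) * ?t n)"
    by (rule sum.mono_neutral_right) (auto simp: qbin_def)
  also have "(\<Sum>n=-int l..int (Suc m). a * ?Q ^ m * (qbin ?Q (m + l) (int l + (n - 1)) * ?t (n - 1))) =
             (\<Sum>n=-int l-1..int m. a * ?Q ^ m * (qbin ?Q (m + l) (int l + n) * ?t n))"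
    by (rule sum.reindex_bij_witness[of _ "\<lambda>n. n + 1" "\<lambda>n. n - 1"]) auto
  also have "\<dots> = (\<Sum>n=-int l..int m. a * ?Q ^ m * (qbin ?Q (m + l) (int l + n) * ?t n))"
    by (rule sum.mono_neutral_right) (auto simp: qbin_def)
  finally show ?thesis
    by (simp add: sum_distrib_left[symmetric] assms(2)[symmetric]) (simp add: algebra_simps)
qed

lemma theta_finite_swap:
  fixes a b :: "'a::field"
  shows "(\<Sum>n=-int l..int m. qbin (a * b) (m + l) (int l + n) * theta_term a b n) =
         (\<Sum>n=-int m..int l. qbin (b * a) (l + m) (int m + n) * theta_term b a n)"
proof (rule sum.reindex_bij_witness[of _ uminus uminus])
  fix n
  have e: "int (l + m) - (int l + n) = int m + (- n)" by simp
  show "qbin (b * a) (l + m) (int m + (- n)) * theta_term b a (- n) =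
        qbin (a * b) (m + l) (int l + n) * theta_term a b n"
    using qbin_sym[of "b * a" "l + m" "int l + n"] unfolding e theta_term_swap
    by (simp add: mult.commute add.commute)
qed auto

text \<open>The finite triple product. Reflection of \<open>n\<close> exchanges \<open>a\<close>
  with \<open>b\<close> and \<open>m\<close> with \<open>l\<close>, so the same step serves both
  inductions.\<close>

lemma theta_finite:
  fixes a b :: "'a::real_normed_field"
  assumes "norm (a * b) < 1"
  shows "(\<Prod>k<m. 1 + a * (a * b) ^ k) * (\<Prod>k<l. 1 + b * (a * b) ^ k) =
         (\<Sum>n=-int l..int m. qbin (a * b) (m + l) (int l + n) * theta_term a b n)"
proof (induction m)
  case 0
  have "(\<Prod>k<l. 1 + b * (b * a) ^ k) * (\<Prod>k<(0::nat). 1 + a * (b * a) ^ k) =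
         (\<Sum>n=-int 0..int l. qbin (b * a) (l + 0) (int 0 + n) * theta_term b a n)"
  proof (induction l)
    case 0
    show ?case by (simp add: qbin_def qfact_def theta_term_def)
  next
    case (Suc l)
    show ?case by (rule theta_finite_step) (use Suc assms in \<open>auto simp: mult.commute\<close>)
  qed
  thus ?case using theta_finite_swap[of a b 0 l] by (simp add: mult.commute)
next
  case (Suc m)
  show ?case by (rule theta_finite_step[OF assms Suc])
qed

theorem jacobi_triple_product:
  fixes a b :: "'a::{real_normed_field,banach}"
  assumes ab: "norm (a * b) < 1"
  shows "ftheta a b = qp (- a) (a * b) * qp (- b) (a * b) * qp (a * b) (a * b)"
proof -
  let ?Q = "a * b" and ?t = "theta_term a b"
  define f where "f = (\<lambda>N n. qbin ?Q (N + N) (int N + n) * ?t n)"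
  have E: "qp ?Q ?Q \<noteq> 0" using ab by (intro qp_nonzero') auto
  note lim = qfact_LIMSEQ[OF ab]
  have sum_f: "infsum (f N) UNIV = (\<Prod>k<N. 1 - (- a) * ?Q ^ k) * (\<Prod>k<N. 1 - (- b) * ?Q ^ k)" for N
  proof -
    have "infsum (f N) UNIV = infsum (f N) {-int N..int N}"
      by (rule infsum_cong_neutral) (auto simp: f_def qbin_def)
    also have "\<dots> = (\<Prod>k<N. 1 + a * ?Q ^ k) * (\<Prod>k<N. 1 + b * ?Q ^ k)"
      using theta_finite[OF ab, of N N] by (simp add: f_def)
    finally show ?thesis by simp
  qed
  have limf: "(\<lambda>N. f N n) \<longlonglongrightarrow> inverse (qp ?Q ?Q) * ?t n" for n
  proof -
    have l1: "filterlim (\<lambda>N. N + N) at_top sequentially"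
      by (rule filterlim_subseq) (auto simp: strict_mono_def)
    have l2: "filterlim (\<lambda>N. nat (int N + n)) at_top sequentially"
      unfolding filterlim_at_top
    proof
      fix Z show "\<forall>\<^sub>F x in sequentially. Z \<le> nat (int x + n)"
        using eventually_ge_at_top[of "Z + nat \<bar>n\<bar>"] by eventually_elim linarith
    qed
    have l3: "filterlim (\<lambda>N. nat (int N - n)) at_top sequentially"
      unfolding filterlim_at_top
    proof
      fix Z show "\<forall>\<^sub>F x in sequentially. Z \<le> nat (int x - n)"
        using eventually_ge_at_top[of "Z + nat \<bar>n\<bar>"] by eventually_elim linarith
    qed
    have "(\<lambda>N. qfact ?Q (N + N) / (qfact ?Q (nat (int N + n)) * qfact ?Q (nat (int N - n))) * ?t n)
           \<longlonglongrightarrow> qp ?Q ?Q / (qp ?Q ?Q * qp ?Q ?Q) * ?t n"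
      by (intro tendsto_intros filterlim_compose[OF lim] l1 l2 l3) (use E in auto)
    moreover have "\<forall>\<^sub>F N in sequentially. qfact ?Q (N + N) / (qfact ?Q (nat (int N + n)) * qfact ?Q (nat (int N - n))) * ?t n = f N n"
      using eventually_ge_at_top[of "nat \<bar>n\<bar>"] by eventually_elim (auto simp: f_def qbin_def)
    ultimately show ?thesis
      using E by (simp add: Lim_transform_eventually field_simps)
  qed
  \<comment> \<open>The q-factorials and their reciprocals converge, hence are bounded. This
    dominates all coefficients uniformly in \<open>N\<close>.\<close>
  obtain C where C: "\<And>n. norm (qfact ?Q n) \<le> C"
    using convergent_imp_Bseq[OF convergentI[OF lim]] by (auto simp: Bseq_def)
  have "(\<lambda>n. inverse (qfact ?Q n)) \<longlonglongrightarrow> inverse (qp ?Q ?Q)"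
    by (intro tendsto_intros lim E)
  then obtain D where D: "\<And>n. norm (inverse (qfact ?Q n)) \<le> D"
    using convergent_imp_Bseq[OF convergentI] by (fastforce simp: Bseq_def)
  have CD: "0 \<le> C" "0 \<le> D" using C[of 0] D[of 0] norm_ge_zero order.trans by blast+
  have bound: "norm (f N n) \<le> C * (D * D) * norm (?t n)" for N n
  proof -
    have "norm (qbin ?Q (N + N) (int N + n)) \<le> C * (D * D)"
      using CD by (auto simp: qbin_def divide_inverse norm_mult simp del: norm_inverse intro!: mult_mono C D)
    thus ?thesis by (auto simp: f_def norm_mult intro: mult_right_mono)
  qed
  have "(\<lambda>N. infsum (f N) UNIV) \<longlonglongrightarrow> infsum (\<lambda>n. inverse (qp ?Q ?Q) * ?t n) UNIV"
    by (rule tannery_int[OF limf bound]) (intro summable_on_cmult_right theta_term_abs_summable ab)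
  also have "infsum (\<lambda>n. inverse (qp ?Q ?Q) * ?t n) UNIV = inverse (qp ?Q ?Q) * ftheta a b"
    by (simp add: ftheta_def infsum_cmult_right')
  finally have "(\<lambda>N. infsum (f N) UNIV) \<longlonglongrightarrow> inverse (qp ?Q ?Q) * ftheta a b" .
  moreover have "(\<lambda>N. infsum (f N) UNIV) \<longlonglongrightarrow> qp (- a) ?Q * qp (- b) ?Q"
    unfolding sum_f by (intro tendsto_mult qp_LIMSEQ ab)
  ultimately have "inverse (qp ?Q ?Q) * ftheta a b = qp (- a) ?Q * qp (- b) ?Q"
    by (rule LIMSEQ_unique)
  thus ?thesis using E by (simp add: field_simps)
qed

section \<open>Splitting products over residue classes and roots of unity\<close>

abbreviation eul :: "'a::{real_normed_field,banach} \<Rightarrow> 'a" where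
  "eul q \<equiv> qp q q"

lemma norm_power_less_1:
  fixes q :: "'a::real_normed_div_algebra"
  assumes "norm q < 1" "m > 0"
  shows "norm (q ^ m) < 1"
  using assms by (auto simp: norm_power power_less_one_iff)

lemma qp_split:
  fixes a q :: "'a::{real_normed_field,banach}"
  assumes q: "norm q < 1" and m: "m > 0"
  shows "qp a q = (\<Prod>i<m. qp (a * q ^ i) (q ^ m))"
proof -
  have "(\<lambda>N. \<Prod>i<m. \<Prod>j<N. 1 - a * q ^ i * (q ^ m) ^ j) \<longlonglongrightarrow> (\<Prod>i<m. qp (a * q ^ i) (q ^ m))"
    by (intro tendsto_prod qp_LIMSEQ norm_power_less_1 q m)
  moreover have "(\<Prod>i<m. \<Prod>j<N. 1 - a * q ^ i * (q ^ m) ^ j) = (\<Prod>k<N*m. 1 - a * q ^ k)" for N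
  proof -
    have "(\<Prod>k<N*m. 1 - a * q ^ k) = (\<Prod>j<N. \<Prod>k\<in>{j*m..<j*m+m}. 1 - a * q ^ k)"
      by (rule prod.nat_group [symmetric])
    also have "\<dots> = (\<Prod>j<N. \<Prod>i<m. 1 - a * q ^ (i + j * m))"
    proof (rule prod.cong[OF refl])
      fix j
      show "(\<Prod>k\<in>{j*m..<j*m+m}. 1 - a * q ^ k) = (\<Prod>i<m. 1 - a * q ^ (i + j * m))"
        by (rule prod.reindex_bij_witness[of _ "\<lambda>i. i + j * m" "\<lambda>k. k - j * m"]) auto
    qed
    also have "\<dots> = (\<Prod>i<m. \<Prod>j<N. 1 - a * q ^ (i + j * m))"
      by (rule prod.swap)
    finally show ?thesis by (simp add: power_add power_mult mult_ac flip: power_mult)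
  qed
  moreover have "(\<lambda>N. \<Prod>k<N*m. 1 - a * q ^ k) \<longlonglongrightarrow> qp a q"
    by (rule filterlim_compose[OF qp_LIMSEQ[OF q]], rule filterlim_subseq) (use m in \<open>auto simp: strict_mono_def\<close>)
  ultimately show ?thesis by (simp add: LIMSEQ_unique)
qed

lemma qp_prod_eq:
  fixes a q :: "'i \<Rightarrow> 'a::{real_normed_field,banach}"
  assumes "\<And>i. i \<in> I \<Longrightarrow> norm (q i) < 1" "norm p < 1"
    and eq: "\<And>k. (\<Prod>i\<in>I. 1 - a i * q i ^ k) = 1 - b * p ^ k"
  shows "(\<Prod>i\<in>I. qp (a i) (q i)) = qp b p"
proof -
  have "(\<lambda>N. \<Prod>i\<in>I. \<Prod>k<N. 1 - a i * q i ^ k) \<longlonglongrightarrow> (\<Prod>i\<in>I. qp (a i) (q i))"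
    by (intro tendsto_prod qp_LIMSEQ assms)
  moreover have "(\<lambda>N. \<Prod>i\<in>I. \<Prod>k<N. 1 - a i * q i ^ k) \<longlonglongrightarrow> qp b p"
    using qp_LIMSEQ[OF assms(2), of b] by (subst prod.swap) (simp add: eq)
  ultimately show ?thesis by (rule LIMSEQ_unique)
qed

lemma qp_head:
  fixes a q :: "'a::{real_normed_field,banach}"
  assumes q: "norm q < 1"
  shows "qp a q = (1 - a) * qp (a * q) q"
proof -
  have "(\<lambda>N. (1 - a) * (\<Prod>k<N. 1 - a * q * q ^ k)) \<longlonglongrightarrow> (1 - a) * qp (a * q) q"
    by (intro tendsto_mult tendsto_const qp_LIMSEQ q)
  moreover have "(1 - a) * (\<Prod>k<N. 1 - a * q * q ^ k) = (\<Prod>k<Suc N. 1 - a * q ^ k)" for N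
    by (subst prod.lessThan_Suc_shift) (simp add: mult.assoc)
  moreover have "(\<lambda>N. \<Prod>k<Suc N. 1 - a * q ^ k) \<longlonglongrightarrow> qp a q"
    by (rule LIMSEQ_Suc[OF qp_LIMSEQ[OF q]])
  ultimately show ?thesis by (simp add: LIMSEQ_unique)
qed

lemma qp_mult_uminus:
  fixes a q :: "'a::{real_normed_field,banach}"
  assumes q: "norm q < 1"
  shows "qp a q * qp (- a) q = qp (a\<^sup>2) (q\<^sup>2)"
proof -
  have "(\<Prod>s\<in>{True,False}. qp (if s then a else - a) q) = qp (a\<^sup>2) (q\<^sup>2)"
  proof (rule qp_prod_eq)
    show "(\<Prod>s\<in>{True,False}. 1 - (if s then a else - a) * q ^ k) = 1 - a\<^sup>2 * (q\<^sup>2) ^ k" for k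
      by (simp add: power2_eq_square power_mult_distrib algebra_simps)
  qed (use q norm_power_less_1[OF q, of 2] in auto)
  thus ?thesis by simp
qed

section \<open>Products over the fifth roots of unity\<close>

lemma fifth_root_power_eq_1:
  fixes z :: "'a::comm_ring_1"
  assumes "1 + z + z ^ 2 + z ^ 3 + z ^ 4 = 0"
  shows "z ^ 5 = 1"
proof -
  have "z ^ 5 - 1 = (z - 1) * (1 + z + z ^ 2 + z ^ 3 + z ^ 4)"
    by (simp add: algebra_simps eval_nat_numeral)
  thus ?thesis using assms by simp
qed

lemma power_mod_5:
  fixes z :: "'a::comm_ring_1"
  assumes "z ^ 5 = 1"
  shows "z ^ n = z ^ (n mod 5)"
proof -
  have "z ^ n = z ^ (5 * (n div 5) + n mod 5)" by simp
  also have "\<dots> = z ^ (n mod 5)" unfolding power_add power_mult by (simp add: assms)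
  finally show ?thesis .
qed

lemma fifth_root_prod:
  fixes z x :: "'a::comm_ring_1"
  assumes z: "1 + z + z ^ 2 + z ^ 3 + z ^ 4 = 0"
  shows "(1 - x) * (1 - z * x) * (1 - z ^ 2 * x) * (1 - z ^ 3 * x) * (1 - z ^ 4 * x) = 1 - x ^ 5"
proof -
  note z5 = fifth_root_power_eq_1[OF z]
  \<comment> \<open>Pairing conjugate factors leaves only the two quadratic periods, whose sum and
    product are both -1.\<close>
  define s t where "s = z + z ^ 4" "t = z ^ 2 + z ^ 3"
  have st: "t = - 1 - s" using z unfolding s_t_def by (simp add: algebra_simps eq_neg_iff_add_eq_0)
  have "s * t = z ^ 3 + z ^ 4 + z ^ 6 + z ^ 7"
    unfolding s_t_def by (simp add: algebra_simps flip: power_add power_Suc)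
  also have "\<dots> = s + t" using power_mod_5[OF z5, of 6] power_mod_5[OF z5, of 7] unfolding s_t_def by simp
  finally have st2: "s * t = - 1" using st by simp
  have 1: "(1 - z * x) * (1 - z ^ 4 * x) = 1 - s * x + x ^ 2"
    using z5 unfolding s_t_def by (simp add: algebra_simps eval_nat_numeral)
  have 2: "(1 - z ^ 2 * x) * (1 - z ^ 3 * x) = 1 - t * x + x ^ 2"
  proof -
    have "(1 - z ^ 2 * x) * (1 - z ^ 3 * x) = 1 - t * x + z ^ 5 * x ^ 2"
      unfolding s_t_def by (simp add: algebra_simps eval_nat_numeral)
    thus ?thesis by (simp add: z5)
  qed
  have "(1 - x) * (1 - z * x) * (1 - z ^ 2 * x) * (1 - z ^ 3 * x) * (1 - z ^ 4 * x) =
        (1 - x) * ((1 - s * x + x ^ 2) * (1 - t * x + x ^ 2))"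
    unfolding 1[symmetric] 2[symmetric] by (simp add: mult_ac)
  also have "(1 - s * x + x ^ 2) * (1 - t * x + x ^ 2) = 
        1 - (s + t) * x + (2 + s * t) * x ^ 2 - (s + t) * x ^ 3 + x ^ 4"
    by (simp add: algebra_simps eval_nat_numeral)
  also have "\<dots> = 1 + x + x ^ 2 + x ^ 3 + x ^ 4" unfolding st2 by (simp add: st)
  also have "(1 - x) * \<dots> = 1 - x ^ 5" by (simp add: algebra_simps eval_nat_numeral)
  finally show ?thesis .
qed

lemma lessThan_5: "{..<5::nat} = {0,1,2,3,4}"
  by auto

lemma qp_fifth_roots:
  fixes z x q :: "'a::{real_normed_field,banach}"
  assumes z: "1 + z + z ^ 2 + z ^ 3 + z ^ 4 = 0" and q: "norm q < 1"
  shows "(\<Prod>j<5. qp (z ^ j * x) q) = qp (x ^ 5) (q ^ 5)"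
proof (rule qp_prod_eq)
  fix k
  show "(\<Prod>j<5. 1 - z ^ j * x * q ^ k) = 1 - x ^ 5 * (q ^ 5) ^ k"
    using fifth_root_prod[OF z, of "x * q ^ k"] unfolding lessThan_5
    by (simp add: mult_ac power_mult_distrib flip: power_mult)
qed (use q norm_power_less_1[of q 5] in auto)

lemma norm_fifth_root:
  fixes z :: "'a::real_normed_field"
  assumes z: "1 + z + z ^ 2 + z ^ 3 + z ^ 4 = 0"
  shows "norm z = 1"
proof -
  have "norm z ^ 5 = 1 ^ 5" using fifth_root_power_eq_1[OF z] by (metis norm_one norm_power power_one)
  thus ?thesis by (subst (asm) power_eq_iff_eq_base) auto
qed

lemma fifth_root_cycle:
  fixes z :: "'a::comm_ring_1"
  assumes z: "1 + z + z ^ 2 + z ^ 3 + z ^ 4 = 0" and "i \<in> {1,2,3,4::nat}"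
  shows "1 + z ^ i + (z ^ i) ^ 2 + (z ^ i) ^ 3 + (z ^ i) ^ 4 = 0"
proof -
  have e: "(z ^ i) ^ k = z ^ (i * k mod 5)" for k
    using power_mod_5[OF fifth_root_power_eq_1[OF z], of "i * k"] by (simp add: power_mult)
  show ?thesis
    unfolding e using assms(2) z by (auto simp: add_ac power2_eq_square)
qed

text \<open>Sort the factors of \<open>eul (z ^ j * p)\<close> by their exponent modulo 5. For
  exponents prime to 5 the five values of \<open>j\<close> run through all fifth roots and merge
  into one factor in \<open>p ^ 5\<close>; for multiples of 5 nothing depends on \<open>j\<close>,
  which leaves \<open>eul (p ^ 5) ^ 5\<close>. The merged classes together give
  \<open>eul (p ^ 5) / eul (p ^ 25)\<close>.\<close>

lemma eul_fifth_roots: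
  fixes z p :: "'a::{real_normed_field,banach}"
  assumes z: "1 + z + z ^ 2 + z ^ 3 + z ^ 4 = 0" and p: "norm p < 1"
  shows "(\<Prod>j<5. eul (z ^ j * p)) * eul (p ^ 25) = eul (p ^ 5) ^ 6"
proof -
  note z5 = fifth_root_power_eq_1[OF z]
  have q: "norm (p ^ 5) < 1" using p by (intro norm_power_less_1) auto
  have "eul (z ^ j * p) = (\<Prod>i<5. qp ((z ^ j * p) ^ Suc i) (p ^ 5))" for j
  proof -
    have "(z ^ j * p) ^ 5 = p ^ 5"
      using z5 by (metis (no_types, lifting) mult.commute mult_1 power_mult power_mult_distrib power_one)
    moreover have "norm (z ^ j * p) < 1"
      using p norm_fifth_root[OF z] by (simp add: norm_mult norm_power)
    ultimately show ?thesis using qp_split[of "z ^ j * p" 5 "z ^ j * p"] by simp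
  qed
  hence "(\<Prod>j<5. eul (z ^ j * p)) = (\<Prod>i<5. \<Prod>j<5. qp ((z ^ j * p) ^ Suc i) (p ^ 5))"
    by (simp only:) (rule prod.swap)
  also have "\<dots> = (\<Prod>i<4. \<Prod>j<5. qp ((z ^ j * p) ^ Suc i) (p ^ 5)) * (\<Prod>j<5. qp ((z ^ j * p) ^ 5) (p ^ 5))"
    by (simp add: eval_nat_numeral)
  also have "(\<Prod>j<5. qp ((z ^ j * p) ^ 5) (p ^ 5)) = (\<Prod>j<(5::nat). eul (p ^ 5))"
  proof (rule prod.cong[OF refl])
    fix j
    have "(z ^ j * p) ^ 5 = p ^ 5"
      using z5 by (metis (no_types, lifting) mult.commute mult_1 power_mult power_mult_distrib power_one)
    thus "qp ((z ^ j * p) ^ 5) (p ^ 5) = eul (p ^ 5)" by simp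
  qed
  also have "\<dots> = eul (p ^ 5) ^ 5" by simp
  also have "(\<Prod>i<4. \<Prod>j<5. qp ((z ^ j * p) ^ Suc i) (p ^ 5)) = (\<Prod>i<4. qp (p ^ 5 * (p ^ 5) ^ i) (p ^ 25))"
  proof (rule prod.cong[OF refl])
    fix i :: nat assume "i \<in> {..<4}"
    hence "Suc i \<in> {1,2,3,4}" by auto
    hence "(\<Prod>j<5. qp ((z ^ Suc i) ^ j * p ^ Suc i) (p ^ 5)) = qp ((p ^ Suc i) ^ 5) ((p ^ 5) ^ 5)"
      by (intro qp_fifth_roots fifth_root_cycle z q)
    moreover have "(z ^ j * p) ^ Suc i = (z ^ Suc i) ^ j * p ^ Suc i" for j
      by (simp only: power_mult_distrib mult.commute[of j] flip: power_mult)
    moreover have "(p ^ Suc i) ^ 5 = p ^ 5 * (p ^ 5) ^ i" 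
      by (simp add: algebra_simps flip: power_mult power_add)
    ultimately show "(\<Prod>j<5. qp ((z ^ j * p) ^ Suc i) (p ^ 5)) = qp (p ^ 5 * (p ^ 5) ^ i) (p ^ 25)"
      by (simp only: power_mult[symmetric]) simp
  qed
  finally have 1: "(\<Prod>j<5. eul (z ^ j * p)) = (\<Prod>i<4. qp (p ^ 5 * (p ^ 5) ^ i) (p ^ 25)) * eul (p ^ 5) ^ 5" .
  have 2: "eul (p ^ 5) = (\<Prod>i<4. qp (p ^ 5 * (p ^ 5) ^ i) (p ^ 25)) * eul (p ^ 25)"
  proof -
    have "(p ^ 5) ^ 5 = p ^ 25" "p ^ 5 * (p ^ 5) ^ 4 = p ^ 25" 
      by (simp_all flip: power_mult power_add)
    moreover have "{..<5::nat} = insert 4 {..<4}" by auto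
    ultimately show ?thesis using qp_split[OF q, of 5 "p ^ 5"] by simp
  qed
  have "eul (p ^ 5) ^ 6 = eul (p ^ 5) ^ 5 * eul (p ^ 5)"
    by (simp flip: power_Suc2)
  also have "\<dots> = eul (p ^ 5) ^ 5 * ((\<Prod>i<4. qp (p ^ 5 * (p ^ 5) ^ i) (p ^ 25)) * eul (p ^ 25))"
    using 2 by simp
  finally show ?thesis unfolding 1 by (simp only: mult_ac)
qed

section \<open>Eta quotients\<close>

lemma eul_nonzero:
  fixes q :: "'a::{real_normed_field,banach}"
  assumes q: "norm q < 1"
  shows "eul q \<noteq> 0"
  using assms by (intro qp_nonzero') auto

text \<open>This and the next two lemmas reduce products to values of \<open>eul\<close>, so that
  identities between theta functions become comparisons of exponents.\<close>

lemma qp_odd: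
  fixes q :: "'a::{real_normed_field,banach}"
  assumes q: "norm q < 1"
  shows "qp q (q\<^sup>2) = eul q / eul (q\<^sup>2)"
  using qp_split[OF q, of 2 q] eul_nonzero[of "q\<^sup>2"] norm_power_less_1[OF q, of 2]
  by (simp add: field_simps numeral_2_eq_2 lessThan_Suc)

lemma qp_uminus_odd:
  fixes q :: "'a::{real_normed_field,banach}"
  assumes q: "norm q < 1"
  shows "qp (- q) (q\<^sup>2) = eul (q\<^sup>2) ^ 2 / (eul q * eul (q ^ 4))"
proof -
  have q2: "norm (q\<^sup>2) < 1" and q4: "norm (q ^ 4) < 1" by (intro norm_power_less_1 q; simp)+
  have "qp q (q\<^sup>2) * qp (- q) (q\<^sup>2) = qp (q\<^sup>2) ((q\<^sup>2)\<^sup>2)" by (rule qp_mult_uminus[OF q2])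
  also have "\<dots> = eul (q\<^sup>2) / eul (q ^ 4)" using qp_odd[OF q2] by simp
  finally show ?thesis using eul_nonzero[OF q] eul_nonzero[OF q2] eul_nonzero[OF q4]
    unfolding qp_odd[OF q] by (simp add: field_simps) (simp add: power2_eq_square)
qed

lemma qp_uminus_even:
  fixes q :: "'a::{real_normed_field,banach}"
  assumes q: "norm q < 1"
  shows "qp (- q) q = eul (q\<^sup>2) / eul q"
  using qp_mult_uminus[OF q, of q] eul_nonzero[OF q] by (simp add: field_simps)

abbreviation phi :: "'a::{real_normed_field,banach} \<Rightarrow> 'a" where
  "phi q \<equiv> ftheta q q"

lemma phi_eul:
  fixes q :: "'a::{real_normed_field,banach}"
  assumes q: "norm q < 1"
  shows "phi q = eul (q\<^sup>2) ^ 5 / (eul q ^ 2 * eul (q ^ 4) ^ 2)"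
proof -
  have q2: "norm (q\<^sup>2) < 1" by (intro norm_power_less_1 q; simp)
  hence "phi q = qp (- q) (q\<^sup>2) * qp (- q) (q\<^sup>2) * eul (q\<^sup>2)"
    using jacobi_triple_product[of q q] by (simp add: power2_eq_square)
  thus ?thesis
    by (simp add: qp_uminus_odd[OF q] power_divide power_mult_distrib power_Suc[of _ 4] flip: power2_eq_square power_mult)
       (simp add: eval_nat_numeral)
qed

lemma phi_uminus_eul:
  fixes q :: "'a::{real_normed_field,banach}"
  assumes q: "norm q < 1"
  shows "phi (- q) = eul q ^ 2 / eul (q\<^sup>2)"
proof -
  have q2: "norm (q\<^sup>2) < 1" by (intro norm_power_less_1 q; simp)
  hence "phi (- q) = qp q (q\<^sup>2) * qp q (q\<^sup>2) * eul (q\<^sup>2)"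
    using jacobi_triple_product[of "- q" "- q"] by (simp add: power2_eq_square)
  thus ?thesis using eul_nonzero[OF q2] unfolding qp_odd[OF q] by (simp add: field_simps power2_eq_square[of "eul _"])
qed

text \<open>This series is twice Ramanujan's psi function. The 2 is the factor for index 0 of
  \<open>qp (- 1) q\<close>.\<close>

lemma ftheta_one_eul:
  fixes q :: "'a::{real_normed_field,banach}"
  assumes q: "norm q < 1"
  shows "ftheta q 1 = 2 * eul (q\<^sup>2) ^ 2 / eul q"
proof -
  have "ftheta q 1 = qp (- q) q * qp (- 1) q * eul q"
    using jacobi_triple_product[of q 1] q by simp
  also have "qp (- 1) q = 2 * qp (- q) q" by (subst qp_head[OF q]) simp
  finally show ?thesis using eul_nonzero[OF q]
    unfolding qp_uminus_even[OF q] by (simp add: power2_eq_square[of "eul _"])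
qed

lemma phi_mult_phi_uminus:
  fixes q :: "'a::{real_normed_field,banach}"
  assumes q: "norm q < 1"
  shows "phi q * phi (- q) = phi (- (q\<^sup>2)) ^ 2"
proof -
  have q2: "norm (q\<^sup>2) < 1" and q4: "norm (q ^ 4) < 1" by (intro norm_power_less_1 q; simp)+
  show ?thesis
    using eul_nonzero[OF q] eul_nonzero[OF q2] eul_nonzero[OF q4]
    by (simp add: phi_eul[OF q] phi_uminus_eul[OF q] phi_uminus_eul[OF q2] field_simps)
       (simp add: eval_nat_numeral)
qed

lemma qp_uminus_odd_5:
  fixes q :: "'a::{real_normed_field,banach}"
  assumes q: "norm q < 1"
  shows "qp (- q) (q\<^sup>2) = qp (- q) (q ^ 10) * qp (- (q ^ 3)) (q ^ 10) * qp (- (q ^ 5)) (q ^ 10) * 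
            qp (- (q ^ 7)) (q ^ 10) * qp (- (q ^ 9)) (q ^ 10)"
proof -
  have q2: "norm (q\<^sup>2) < 1" by (intro norm_power_less_1 q; simp)
  show ?thesis using qp_split[OF q2, of 5 "- q"] unfolding lessThan_5
    by (simp add: mult_ac flip: power_mult power_Suc)
qed

text \<open>The residues 1, 3, 7, 9 are all odd residues modulo 10 except 5, so the triple products
  combine to \<open>qp (- q) (q\<^sup>2)\<close> divided by \<open>qp (- (q ^ 5)) (q ^ 10)\<close>,
  up to \<open>eul (q ^ 10)\<close>.\<close>

lemma ftheta_1_9_3_7:
  fixes q :: "'a::{real_normed_field,banach}"
  assumes q: "norm q < 1"
  shows "ftheta (q ^ 9) q * ftheta (q ^ 7) (q ^ 3) =
           eul (q\<^sup>2) ^ 2 * eul (q ^ 5) * eul (q ^ 20) / (eul q * eul (q ^ 4))"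
proof -
  have n: "norm (q ^ m) < 1" if "m > 0" for m by (intro norm_power_less_1 q that)
  have "ftheta (q ^ 9) q = qp (- (q ^ 9)) (q ^ 10) * qp (- q) (q ^ 10) * eul (q ^ 10)"
    using jacobi_triple_product[of "q ^ 9" q] n[of 10] by (simp flip: power_Suc2)
  moreover have "ftheta (q ^ 7) (q ^ 3) = qp (- (q ^ 7)) (q ^ 10) * qp (- (q ^ 3)) (q ^ 10) * eul (q ^ 10)"
    using jacobi_triple_product[of "q ^ 7" "q ^ 3"] n[of 10] by (simp flip: power_add)
  ultimately have "ftheta (q ^ 9) q * ftheta (q ^ 7) (q ^ 3) * qp (- (q ^ 5)) (q ^ 10) = qp (- q) (q\<^sup>2) * eul (q ^ 10) ^ 2"
    unfolding qp_uminus_odd_5[OF q] by (simp add: power2_eq_square[of "eul _"] mult_ac)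
  moreover have "qp (- (q ^ 5)) (q ^ 10) = eul (q ^ 10) ^ 2 / (eul (q ^ 5) * eul (q ^ 20))"
    using qp_uminus_odd[OF n[of 5]] by (simp flip: power_mult)
  ultimately show ?thesis
    using eul_nonzero[OF q] eul_nonzero[OF n[of 2]] eul_nonzero[OF n[of 4]]
      eul_nonzero[OF n[of 5]] eul_nonzero[OF n[of 10]] eul_nonzero[OF n[of 20]]
    unfolding qp_uminus_odd[OF q] by (simp add: field_simps)
qed

definition rrA :: "'a::{real_normed_field,banach} \<Rightarrow> 'a" where "rrA q = ftheta (- (q ^ 3)) (- (q\<^sup>2))"
definition rrB :: "'a::{real_normed_field,banach} \<Rightarrow> 'a" where "rrB q = ftheta (- (q ^ 4)) (- q)"

lemma rrA_mult_rrB: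
  fixes q :: "'a::{real_normed_field,banach}"
  assumes q: "norm q < 1"
  shows "rrA q * rrB q = eul q * eul (q ^ 5)"
proof -
  have n: "norm (q ^ m) < 1" if "m > 0" for m by (intro norm_power_less_1 q that)
  have "rrA q = qp (q ^ 3) (q ^ 5) * qp (q ^ 2) (q ^ 5) * eul (q ^ 5)"
    using jacobi_triple_product[of "- (q ^ 3)" "- (q\<^sup>2)"] n[of 5] by (simp add: rrA_def flip: power_add)
  moreover have "rrB q = qp (q ^ 4) (q ^ 5) * qp q (q ^ 5) * eul (q ^ 5)"
    using jacobi_triple_product[of "- (q ^ 4)" "- q"] n[of 5] by (simp add: rrB_def flip: power_Suc2)
  moreover have "eul q = qp q (q ^ 5) * qp (q ^ 2) (q ^ 5) * qp (q ^ 3) (q ^ 5) * qp (q ^ 4) (q ^ 5) * eul (q ^ 5)"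
    using qp_split[OF q, of 5 q] unfolding lessThan_5
    by (simp add: mult_ac flip: power_Suc) (simp add: eval_nat_numeral)
  ultimately show ?thesis by (simp add: mult_ac)
qed

text \<open>The arguments are \<open>q\<close> times the four nontrivial fifth roots of unity.
  Restoring the factor for the root 1 merges the products into
  \<open>qp (- (q ^ 5)) (q ^ 10)\<close>.\<close>

lemma ftheta_fifth_roots:
  fixes z q :: "'a::{real_normed_field,banach}"
  assumes z: "1 + z + z ^ 2 + z ^ 3 + z ^ 4 = 0" and q: "norm q < 1"
  shows "ftheta (z * q) (z ^ 4 * q) * ftheta (z\<^sup>2 * q) (z ^ 3 * q) =
           eul q * eul (q ^ 4) * eul (q ^ 10) ^ 2 / (eul (q ^ 5) * eul (q ^ 20))"
proof -
  have n: "norm (q ^ m) < 1" if "m > 0" for m by (intro norm_power_less_1 q that)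
  note z5 = fifth_root_power_eq_1[OF z]
  have e: "z * q * (z ^ 4 * q) = q\<^sup>2" "z\<^sup>2 * q * (z ^ 3 * q) = q\<^sup>2"
    using z5 by algebra+
  have "ftheta (z * q) (z ^ 4 * q) = qp (- (z * q)) (q\<^sup>2) * qp (- (z ^ 4 * q)) (q\<^sup>2) * eul (q\<^sup>2)"
    using jacobi_triple_product[of "z * q" "z ^ 4 * q"] n[of 2] by (simp add: e)
  moreover have "ftheta (z\<^sup>2 * q) (z ^ 3 * q) = qp (- (z\<^sup>2 * q)) (q\<^sup>2) * qp (- (z ^ 3 * q)) (q\<^sup>2) * eul (q\<^sup>2)"
    using jacobi_triple_product[of "z\<^sup>2 * q" "z ^ 3 * q"] n[of 2] by (simp add: e)
  moreover have "qp (- q) (q\<^sup>2) * qp (- (z * q)) (q\<^sup>2) * qp (- (z\<^sup>2 * q)) (q\<^sup>2) * qp (- (z ^ 3 * q)) (q\<^sup>2) * qp (- (z ^ 4 * q)) (q\<^sup>2)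
       = qp (- (q ^ 5)) (q ^ 10)"
    using qp_fifth_roots[OF z n[of 2], of "- q"] unfolding lessThan_5 by (simp add: mult_ac flip: power_mult)
  ultimately have "ftheta (z * q) (z ^ 4 * q) * ftheta (z\<^sup>2 * q) (z ^ 3 * q) * qp (- q) (q\<^sup>2) = 
       qp (- (q ^ 5)) (q ^ 10) * eul (q\<^sup>2) ^ 2"
    by (simp add: power2_eq_square mult_ac)
  moreover have "qp (- (q ^ 5)) (q ^ 10) = eul (q ^ 10) ^ 2 / (eul (q ^ 5) * eul (q ^ 20))"
    using qp_uminus_odd[OF n[of 5]] by (simp flip: power_mult)
  ultimately show ?thesis
    using eul_nonzero[OF q] eul_nonzero[OF n[of 2]] eul_nonzero[OF n[of 4]]
      eul_nonzero[OF n[of 5]] eul_nonzero[OF n[of 10]] eul_nonzero[OF n[of 20]]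
    unfolding qp_uminus_odd[OF q] by (simp add: field_simps)
qed

section \<open>Sums over residue classes of a lattice\<close>

lemma ftheta_mult_has_sum:
  fixes a b c d :: "'a::{real_normed_field,banach}"
  assumes "norm (a * b) < 1" "norm (c * d) < 1"
  shows "((\<lambda>(m,n). theta_term a b m * theta_term c d n) has_sum (ftheta a b * ftheta c d)) UNIV"
proof -
  let ?f = "\<lambda>(m,n). theta_term a b m * theta_term c d n"
  have "?f abs_summable_on (UNIV \<times> UNIV)"
  proof (subst Infinite_Sum.abs_summable_on_Sigma_iff, intro conjI ballI)
    fix m
    show "(\<lambda>n. ?f (m, n)) abs_summable_on UNIV"
      using summable_on_cmult_right[OF theta_term_abs_summable[OF assms(2)], of "norm (theta_term a b m)"]
      by (simp add: norm_mult)
  next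
    have "(\<lambda>m. norm (theta_term a b m) * infsum (\<lambda>n. norm (theta_term c d n)) UNIV) summable_on UNIV"
      by (intro summable_on_cmult_left theta_term_abs_summable assms)
    moreover have "infsum (\<lambda>n. norm (?f (m, n))) UNIV = norm (theta_term a b m) * infsum (\<lambda>n. norm (theta_term c d n)) UNIV" for m
      by (simp add: norm_mult infsum_cmult_right')
    ultimately show "(\<lambda>m. norm (infsum (\<lambda>n. norm (?f (m, n))) UNIV)) summable_on UNIV"
      by (simp add: abs_mult infsum_nonneg)
  qed
  hence s: "?f summable_on (UNIV \<times> UNIV)" by (rule abs_summable_summable)
  have "(?f has_sum (ftheta a b * ftheta c d)) (UNIV \<times> UNIV)"
  proof (rule has_sum_SigmaI[OF _ _ s])
    show "((\<lambda>n. ?f (m, n)) has_sum (theta_term a b m * ftheta c d)) UNIV" for m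
      using has_sum_cmult_right[OF ftheta_has_sum[OF assms(2)]] by simp
    show "((\<lambda>m. theta_term a b m * ftheta c d) has_sum (ftheta a b * ftheta c d)) UNIV"
      by (intro has_sum_cmult_left ftheta_has_sum assms)
  qed
  thus ?thesis by simp
qed

lemma infsum_residue_classes:
  fixes g :: "'b \<Rightarrow> 'a::banach" and h :: "'b \<Rightarrow> int"
  assumes "g summable_on UNIV" "m > 0"
  shows "infsum g UNIV = (\<Sum>c\<in>{0..<m}. infsum g {x. h x mod m = c})"
proof -
  have "(\<Union>c\<in>{0..<m}. {x. h x mod m = c}) = UNIV" using assms(2) by auto
  moreover have "(\<Sum>c\<in>{0..<m}. infsum g {x. h x mod m = c}) = infsum g (\<Union>c\<in>{0..<m}. {x. h x mod m = c})"
    by (rule sum_infsum) (auto intro: summable_on_subset_banach[OF assms(1)])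
  ultimately show ?thesis by simp
qed

text \<open>The inverse \<open>U\<close>, \<open>V\<close> also receives the quotient
  \<open>k\<close> of the linear form by \<open>m\<close>. It can then be given by linear
  expressions without division, and linear arithmetic settles the side conditions.\<close>

lemma infsum_lattice_class:
  fixes f1 f2 L K :: "int \<Rightarrow> int \<Rightarrow> int" and U V :: "int \<Rightarrow> int \<Rightarrow> int \<Rightarrow> int"
  assumes "0 \<le> c" "c < m"
    and L: "\<And>u v. L (f1 u v) (f2 u v) = m * K u v + c"
    and inj: "\<And>u v u' v'. f1 u v = f1 u' v' \<Longrightarrow> f2 u v = f2 u' v' \<Longrightarrow> u = u' \<and> v = v'"
    and surj: "\<And>a b k. L a b = m * k + c \<Longrightarrow> f1 (U a b k) (V a b k) = a \<and> f2 (U a b k) (V a b k) = b"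
  shows "infsum (\<lambda>(u,v). g (f1 u v, f2 u v)) UNIV = infsum g {(a,b). L a b mod m = c}"
proof -
  define h where "h = (\<lambda>(u,v). (f1 u v, f2 u v))"
  have "inj h" unfolding h_def by (auto intro!: injI dest: inj)
  moreover have "range h = {(a,b). L a b mod m = c}"
  proof (intro equalityI subsetI)
    fix x assume "x \<in> {(a,b). L a b mod m = c}"
    then obtain a b where x: "x = (a,b)" "L a b mod m = c" by auto
    have "L a b = m * (L a b div m) + c" using x(2) mult_div_mod_eq[of m "L a b"] by simp
    from surj[OF this] have "x = h (U a b (L a b div m), V a b (L a b div m))" by (simp add: h_def x)
    thus "x \<in> range h" by blast
  qed (use assms(1,2) in \<open>auto simp: h_def L\<close>)
  ultimately show ?thesis
    using infsum_reindex[of h UNIV g] by (simp add: h_def o_def case_prod_unfold)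
qed

section \<open>Gaussian integers of even and odd norm\<close>

lemma ivl_int_2: "{0..<2::int} = {0,1}" and ivl_int_5: "{0..<5::int} = {0,1,2,3,4}"
  by auto

definition norm_term :: "'a::monoid_mult \<Rightarrow> int \<times> int \<Rightarrow> 'a" where
  "norm_term q = (\<lambda>(a,b). q ^ nat (a\<^sup>2 + b\<^sup>2))"

lemma int_tri_add_uminus: "tri n + tri (- n) = nat (n\<^sup>2)"
  using two_tri[of n] two_tri[of "- n"]
  by (simp add: algebra_simps power2_eq_square flip: of_nat_eq_iff[where ?'a = int])

lemma theta_term_same: "theta_term q q n = q ^ nat (n\<^sup>2)"
  by (simp add: theta_term_def int_tri_add_uminus flip: power_add)

lemma norm_term_eq: "norm_term q (a, b) = theta_term q q a * theta_term q q b"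
  by (simp add: norm_term_def theta_term_same nat_add_distrib power_add)

lemma norm_term_has_sum:
  fixes q :: "'a::{real_normed_field,banach}"
  assumes q: "norm q < 1"
  shows "(norm_term q has_sum (phi q)\<^sup>2) UNIV"
proof -
  have "norm_term q = (\<lambda>(m,n). theta_term q q m * theta_term q q n)"
    by (auto simp: norm_term_eq)
  moreover have "norm (q * q) < 1" using norm_power_less_1[OF q, of 2] by (simp add: power2_eq_square)
  ultimately show ?thesis using ftheta_mult_has_sum[of q q q q] by (simp add: power2_eq_square)
qed

lemma nat_eqI: "int m = n \<Longrightarrow> m = nat n" by simp

text \<open>The points form the ideal \<open>(1 + i)\<close>, a copy of the whole lattice with all
  norms doubled.\<close>

lemma norm_term_even:
  fixes q :: "'a::{real_normed_field,banach}"
  assumes q: "norm q < 1"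
  shows "infsum (norm_term q) {(a,b). (a + b) mod 2 = 0} = (phi (q\<^sup>2))\<^sup>2"
proof -
  have "infsum (norm_term q) {(a,b). (a + b) mod 2 = 0} = infsum (\<lambda>(u,v). norm_term q (u + v, u - v)) UNIV"
    by (rule infsum_lattice_class[where c = 0 and m = 2 and L = "\<lambda>a b. a + b" and ?f1.0 = "\<lambda>u v. u + v" and ?f2.0 = "\<lambda>u v. u - v"
        and K = "\<lambda>u v. u" and U = "\<lambda>a b k. k" and V = "\<lambda>a b k. k - b", symmetric]) auto
  also have "(\<lambda>(u,v). norm_term q (u + v, u - v)) = norm_term (q\<^sup>2)"
  proof (rule ext)
    fix x :: "int \<times> int"
    obtain u v where x: "x = (u,v)" by force
    have "(u + v)\<^sup>2 + (u - v)\<^sup>2 = 2 * (u\<^sup>2 + v\<^sup>2)" by (simp add: power2_eq_square algebra_simps)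
    hence "nat ((u + v)\<^sup>2 + (u - v)\<^sup>2) = 2 * nat (u\<^sup>2 + v\<^sup>2)" by (simp only: nat_mult_distrib nat_numeral)
    thus "(case x of (u, v) \<Rightarrow> norm_term q (u + v, u - v)) = norm_term (q\<^sup>2) x"
      by (simp add: norm_term_def x power_mult)
  qed
  finally show ?thesis using norm_term_has_sum[of "q\<^sup>2"] norm_power_less_1[OF q, of 2] by (simp add: infsumI)
qed

text \<open>In the coordinates \<open>u\<close>, \<open>v\<close> of the other coset the norm is
  \<open>1 + 4 * tri u + 4 * tri v\<close>, so the sum factors.\<close>

lemma norm_term_odd:
  fixes q :: "'a::{real_normed_field,banach}"
  assumes q: "norm q < 1"
  shows "infsum (norm_term q) {(a,b). (a + b) mod 2 = 1} = q * (ftheta (q ^ 4) 1)\<^sup>2"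
proof -
  have q4: "norm (q ^ 4) < 1" by (rule norm_power_less_1[OF q]) simp
  have "infsum (norm_term q) {(a,b). (a + b) mod 2 = 1} = infsum (\<lambda>(u,v). norm_term q (u + v + 1, u - v)) UNIV"
    by (rule infsum_lattice_class[where c = 1 and m = 2 and L = "\<lambda>a b. a + b" and ?f1.0 = "\<lambda>u v. u + v + 1" and ?f2.0 = "\<lambda>u v. u - v"
        and K = "\<lambda>u v. u" and U = "\<lambda>a b k. k" and V = "\<lambda>a b k. k - b", symmetric]) auto
  also have "(\<lambda>(u,v). norm_term q (u + v + 1, u - v)) = (\<lambda>(u,v). q * (theta_term (q ^ 4) 1 u * theta_term (q ^ 4) 1 v))"
  proof (rule ext)
    fix x :: "int \<times> int"
    obtain u v where x: "x = (u,v)" by force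
    have "int (1 + 4 * tri u + 4 * tri v) = (u + v + 1)\<^sup>2 + (u - v)\<^sup>2"
      using two_tri[of u] two_tri[of v] by (simp add: power2_eq_square algebra_simps)
    hence "1 + 4 * tri u + 4 * tri v = nat ((u + v + 1)\<^sup>2 + (u - v)\<^sup>2)" by (rule nat_eqI)
    hence "norm_term q (u + v + 1, u - v) = q ^ (1 + 4 * tri u + 4 * tri v)" by (simp add: norm_term_def)
    thus "(case x of (u, v) \<Rightarrow> norm_term q (u + v + 1, u - v)) = 
          (case x of (u, v) \<Rightarrow> q * (theta_term (q ^ 4) 1 u * theta_term (q ^ 4) 1 v))"
      by (simp add: x theta_term_def power_add power_mult)
  qed
  finally have "infsum (norm_term q) {(a,b). (a + b) mod 2 = 1} = infsum (\<lambda>(u,v). q * (theta_term (q ^ 4) 1 u * theta_term (q ^ 4) 1 v)) UNIV" .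
  moreover have "((\<lambda>x. q * (case x of (u,v) \<Rightarrow> theta_term (q ^ 4) 1 u * theta_term (q ^ 4) 1 v)) has_sum
        (q * (ftheta (q ^ 4) 1 * ftheta (q ^ 4) 1))) UNIV"
    by (intro has_sum_cmult_right ftheta_mult_has_sum) (use q4 in auto)
  hence "infsum (\<lambda>(u,v). q * (theta_term (q ^ 4) 1 u * theta_term (q ^ 4) 1 v)) UNIV = q * (ftheta (q ^ 4) 1)\<^sup>2"
    by (intro infsumI) (simp add: case_prod_unfold power2_eq_square)
  ultimately show ?thesis by simp
qed

text \<open>Passing to \<open>- q\<close> changes the sign of exactly the terms of odd norm.\<close>

lemma phi_uminus_sq:
  fixes q :: "'a::{real_normed_field,banach}"
  assumes q: "norm q < 1"
  shows "(phi q)\<^sup>2 = (phi (q\<^sup>2))\<^sup>2 + q * (ftheta (q ^ 4) 1)\<^sup>2"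
    and "(phi (- q))\<^sup>2 = (phi (q\<^sup>2))\<^sup>2 - q * (ftheta (q ^ 4) 1)\<^sup>2"
proof -
  have split: "(phi p)\<^sup>2 = infsum (norm_term p) {(a,b). (a + b) mod 2 = 0} + infsum (norm_term p) {(a,b). (a + b) mod 2 = 1}"
    if "norm p < 1" for p :: 'a
    using norm_term_has_sum[OF that] infsum_residue_classes[of "norm_term p" 2 "\<lambda>(a,b). a + b"]
    by (simp add: ivl_int_2 has_sum_iff case_prod_unfold)
  show "(phi q)\<^sup>2 = (phi (q\<^sup>2))\<^sup>2 + q * (ftheta (q ^ 4) 1)\<^sup>2"
    by (simp add: split norm_term_even norm_term_odd q)
  show "(phi (- q))\<^sup>2 = (phi (q\<^sup>2))\<^sup>2 - q * (ftheta (q ^ 4) 1)\<^sup>2"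
    using q by (simp add: split norm_term_even norm_term_odd)
qed

section \<open>Theta functions at nomes of ratio five\<close>

text \<open>For \<open>c = 0\<close> the class \<open>a + 2 * b \<equiv> c (mod 5)\<close> is the ideal \<open>(2 + \<i>)\<close> of the Gaussian
  integers, whose elements have norm \<open>5 * (m\<^sup>2 + n\<^sup>2)\<close>; multiplication by \<open>\<i>\<close> permutes the other
  four classes cyclically, so all of them have the same sum.\<close>

lemma norm_term_class_0:
  fixes q :: "'a::{real_normed_field,banach}"
  assumes q: "norm q < 1"
  shows "infsum (norm_term q) {(a,b). (a + 2 * b) mod 5 = 0} = (phi (q ^ 5))\<^sup>2"
proof -
  have "infsum (norm_term q) {(a,b). (a + 2 * b) mod 5 = 0} = infsum (\<lambda>(m,n). norm_term q (n-2*m, m+2*n)) UNIV"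
    by (rule infsum_lattice_class[where c = 0 and m = 5 and L = "\<lambda>a b. a + 2 * b" and ?f1.0 = "\<lambda>m n. n-2*m" and ?f2.0 = "\<lambda>m n. m+2*n"
        and K = "\<lambda>m n. n" and U = "\<lambda>a b k. b - 2 * k" and V = "\<lambda>a b k. k", symmetric]) auto
  also have "(\<lambda>(m,n). norm_term q (n-2*m, m+2*n)) = norm_term (q ^ 5)"
  proof (rule ext)
    fix x :: "int \<times> int"
    obtain m n where x: "x = (m,n)" by force
    have "(n-2*m)\<^sup>2 + (m+2*n)\<^sup>2 = 5 * (m\<^sup>2 + n\<^sup>2)" by (simp add: power2_eq_square algebra_simps)
    hence "nat ((n-2*m)\<^sup>2 + (m+2*n)\<^sup>2) = 5 * nat (m\<^sup>2 + n\<^sup>2)" by (simp only: nat_mult_distrib nat_numeral)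
    thus "(case x of (m, n) \<Rightarrow> norm_term q (n-2*m, m+2*n)) = norm_term (q ^ 5) x"
      by (simp add: norm_term_def x power_mult)
  qed
  finally show ?thesis using norm_term_has_sum[of "q ^ 5"] norm_power_less_1[OF q, of 5] by (simp add: infsumI)
qed

text \<open>Translating the ideal by 1 turns the norm into
  \<open>1 + (5 * n\<^sup>2 + 4 * n) + (5 * m\<^sup>2 + 2 * m)\<close>, which separates the
  variables; the brackets are \<open>9 * tri n + tri (- n)\<close> and
  \<open>7 * tri m + 3 * tri (- m)\<close>.\<close>

lemma norm_term_class_1:
  fixes q :: "'a::{real_normed_field,banach}"
  assumes q: "norm q < 1"
  shows "infsum (norm_term q) {(a,b). (a + 2 * b) mod 5 = 1} = q * (ftheta (q ^ 9) q * ftheta (q ^ 7) (q ^ 3))"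
proof -
  have q10: "norm (q ^ 10) < 1" by (rule norm_power_less_1[OF q]) simp
  let ?t = "\<lambda>(n,m). theta_term (q ^ 9) q n * theta_term (q ^ 7) (q ^ 3) m"
  have "infsum (norm_term q) {(a,b). (a + 2 * b) mod 5 = 1} = infsum (\<lambda>(n,m). norm_term q (2*n+m+1, 2*m-n)) UNIV"
    by (rule infsum_lattice_class[where c = 1 and m = 5 and L = "\<lambda>a b. a + 2 * b" and ?f1.0 = "\<lambda>n m. 2*n+m+1" and ?f2.0 = "\<lambda>n m. 2*m-n"
        and K = "\<lambda>n m. m" and U = "\<lambda>a b k. 2 * k - b" and V = "\<lambda>a b k. k", symmetric]) auto
  also have "(\<lambda>(n,m). norm_term q (2*n+m+1, 2*m-n)) = (\<lambda>x. q * ?t x)"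
  proof (rule ext)
    fix x :: "int \<times> int"
    obtain n m where x: "x = (n,m)" by force
    have "int (1 + 9 * tri n + tri (- n) + 7 * tri m + 3 * tri (- m)) = (2*n+m+1)\<^sup>2 + (2*m-n)\<^sup>2"
      using two_tri[of n] two_tri[of "- n"] two_tri[of m] two_tri[of "- m"] by (simp add: power2_eq_square algebra_simps)
    hence "1 + 9 * tri n + tri (- n) + 7 * tri m + 3 * tri (- m) = nat ((2*n+m+1)\<^sup>2 + (2*m-n)\<^sup>2)" by (rule nat_eqI)
    hence "norm_term q (2*n+m+1, 2*m-n) = q ^ (1 + 9 * tri n + tri (- n) + 7 * tri m + 3 * tri (- m))" by (simp only: norm_term_def prod.case)
    moreover have "(q ^ k) ^ l = (q ^ l) ^ k" for k l by (simp add: mult.commute flip: power_mult)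
    ultimately show "(case x of (n,m) \<Rightarrow> norm_term q (2*n+m+1, 2*m-n)) = q * ?t x"
      unfolding x prod.case theta_term_def by (simp only: power_add power_mult power_one_right mult.assoc mult_ac)
  qed
  finally have "infsum (norm_term q) {(a,b). (a + 2 * b) mod 5 = 1} = infsum (\<lambda>x. q * ?t x) UNIV" .
  moreover have "((\<lambda>x. q * ?t x) has_sum (q * (ftheta (q ^ 9) q * ftheta (q ^ 7) (q ^ 3)))) UNIV"
    by (intro has_sum_cmult_right ftheta_mult_has_sum) (use q10 in \<open>auto simp flip: power_Suc2 power_add\<close>)
  ultimately show ?thesis by (simp add: infsumI)
qed

text \<open>A quarter turn takes \<open>a + 2 * b\<close> to \<open>2 * a - b\<close>, which is
  congruent to its double modulo 5. Doubling leads from class 1 to 2, 4 and 3.\<close>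

lemma norm_term_rotate:
  fixes q :: "'a::{real_normed_field,banach}"
  assumes "0 \<le> c" "c < 5"
  shows "infsum (norm_term q) {(a,b). (a + 2 * b) mod 5 = 2 * c mod 5} = infsum (norm_term q) {(a,b). (a + 2 * b) mod 5 = c}"
proof (rule infsum_reindex_bij_witness[of _ "\<lambda>(a,b). (-b, a)" "\<lambda>(a,b). (b, - a)"])
  fix x assume "x \<in> {(a,b). (a + 2 * b) mod 5 = 2 * c mod 5}"
  then obtain a b where x: "x = (a, b)" "(a + 2 * b) mod 5 = 2 * c mod 5" by auto
  have "b - 2 * a = 3 * (a + 2 * b) + 5 * (- a - b)" by simp
  hence "(b - 2 * a) mod 5 = 3 * ((a + 2 * b) mod 5) mod 5" by (simp only: mod_mult_self2 mod_mult_right_eq)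
  also have "\<dots> = c"
  proof -
    have "c \<in> {0,1,2,3,4}" using assms by auto
    thus ?thesis unfolding x(2) by auto
  qed
  finally have "(b - 2 * a) mod 5 = c" .
  thus "(case x of (a,b) \<Rightarrow> (b, - a)) \<in> {(a,b). (a + 2 * b) mod 5 = c}" by (simp add: x)
next
  fix x assume "x \<in> {(a,b). (a + 2 * b) mod 5 = c}"
  then obtain a b where x: "x = (a, b)" "(a + 2 * b) mod 5 = c" by auto
  have "- b + 2 * a = 2 * (a + 2 * b) + 5 * (- b)" by simp
  hence "(- b + 2 * a) mod 5 = 2 * ((a + 2 * b) mod 5) mod 5" by (simp only: mod_mult_self2 mod_mult_right_eq)
  hence "(- b + 2 * a) mod 5 = 2 * c mod 5" unfolding x(2) .
  thus "(case x of (a,b) \<Rightarrow> (- b, a)) \<in> {(a,b). (a + 2 * b) mod 5 = 2 * c mod 5}" by (simp add: x)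
qed (auto simp: norm_term_def add.commute)

lemma norm_term_classes:
  fixes q :: "'a::{real_normed_field,banach}"
  assumes q: "norm q < 1" and "c \<in> {1,2,3,4}"
  shows "infsum (norm_term q) {(a,b). (a + 2 * b) mod 5 = c} = q * (ftheta (q ^ 9) q * ftheta (q ^ 7) (q ^ 3))"
  using norm_term_rotate[of 1 q] norm_term_rotate[of 2 q] norm_term_rotate[of 4 q] norm_term_class_1[OF q] assms(2)
  by auto

lemma phi_sq_minus_phi5_sq:
  fixes q :: "'a::{real_normed_field,banach}"
  assumes q: "norm q < 1"
  shows "(phi q)\<^sup>2 - (phi (q ^ 5))\<^sup>2 = 4 * q * (ftheta (q ^ 9) q * ftheta (q ^ 7) (q ^ 3))"
  using norm_term_has_sum[OF q] infsum_residue_classes[of "norm_term q" 5 "\<lambda>(a,b). a + 2 * b"]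
    norm_term_class_0[OF q] norm_term_classes[OF q]
  by (simp add: ivl_int_5 has_sum_iff case_prod_unfold)

text \<open>The power of \<open>z\<close> at the lattice point \<open>(a, b)\<close> depends only on
  \<open>a + 2 * b\<close> modulo 5. The four nonzero classes have equal sums, and their weights add
  up to -1.\<close>

lemma ftheta_fifth_roots_lattice:
  fixes z q :: "'a::{real_normed_field,banach}"
  assumes z: "1 + z + z ^ 2 + z ^ 3 + z ^ 4 = 0" and q: "norm q < 1"
  shows "ftheta (z * q) (z ^ 4 * q) * ftheta (z\<^sup>2 * q) (z ^ 3 * q) = 
           (phi (q ^ 5))\<^sup>2 - q * (ftheta (q ^ 9) q * ftheta (q ^ 7) (q ^ 3))"
proof -
  note z5 = fifth_root_power_eq_1[OF z]
  have q2: "norm (q * q) < 1" using norm_power_less_1[OF q, of 2] by (simp add: power2_eq_square)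
  define g where "g = (\<lambda>(a,b). theta_term (z * q) (z ^ 4 * q) a * theta_term (z\<^sup>2 * q) (z ^ 3 * q) b)"
  have e: "z * q * (z ^ 4 * q) = z ^ 5 * (q * q)" "z\<^sup>2 * q * (z ^ 3 * q) = z ^ 5 * (q * q)"
    by (simp_all add: algebra_simps eval_nat_numeral)
  have "(g has_sum (ftheta (z * q) (z ^ 4 * q) * ftheta (z\<^sup>2 * q) (z ^ 3 * q))) UNIV"
    unfolding g_def by (rule ftheta_mult_has_sum) (use q2 in \<open>simp_all only: e z5 mult_1\<close>)
  hence "ftheta (z * q) (z ^ 4 * q) * ftheta (z\<^sup>2 * q) (z ^ 3 * q) = 
         (\<Sum>c\<in>{0..<5}. infsum g {(a,b). (a + 2 * b) mod 5 = c})"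
    using infsum_residue_classes[of g 5 "\<lambda>(a,b). a + 2 * b"] by (simp add: has_sum_iff case_prod_unfold)
  also have "\<dots> = (\<Sum>c\<in>{0..<5}. z ^ nat c * infsum (norm_term q) {(a,b). (a + 2 * b) mod 5 = c})"
  proof (rule sum.cong[OF refl])
    fix c :: int
    have "infsum g {(a,b). (a + 2 * b) mod 5 = c} = infsum (\<lambda>x. z ^ nat c * norm_term q x) {(a,b). (a + 2 * b) mod 5 = c}"
    proof (rule infsum_cong)
      fix x assume "x \<in> {(a,b). (a + 2 * b) mod 5 = c}"
      then obtain a b where x: "x = (a,b)" "(a + 2 * b) mod 5 = c" by auto
      let ?e = "tri a + 4 * tri (- a) + 2 * tri b + 3 * tri (- b)"
      have E: "int ?e = a + 2 * b + 5 * int (tri (- a) + tri (- b))"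
        using two_tri[of a] two_tri[of "- a"] two_tri[of b] two_tri[of "- b"] by (simp add: algebra_simps)
      have "int ?e mod 5 = c" unfolding E by (simp only: mod_mult_self2 x(2))
      hence "?e mod 5 = nat c" by (metis nat_int zmod_int of_nat_numeral)
      hence "z ^ ?e = z ^ nat c" using power_mod_5[OF z5] by metis
      moreover have "g x = z ^ ?e * norm_term q x"
        unfolding x g_def norm_term_eq theta_term_def prod.case power_add power_mult power_mult_distrib
        by (simp only: mult_ac)
      ultimately show "g x = z ^ nat c * norm_term q x" by simp
    qed
    thus "infsum g {(a,b). (a + 2 * b) mod 5 = c} = z ^ nat c * infsum (norm_term q) {(a,b). (a + 2 * b) mod 5 = c}"
      by (simp add: infsum_cmult_right')
  qed
  also have "\<dots> = (phi (q ^ 5))\<^sup>2 + (z + z\<^sup>2 + z ^ 3 + z ^ 4) * (q * (ftheta (q ^ 9) q * ftheta (q ^ 7) (q ^ 3)))"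
    by (simp add: ivl_int_5 norm_term_class_0[OF q] norm_term_classes[OF q] distrib_right add_ac nat_numeral)
  also have "z + z\<^sup>2 + z ^ 3 + z ^ 4 = - 1" using z by (simp add: add_ac eq_neg_iff_add_eq_0)
  finally show ?thesis by simp
qed

lemma phi_sq_diff_eul:
  fixes q :: "'a::{real_normed_field,banach}"
  assumes q: "norm q < 1"
  shows "(phi q)\<^sup>2 - (phi (q ^ 5))\<^sup>2 = 4 * q * (eul (q\<^sup>2) ^ 2 * eul (q ^ 5) * eul (q ^ 20) / (eul q * eul (q ^ 4)))"
  unfolding phi_sq_minus_phi5_sq[OF q] ftheta_1_9_3_7[OF q] ..

lemma five_phi_sq_diff_eul:
  fixes z q :: "'a::{real_normed_field,banach}"
  assumes z: "1 + z + z ^ 2 + z ^ 3 + z ^ 4 = 0" and q: "norm q < 1"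
  shows "5 * (phi (q ^ 5))\<^sup>2 - (phi q)\<^sup>2 = 4 * (eul q * eul (q ^ 4) * eul (q ^ 10) ^ 2 / (eul (q ^ 5) * eul (q ^ 20)))"
  using phi_sq_minus_phi5_sq[OF q] unfolding ftheta_fifth_roots[OF z q, symmetric] ftheta_fifth_roots_lattice[OF z q]
  by (simp add: algebra_simps)

section \<open>A quintic dissection\<close>

definition alt_sign :: "int \<Rightarrow> 'a::comm_ring_1" where "alt_sign n = (if even n then 1 else - 1)"

lemma alt_sign_add: "alt_sign (m + n) = alt_sign m * alt_sign n"
  by (auto simp: alt_sign_def)

lemma theta_term_uminus: "theta_term (- a) (- b) n = alt_sign n * theta_term a b n"
  for a b :: "'a::comm_ring_1"
proof -
  have "even (tri n + tri (- n)) = even n"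
    by (simp add: int_tri_add_uminus even_nat_iff)
  moreover have "theta_term (- a) (- b) n = (- 1) ^ (tri n + tri (- n)) * theta_term a b n"
    unfolding theta_term_def power_minus[of a] power_minus[of b] power_add by (simp only: mult_ac)
  ultimately show ?thesis by (simp add: alt_sign_def)
qed

definition rra :: "int \<Rightarrow> nat" where "rra n = 3 * tri n + 2 * tri (- n)"
definition rrb :: "int \<Rightarrow> nat" where "rrb n = 4 * tri n + tri (- n)"

lemma two_rra: "2 * int (rra n) = 5 * n\<^sup>2 + n" and two_rrb: "2 * int (rrb n) = 5 * n\<^sup>2 + 3 * n"
  using two_tri[of n] two_tri[of "- n"] by (simp_all add: rra_def rrb_def power2_eq_square algebra_simps)

lemma rrA_term: "theta_term (- (q ^ 3)) (- (q\<^sup>2)) n = alt_sign n * q ^ rra n" for q :: "'a::comm_ring_1"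
  by (simp add: theta_term_uminus theta_term_def[of "q ^ 3"] rra_def power_add power_mult)

lemma rrB_term: "theta_term (- (q ^ 4)) (- q) n = alt_sign n * q ^ rrb n" for q :: "'a::comm_ring_1"
  by (simp add: theta_term_uminus theta_term_def[of "q ^ 4"] rrb_def power_add power_mult)

lemma rr_mult_has_sum:
  fixes q :: "'a::{real_normed_field,banach}"
  assumes q: "norm q < 1"
  shows "((\<lambda>(m,n). alt_sign (m + n) * q ^ (rra m + rra n)) has_sum (rrA q * rrA q)) UNIV" 
    and "((\<lambda>(m,n). alt_sign (m + n) * q ^ (rra m + rrb n)) has_sum (rrA q * rrB q)) UNIV"
    and "((\<lambda>(m,n). alt_sign (m + n) * q ^ (rrb m + rrb n)) has_sum (rrB q * rrB q)) UNIV"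
proof -
  have q5: "norm (q ^ 5) < 1" by (rule norm_power_less_1[OF q]) simp
  have n: "norm (- (q ^ 3) * - (q\<^sup>2)) < 1" "norm (- (q ^ 4) * - q) < 1"
    using q5 by (simp_all flip: power_add power_Suc2)
  note simps = rrA_term rrB_term rrA_def[symmetric] rrB_def[symmetric] alt_sign_add power_add mult_ac
  show "((\<lambda>(m,n). alt_sign (m + n) * q ^ (rra m + rra n)) has_sum (rrA q * rrA q)) UNIV"
    using ftheta_mult_has_sum[OF n(1) n(1)] by (simp add: simps)
  show "((\<lambda>(m,n). alt_sign (m + n) * q ^ (rra m + rrb n)) has_sum (rrA q * rrB q)) UNIV"
    using ftheta_mult_has_sum[OF n(1) n(2)] by (simp add: simps)
  show "((\<lambda>(m,n). alt_sign (m + n) * q ^ (rrb m + rrb n)) has_sum (rrB q * rrB q)) UNIV"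
    using ftheta_mult_has_sum[OF n(2) n(2)] by (simp add: simps)
qed

lemma infsum_odd_involution:
  fixes g :: "'b \<Rightarrow> 'a::{banach,real_normed_field}"
  assumes "\<And>x. x \<in> S \<Longrightarrow> h x \<in> S" "\<And>x. x \<in> S \<Longrightarrow> h (h x) = x" "\<And>x. x \<in> S \<Longrightarrow> g (h x) = - g x"
  shows "infsum g S = 0"
proof -
  have "infsum (\<lambda>x. - g x) S = infsum g S"
    by (rule infsum_reindex_bij_witness[of _ h h]) (use assms in auto)
  hence "2 * infsum g S = 0" by (simp add: infsum_uminus)
  thus ?thesis by simp
qed

text \<open>The exponents on the left are \<open>(X\<^sup>2 + Y\<^sup>2 - 10) / 40\<close> with \<open>X = 10 * r + 1\<close> and \<open>Y = 10 * s + 3\<close>. Then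
  \<open>X + \<i> Y\<close> is divisible by \<open>2 + \<i>\<close>, and the quotient \<open>x + \<i> y\<close> runs through pairs of odd numbers.
  Three of the five residue classes of \<open>x\<close> modulo 5 give the products on the right; in the other two
  \<open>x\<close> or \<open>y\<close> is divisible by 5 and changing its sign cancels the terms in pairs.\<close>

theorem rr_dissection:
  fixes p :: "'a::{real_normed_field,banach}"
  assumes p: "norm p < 1"
  shows "rrA p * rrB p = (rrA (p ^ 5))\<^sup>2 - p * (rrA (p ^ 5) * rrB (p ^ 5)) - p\<^sup>2 * (rrB (p ^ 5))\<^sup>2"
proof -
  have p5: "norm (p ^ 5) < 1" by (rule norm_power_less_1[OF p]) simp
  define g where "g = (\<lambda>(r,s). alt_sign (r + s) * p ^ (rra r + rrb s))"
  define C where "C = (\<lambda>c::int. {(r::int,s::int). (2 * r + s) mod 5 = c})"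
  note two = two_rra two_rrb
  have "rrA p * rrB p = infsum g UNIV"
    using rr_mult_has_sum(2)[OF p] by (simp add: g_def infsumI)
  also have "\<dots> = infsum g (C 0) + infsum g (C 1) + infsum g (C 2) + infsum g (C 3) + infsum g (C 4)"
    using infsum_residue_classes[of g 5 "\<lambda>(r,s). 2 * r + s"] rr_mult_has_sum(2)[OF p]
    by (simp add: C_def g_def has_sum_iff case_prod_unfold ivl_int_5)
  \<comment> \<open>Here \<open>x = 10 * u + 1\<close> and \<open>y = 10 * v + 1\<close>. In all
    classes the exponent is \<open>(x\<^sup>2 + y\<^sup>2 - 2) / 8\<close>, as
    \<open>X\<^sup>2 + Y\<^sup>2 = 5 * (x\<^sup>2 + y\<^sup>2)\<close>.\<close>
  also have "infsum g (C 0) = (rrA (p ^ 5))\<^sup>2"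
  proof -
    let ?h = "\<lambda>(u,v). alt_sign (u + v) * (p ^ 5) ^ (rra u + rra v)"
    have "infsum g (C 0) = infsum (\<lambda>(u,v). g (2* u-v, u+2* v)) UNIV"
      unfolding C_def
      by (rule infsum_lattice_class[where c = 0 and m = 5 and L = "\<lambda>r s. 2 * r + s" and ?f1.0 = "\<lambda>u v. 2* u-v" and ?f2.0 = "\<lambda>u v. u+2* v"
        and K = "\<lambda>u v. u" and U = "\<lambda>r s k. k" and V = "\<lambda>r s k. 2 * k - r", symmetric]) auto
    also have "(\<lambda>(u,v). g (2* u-v, u+2* v)) = (\<lambda>x. ?h x)"
    proof (rule ext)
      fix x :: "int \<times> int"
      obtain u v where x: "x = (u,v)" by force
      have "int (rra (2* u-v) + rrb (u+2* v)) = int (5 * (rra u + rra v))"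
        using two[of "2* u-v"] two[of "u+2* v"] two[of u] two[of v] by (simp add: power2_eq_square algebra_simps)
      hence "rra (2* u-v) + rrb (u+2* v) = 5 * (rra u + rra v)" by (simp only: of_nat_eq_iff)
      hence "g (2* u-v, u+2* v) = alt_sign (2* u-v + (u+2* v)) * p ^ (5 * (rra u + rra v))" unfolding g_def prod.case by (rule arg_cong)
      also have "alt_sign (2* u-v + (u+2* v)) = (alt_sign (u + v) :: 'a)" by (simp add: alt_sign_def)
      finally show "(case x of (u,v) \<Rightarrow> g (2* u-v, u+2* v)) = ?h x"
        unfolding x prod.case by (simp add: power_add power2_eq_square flip: power_mult)
    qed
    finally show ?thesis using rr_mult_has_sum(1)[OF p5] by (simp add: infsumI power2_eq_square)
  qed
  \<comment> \<open>Here \<open>x = - (10 * u + 1)\<close> and \<open>y = - (10 * v + 3)\<close>;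
    replacing a residue 1 by 3 adds \<open>(9 - 1) / 8 = 1\<close> to the exponent.\<close>
  also have "infsum g (C 4) = - p * (rrA (p ^ 5) * rrB (p ^ 5))"
  proof -
    let ?h = "\<lambda>(u,v). alt_sign (u + v) * (p ^ 5) ^ (rra u + rrb v)"
    have "infsum g (C 4) = infsum (\<lambda>(u,v). g (-2* u+v, -u-2* v-1)) UNIV"
      unfolding C_def
      by (rule infsum_lattice_class[where c = 4 and m = 5 and L = "\<lambda>r s. 2 * r + s" and ?f1.0 = "\<lambda>u v. -2* u+v" and ?f2.0 = "\<lambda>u v. -u-2* v-1"
        and K = "\<lambda>u v. - u - 1" and U = "\<lambda>r s k. - k - 1" and V = "\<lambda>r s k. r - 2 * k - 2", symmetric]) auto
    also have "(\<lambda>(u,v). g (-2* u+v, -u-2* v-1)) = (\<lambda>x. - p * ?h x)"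
    proof (rule ext)
      fix x :: "int \<times> int"
      obtain u v where x: "x = (u,v)" by force
      have "int (rra (-2* u+v) + rrb (-u-2* v-1)) = int (1 + 5 * (rra u + rrb v))"
        using two[of "-2* u+v"] two[of "-u-2* v-1"] two[of u] two[of v] by (simp add: power2_eq_square algebra_simps)
      hence "rra (-2* u+v) + rrb (-u-2* v-1) = 1 + 5 * (rra u + rrb v)" by (simp only: of_nat_eq_iff)
      hence "g (-2* u+v, -u-2* v-1) = alt_sign (-2* u+v + (-u-2* v-1)) * p ^ (1 + 5 * (rra u + rrb v))" unfolding g_def prod.case by (rule arg_cong)
      also have "alt_sign (-2* u+v + (-u-2* v-1)) = (- alt_sign (u + v) :: 'a)" by (simp add: alt_sign_def)
      finally show "(case x of (u,v) \<Rightarrow> g (-2* u+v, -u-2* v-1)) = - p * ?h x"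
        unfolding x prod.case by (simp add: power_add power2_eq_square flip: power_mult)
    qed
    finally have "infsum g (C 4) = infsum (\<lambda>x. - p * ?h x) UNIV" .
    moreover have "((\<lambda>x. - p * ?h x) has_sum (- p * (rrA (p ^ 5) * rrB (p ^ 5)))) UNIV"
      by (intro has_sum_cmult_right rr_mult_has_sum p5)
    ultimately show ?thesis by (simp add: infsumI)
  qed
  \<comment> \<open>Here \<open>x = - (10 * u + 3)\<close> and \<open>y = 10 * v + 3\<close>, which
    accounts for two extra factors \<open>p\<close>.\<close>
  also have "infsum g (C 3) = - (p\<^sup>2) * (rrB (p ^ 5))\<^sup>2"
  proof -
    let ?h = "\<lambda>(u,v). alt_sign (u + v) * (p ^ 5) ^ (rrb u + rrb v)"
    have "infsum g (C 3) = infsum (\<lambda>(u,v). g (-2* u-v-1, -u+2* v)) UNIV"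
      unfolding C_def
      by (rule infsum_lattice_class[where c = 3 and m = 5 and L = "\<lambda>r s. 2 * r + s" and ?f1.0 = "\<lambda>u v. -2* u-v-1" and ?f2.0 = "\<lambda>u v. -u+2* v"
        and K = "\<lambda>u v. - u - 1" and U = "\<lambda>r s k. - k - 1" and V = "\<lambda>r s k. 2 * k + 1 - r", symmetric]) auto
    also have "(\<lambda>(u,v). g (-2* u-v-1, -u+2* v)) = (\<lambda>x. - (p\<^sup>2) * ?h x)"
    proof (rule ext)
      fix x :: "int \<times> int"
      obtain u v where x: "x = (u,v)" by force
      have "int (rra (-2* u-v-1) + rrb (-u+2* v)) = int (2 + 5 * (rrb u + rrb v))"
        using two[of "-2* u-v-1"] two[of "-u+2* v"] two[of u] two[of v] by (simp add: power2_eq_square algebra_simps)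
      hence "rra (-2* u-v-1) + rrb (-u+2* v) = 2 + 5 * (rrb u + rrb v)" by (simp only: of_nat_eq_iff)
      hence "g (-2* u-v-1, -u+2* v) = alt_sign (-2* u-v-1 + (-u+2* v)) * p ^ (2 + 5 * (rrb u + rrb v))" unfolding g_def prod.case by (rule arg_cong)
      also have "alt_sign (-2* u-v-1 + (-u+2* v)) = (- alt_sign (u + v) :: 'a)" by (simp add: alt_sign_def)
      finally show "(case x of (u,v) \<Rightarrow> g (-2* u-v-1, -u+2* v)) = - (p\<^sup>2) * ?h x"
        unfolding x prod.case by (simp add: power_add power2_eq_square flip: power_mult)
    qed
    finally have "infsum g (C 3) = infsum (\<lambda>x. - (p\<^sup>2) * ?h x) UNIV" .
    moreover have "((\<lambda>x. - (p\<^sup>2) * ?h x) has_sum (- (p\<^sup>2) * (rrB (p ^ 5) * rrB (p ^ 5)))) UNIV"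
      by (intro has_sum_cmult_right rr_mult_has_sum p5)
    ultimately show ?thesis by (simp add: infsumI power2_eq_square)
  qed
  \<comment> \<open>Here \<open>x = 10 * u + 5\<close> and \<open>y = 10 * v - 1\<close>, and
    \<open>u\<close> becoming \<open>-1-u\<close> is the change of sign of \<open>x\<close>.\<close>
  also have "infsum g (C 2) = 0"
  proof -
    let ?g = "\<lambda>(u,v). g (2* u-v+1, u+2* v)"
    have "infsum g (C 2) = infsum ?g UNIV"
      unfolding C_def
      by (rule infsum_lattice_class[where c = 2 and m = 5 and L = "\<lambda>r s. 2 * r + s" and ?f1.0 = "\<lambda>u v. 2* u-v+1" and ?f2.0 = "\<lambda>u v. u+2* v"
        and K = "\<lambda>u v. u" and U = "\<lambda>r s k. k" and V = "\<lambda>r s k. 2 * k + 1 - r", symmetric]) auto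
    also have "\<dots> = 0"
    proof (rule infsum_odd_involution[where h = "\<lambda>(u,v). (-1-u,v)"])
      fix x :: "int \<times> int"
      obtain u v where x: "x = (u,v)" by force
      have "int (rra (2*(-1-u)-v+1) + rrb ((-1-u)+2* v)) = int (rra (2* u-v+1) + rrb (u+2* v))"
        using two[of "2*(-1-u)-v+1"] two[of "(-1-u)+2* v"] two[of "2* u-v+1"] two[of "u+2* v"] by (simp add: power2_eq_square algebra_simps)
      hence "rra (2*(-1-u)-v+1) + rrb ((-1-u)+2* v) = rra (2* u-v+1) + rrb (u+2* v)" by (simp only: of_nat_eq_iff)
      moreover have "alt_sign (2*(-1-u)-v+1 + ((-1-u)+2* v)) = (- alt_sign (2* u-v+1 + (u+2* v)) :: 'a)" by (simp add: alt_sign_def)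
      ultimately show "?g (case x of (u,v) \<Rightarrow> (-1-u,v)) = - ?g x"
        unfolding x g_def prod.case by (simp only: mult_minus_left)
    qed auto
    finally show ?thesis .
  qed
  \<comment> \<open>Here \<open>x = 10 * u + 3\<close> and \<open>y = 10 * v + 5\<close>, and
    \<open>v\<close> becoming \<open>-1-v\<close> is the change of sign of \<open>y\<close>.\<close>
  also have "infsum g (C 1) = 0"
  proof -
    let ?g = "\<lambda>(u,v). g (2* u-v, u+2* v+1)"
    have "infsum g (C 1) = infsum ?g UNIV"
      unfolding C_def
      by (rule infsum_lattice_class[where c = 1 and m = 5 and L = "\<lambda>r s. 2 * r + s" and ?f1.0 = "\<lambda>u v. 2* u-v" and ?f2.0 = "\<lambda>u v. u+2* v+1"
        and K = "\<lambda>u v. u" and U = "\<lambda>r s k. k" and V = "\<lambda>r s k. 2 * k - r", symmetric]) auto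
    also have "\<dots> = 0"
    proof (rule infsum_odd_involution[where h = "\<lambda>(u,v). (u,-1-v)"])
      fix x :: "int \<times> int"
      obtain u v where x: "x = (u,v)" by force
      have "int (rra (2* u-(-1-v)) + rrb (u+2*(-1-v)+1)) = int (rra (2* u-v) + rrb (u+2* v+1))"
        using two[of "2* u-(-1-v)"] two[of "u+2*(-1-v)+1"] two[of "2* u-v"] two[of "u+2* v+1"] by (simp add: power2_eq_square algebra_simps)
      hence "rra (2* u-(-1-v)) + rrb (u+2*(-1-v)+1) = rra (2* u-v) + rrb (u+2* v+1)" by (simp only: of_nat_eq_iff)
      moreover have "alt_sign (2* u-(-1-v) + (u+2*(-1-v)+1)) = (- alt_sign (2* u-v + (u+2* v+1)) :: 'a)" by (simp add: alt_sign_def)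
      ultimately show "?g (case x of (u,v) \<Rightarrow> (u,-1-v)) = - ?g x"
        unfolding x g_def prod.case by (simp only: mult_minus_left)
    qed auto
    finally show ?thesis .
  qed
  finally show ?thesis by simp
qed

section \<open>Landen's transformation\<close>

lemma ellK_arg_pos:
  fixes k :: real
  assumes "\<bar>k\<bar> < 1"
  shows "0 < 1 - k\<^sup>2 * (sin t)\<^sup>2"
proof -
  have "k\<^sup>2 * (sin t)\<^sup>2 \<le> k\<^sup>2 * 1" by (intro mult_left_mono) (auto simp: abs_square_le_1)
  moreover have "k\<^sup>2 < 1" using assms by (simp add: abs_square_less_1)
  ultimately show ?thesis by linarith
qed

lemma ellK_continuous:
  assumes "\<bar>k\<bar> < 1"
  shows "continuous_on S (\<lambda>t. 1 / sqrt (1 - k\<^sup>2 * (sin t)\<^sup>2))"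
  using ellK_arg_pos[OF assms] by (intro continuous_intros) (auto simp: less_imp_neq[symmetric] dest: less_imp_neq)

text \<open>Landen's substitution takes the interval up to pi/2 to the interval up to pi, where this
  symmetry about pi/2 is needed.\<close>

lemma ellK_double:
  assumes k: "\<bar>k\<bar> < 1"
  shows "integral {0..pi} (\<lambda>t. 1 / sqrt (1 - k\<^sup>2 * (sin t)\<^sup>2)) = 2 * ellK k"
proof -
  define f where "f = (\<lambda>t. 1 / sqrt (1 - k\<^sup>2 * (sin t)\<^sup>2))"
  have cont: "continuous_on S f" for S unfolding f_def by (rule ellK_continuous[OF k])
  have "((\<lambda>x. - 1 *\<^sub>R f (pi - x)) has_integral (integral {pi - 0..pi - pi/2} f - integral {pi - pi/2..pi - 0} f)) {0..pi/2}"
    by (rule has_integral_substitution_general[where s = "{}" and c = 0 and d = pi])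
       (auto intro!: cont derivative_eq_intros continuous_intros)
  moreover have "integral {pi - 0..pi - pi/2} f = 0"
    using pi_gt_zero by simp
  ultimately have "((\<lambda>x. - f x) has_integral (- integral {pi/2..pi} f)) {0..pi/2}"
    by (simp add: f_def)
  hence "integral {0..pi/2} f = integral {pi/2..pi} f"
    by (auto dest!: integral_unique)
  moreover have "integral {0..pi/2} f + integral {pi/2..pi} f = integral {0..pi} f"
    by (intro Henstock_Kurzweil_Integration.integral_combine integrable_continuous_interval cont) auto
  ultimately show ?thesis by (simp add: ellK_def f_def)
qed

text \<open>This is \<open>t + arctan (c * tan t)\<close>, written so that it is smooth at \<open>t = pi / 2\<close>.\<close>

definition landen :: "real \<Rightarrow> real \<Rightarrow> real" where
  "landen c t = 2 * t - arctan ((1 - c) * sin t * cos t / ((cos t)\<^sup>2 + c * (sin t)\<^sup>2))"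

text \<open>\<open>D\<close> is the radicand of the integral with modulus
  \<open>sqrt (1 - c\<^sup>2)\<close>. The arctangent in \<open>landen\<close> is an angle with
  cosine \<open>M / sqrt D\<close>, by the last identity; addition formulas do the rest.\<close>

lemma landen_facts:
  fixes c t :: real
  assumes c: "0 < c"
  defines "D \<equiv> (cos t)\<^sup>2 + c\<^sup>2 * (sin t)\<^sup>2" and "M \<equiv> (cos t)\<^sup>2 + c * (sin t)\<^sup>2"
  shows "D > 0" "M > 0" "sin (landen c t) = (1 + c) * sin t * cos t / sqrt D"
    and "(landen c has_field_derivative ((1 + c) * M / D)) (at t within S)"
    and "D = M\<^sup>2 + ((1 - c) * sin t * cos t)\<^sup>2"
proof -
  define s x where "s = sin t" "x = cos t"
  have sx: "s\<^sup>2 + x\<^sup>2 = 1" unfolding s_x_def by simp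
  hence x2: "x\<^sup>2 = 1 - s\<^sup>2" by simp
  have pos: "x\<^sup>2 + b * s\<^sup>2 > 0" if "b > 0" for b
  proof (cases "s = 0")
    case False
    thus ?thesis using that by (intro add_nonneg_pos) auto
  qed (use sx in auto)
  show D: "D > 0" and M: "M > 0" unfolding D_def M_def using pos[of "c\<^sup>2"] pos[of c] c by (auto simp: s_x_def)
  have D': "D = x\<^sup>2 + c\<^sup>2 * s\<^sup>2" and M': "M = x\<^sup>2 + c * s\<^sup>2" by (simp_all add: D_def M_def s_x_def)
  have "M\<^sup>2 + ((1 - c) * s * x)\<^sup>2 = D * (s\<^sup>2 + x\<^sup>2)"
    unfolding D' M' by (simp add: power2_eq_square algebra_simps)
  thus DM: "D = M\<^sup>2 + ((1 - c) * sin t * cos t)\<^sup>2" using sx by (simp add: s_x_def)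
  define u where "u = (1 - c) * s * x / M"
  have u1: "1 + u\<^sup>2 = D / M\<^sup>2" using M DM by (simp add: u_def s_x_def field_simps)
  have sq: "sqrt (1 + u\<^sup>2) = sqrt D / M" using M by (simp add: u1 real_sqrt_divide)
  have "sin (landen c t) = sin (2 * t) * cos (arctan u) - cos (2 * t) * sin (arctan u)"
    unfolding landen_def u_def s_x_def M_def by (rule sin_diff)
  also have "\<dots> = 2 * s * x * (M / sqrt D) - (x\<^sup>2 - s\<^sup>2) * ((1 - c) * s * x / sqrt D)"
    unfolding cos_arctan sin_arctan sq sin_double cos_double s_x_def[symmetric] using M by (simp add: u_def)
  also have "\<dots> = s * x * (2 * M - (x\<^sup>2 - s\<^sup>2) * (1 - c)) / sqrt D"
    using D by (simp add: field_simps)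
  also have "2 * M - (x\<^sup>2 - s\<^sup>2) * (1 - c) = (1 + c) * (s\<^sup>2 + x\<^sup>2)"
    unfolding M' by (simp add: algebra_simps)
  finally show "sin (landen c t) = (1 + c) * sin t * cos t / sqrt D"
    unfolding sx by (simp add: s_x_def mult_ac)
  have "(landen c has_field_derivative (2 - inverse (1 + u\<^sup>2) * 
      (((1 - c) * (x * x + s * (- s)) * M - (1 - c) * s * x * (2 * x * (- s) + c * (2 * s * x))) / (M * M)))) (at t within S)"
    unfolding landen_def[abs_def] u_def s_x_def M_def
    by (rule derivative_eq_intros refl | use M in \<open>simp add: M_def\<close>; fail)+ (use M in \<open>simp add: M_def field_simps\<close>)
  also have "2 - inverse (1 + u\<^sup>2) * 
      (((1 - c) * (x * x + s * (- s)) * M - (1 - c) * s * x * (2 * x * (- s) + c * (2 * s * x))) / (M * M)) =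
      (2 * D - ((1 - c) * (x\<^sup>2 - s\<^sup>2) * M + 2 * (1 - c)\<^sup>2 * s\<^sup>2 * x\<^sup>2)) / D"
    using M D unfolding u1 by (simp add: field_simps power2_eq_square)
  also have "2 * D - ((1 - c) * (x\<^sup>2 - s\<^sup>2) * M + 2 * (1 - c)\<^sup>2 * s\<^sup>2 * x\<^sup>2) = (1 + c) * M"
    unfolding D' M' x2 by (simp add: power2_eq_square algebra_simps)
  finally show "(landen c has_field_derivative ((1 + c) * M / D)) (at t within S)" .
qed

text \<open>Under the substitution the radicand on the left becomes \<open>M\<^sup>2 / D\<close>, in
  the notation of \<open>landen_facts\<close>, and the derivative \<open>(1 + c) * M / D\<close>
  cancels \<open>M\<close>, leaving \<open>(1 + c) / sqrt D\<close>.\<close>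

lemma landen_transformation:
  fixes c :: real
  assumes c: "0 < c" "c \<le> 1"
  shows "2 * ellK ((1 - c) / (1 + c)) = (1 + c) * ellK (sqrt (1 - c\<^sup>2))"
proof -
  define k where "k = (1 - c) / (1 + c)"
  have k: "\<bar>k\<bar> < 1" using c by (simp add: k_def divide_less_eq)
  define f where "f = (\<lambda>t. 1 / sqrt (1 - k\<^sup>2 * (sin t)\<^sup>2))"
  let ?D = "\<lambda>t. (cos t)\<^sup>2 + c\<^sup>2 * (sin t)\<^sup>2" and ?M = "\<lambda>t. (cos t)\<^sup>2 + c * (sin t)\<^sup>2"
  have "((\<lambda>t. ((1 + c) * ?M t / ?D t) *\<^sub>R f (landen c t)) has_integral (integral {landen c 0..landen c (pi/2)} f)) {0..pi/2}"
  \<comment> \<open>The interval only has to contain all values of \<open>landen c\<close>; as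
    arctan stays within pi/2, these bounds are generous.\<close>
  proof (rule has_integral_substitution[where c = "- pi" and d = "2 * pi"])
    show "landen c ` {0..pi/2} \<subseteq> {- pi..2 * pi}"
    proof safe
      fix t assume "t \<in> {0..pi/2}"
      moreover have "- (pi/2) < arctan u \<and> arctan u < pi/2" for u using arctan_bounded[of u] by simp
      ultimately show "landen c t \<in> {- pi..2 * pi}" unfolding landen_def atLeastAtMost_iff by (smt (verit) pi_gt_zero field_sum_of_halves)
    qed
    show "continuous_on {- pi..2 * pi} f" unfolding f_def by (rule ellK_continuous[OF k])
    show "landen c 0 \<le> landen c (pi/2)" by (simp add: landen_def)
  qed (use c in \<open>auto intro: landen_facts\<close>)
  moreover have "((1 + c) * ?M t / ?D t) *\<^sub>R f (landen c t) = (1 + c) * (1 / sqrt (1 - (sqrt (1 - c\<^sup>2))\<^sup>2 * (sin t)\<^sup>2))" for t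
  proof -
    note F = landen_facts[OF c(1), of t]
    have "(sqrt (1 - c\<^sup>2))\<^sup>2 = 1 - c\<^sup>2" using c by (simp add: power_le_one)
    hence D: "1 - (sqrt (1 - c\<^sup>2))\<^sup>2 * (sin t)\<^sup>2 = ?D t"
      by (simp only: cos_squared_eq) (simp add: left_diff_distrib)
    have "1 - k\<^sup>2 * (sin (landen c t))\<^sup>2 = 1 - k\<^sup>2 * ((1 + c)\<^sup>2 * (sin t)\<^sup>2 * (cos t)\<^sup>2 / ?D t)"
      unfolding F(3) using F(1) by (simp add: power_divide power_mult_distrib)
    also have "k\<^sup>2 * ((1 + c)\<^sup>2 * (sin t)\<^sup>2 * (cos t)\<^sup>2 / ?D t) = ((1 - c) * sin t * cos t)\<^sup>2 / ?D t"
      using c by (simp add: k_def power_divide power_mult_distrib)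
    also have "1 - \<dots> = (?M t)\<^sup>2 / ?D t"
    proof -
      have "1 - x / z = y / z" if "z > 0" "z = y + x" for x y z :: real
        using that by (simp add: field_simps)
      from this[OF F(1) F(5)] show ?thesis .
    qed
    finally have "f (landen c t) = sqrt (?D t) / ?M t" unfolding f_def using F(2) by (simp add: real_sqrt_divide)
    moreover have "((1 + c) * m / d) *\<^sub>R (sqrt d / m) = (1 + c) * (1 / sqrt d)" if "d > 0" "m > 0" for d m :: real
    proof -
      have "d = sqrt d * sqrt d" using that by simp
      hence "((1 + c) * m / d) *\<^sub>R (sqrt d / m) = ((1 + c) * m / (sqrt d * sqrt d)) * (sqrt d / m)" by simp
      thus ?thesis using that by (simp add: divide_simps del: real_sqrt_mult_self)
    qed
    ultimately show ?thesis unfolding D using F(1,2) by simp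
  qed
  moreover have "landen c 0 = 0" "landen c (pi/2) = pi" by (simp_all add: landen_def)
  ultimately have "((\<lambda>t. (1 + c) * (1 / sqrt (1 - (sqrt (1 - c\<^sup>2))\<^sup>2 * (sin t)\<^sup>2))) has_integral (integral {0..pi} f)) {0..pi/2}"
    by simp
  hence "integral {0..pi} f = (1 + c) * ellK (sqrt (1 - c\<^sup>2))"
    unfolding ellK_def by (metis integral_unique integral_mult_right)
  thus ?thesis using ellK_double[OF k] by (simp add: f_def k_def)
qed

section \<open>Bounds for the complete elliptic integral\<close>

lemma ellK_integrable:
  assumes "\<bar>k\<bar> < 1"
  shows "(\<lambda>t. 1 / sqrt (1 - k\<^sup>2 * (sin t)\<^sup>2)) integrable_on {0..pi/2}"
  by (intro integrable_continuous_interval ellK_continuous assms)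

lemma ellK_bounds:
  assumes k: "\<bar>k\<bar> < 1"
  shows "pi/2 \<le> ellK k" "ellK k \<le> pi/2 / sqrt (1 - k\<^sup>2)"
proof -
  have k2: "k\<^sup>2 < 1" using k by (simp add: abs_square_less_1)
  have "integral {0..pi/2} (\<lambda>t::real. 1) \<le> ellK k"
    unfolding ellK_def
  proof (rule integral_le)
    fix t :: real
    have "1 - k\<^sup>2 * (sin t)\<^sup>2 \<le> 1" by simp
    hence "sqrt (1 - k\<^sup>2 * (sin t)\<^sup>2) \<le> 1" by simp
    thus "1 \<le> 1 / sqrt (1 - k\<^sup>2 * (sin t)\<^sup>2)" using ellK_arg_pos[OF k, of t] by simp
  qed (use ellK_integrable[OF k] in auto)
  thus "pi/2 \<le> ellK k" by simp
  have "ellK k \<le> integral {0..pi/2} (\<lambda>t::real. 1 / sqrt (1 - k\<^sup>2))"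
    unfolding ellK_def
  proof (rule integral_le)
    fix t :: real
    have "k\<^sup>2 * (sin t)\<^sup>2 \<le> k\<^sup>2 * 1" by (intro mult_left_mono) (auto simp: abs_square_le_1)
    thus "1 / sqrt (1 - k\<^sup>2 * (sin t)\<^sup>2) \<le> 1 / sqrt (1 - k\<^sup>2)"
      using k2 by (intro divide_left_mono real_sqrt_le_mono mult_pos_pos) (auto simp: ellK_arg_pos[OF k])
  qed (use ellK_integrable[OF k] in auto)
  thus "ellK k \<le> pi/2 / sqrt (1 - k\<^sup>2)" by simp
qed

lemma ellK_strict_mono:
  assumes "0 \<le> k" "k < l" "l < 1"
  shows "ellK k < ellK l"
  unfolding ellK_def
proof (rule integral_less_real)
  fix t :: real assume t: "t \<in> {0<..<pi/2}"
  have s: "sin t > 0" using t by (intro sin_gt_zero) auto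
  have "k\<^sup>2 * (sin t)\<^sup>2 < l\<^sup>2 * (sin t)\<^sup>2" using assms s by (intro mult_strict_right_mono power_strict_mono) auto
  thus "1 / sqrt (1 - k\<^sup>2 * (sin t)\<^sup>2) < 1 / sqrt (1 - l\<^sup>2 * (sin t)\<^sup>2)"
    using ellK_arg_pos[of k t] ellK_arg_pos[of l t] assms
    by (intro divide_strict_left_mono real_sqrt_less_mono mult_pos_pos) auto
qed (use assms pi_gt_zero in \<open>auto intro!: ellK_continuous simp del: pi_gt_zero\<close>)

lemma ellK_compl_arg:
  assumes "0 < k" "k < 1"
  shows "1 - (sqrt (1 - k\<^sup>2))\<^sup>2 * (sin t)\<^sup>2 = k\<^sup>2 + (1 - k\<^sup>2) * (cos t)\<^sup>2"
proof -
  have "k\<^sup>2 < 1" using assms by (simp add: power_less_one_iff)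
  thus ?thesis by (simp add: cos_squared_eq algebra_simps)
qed

text \<open>An elementary comparison integral: the inserted \<open>sin t\<close> makes it exactly
  integrable and keeps the logarithmic growth as \<open>a\<close> tends to 0.\<close>

lemma arsinh_cos_has_integral:
  fixes a :: real
  assumes a: "a > 0"
  shows "((\<lambda>t. sin t / sqrt (a\<^sup>2 + (cos t)\<^sup>2)) has_integral arsinh (1 / a)) {0..pi/2}"
proof -
  have "((\<lambda>t. sin t / sqrt (a\<^sup>2 + (cos t)\<^sup>2)) has_integral (- arsinh (cos (pi/2) / a) - (- arsinh (cos 0 / a)))) {0..pi/2}"
  proof (rule fundamental_theorem_of_calculus)
    fix t :: real
    have "sqrt ((cos t / a)\<^sup>2 + 1) = sqrt (a\<^sup>2 + (cos t)\<^sup>2) / a"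
    proof -
      have "(cos t / a)\<^sup>2 + 1 = (a\<^sup>2 + (cos t)\<^sup>2) / a\<^sup>2" using a by (simp add: field_simps)
      thus ?thesis using a by (simp add: real_sqrt_divide)
    qed
    moreover have "((\<lambda>t. - arsinh (cos t / a)) has_field_derivative - (1 / sqrt ((cos t / a)\<^sup>2 + 1) * (- sin t / a))) (at t within {0..pi/2})"
      using a by (intro DERIV_minus DERIV_chain2[OF arsinh_real_has_field_derivative])
        (auto intro!: derivative_eq_intros)
    ultimately have "((\<lambda>t. - arsinh (cos t / a)) has_field_derivative sin t / sqrt (a\<^sup>2 + (cos t)\<^sup>2)) (at t within {0..pi/2})"
      using a by simp
    thus "((\<lambda>t. - arsinh (cos t / a)) has_vector_derivative sin t / sqrt (a\<^sup>2 + (cos t)\<^sup>2)) (at t within {0..pi/2})"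
      by (simp add: has_real_derivative_iff_has_vector_derivative)
  qed auto
  thus ?thesis by simp
qed

lemma arsinh_inverse_bounds:
  fixes k :: real
  assumes k: "0 < k" "k < 1"
  shows "ln (1 / k) \<le> arsinh (1 / k)" "arsinh (1 / k) \<le> ln (3 / k)"
proof -
  have "1 / k \<le> 1 / k + sqrt ((1 / k)\<^sup>2 + 1)" by simp
  thus "ln (1 / k) \<le> arsinh (1 / k)" unfolding arsinh_real_def using k by (intro ln_mono) auto
  have "1 \<le> 1 / k" using k by simp
  hence "1 \<le> (1 / k)\<^sup>2" by (simp only: one_le_power)
  hence "sqrt ((1 / k)\<^sup>2 + 1) \<le> sqrt ((2 / k)\<^sup>2)" by (intro real_sqrt_le_mono) (simp add: power_divide)
  also have "sqrt ((2 / k)\<^sup>2) = 2 / k" using k by (subst real_sqrt_abs) simp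
  finally have "1 / k + sqrt ((1 / k)\<^sup>2 + 1) \<le> 1 / k + 2 / k" by (rule add_left_mono)
  also have "1 / k + 2 / k = 3 / k" by (simp add: add_divide_distrib[symmetric])
  finally have "1 / k + sqrt ((1 / k)\<^sup>2 + 1) \<le> 3 / k" .
  moreover have "0 < 1 / k + sqrt ((1 / k)\<^sup>2 + 1)" using k by (intro add_pos_nonneg) auto
  ultimately show "arsinh (1 / k) \<le> ln (3 / k)" unfolding arsinh_real_def by (intro ln_mono) auto
qed

text \<open>The true asymptotics is ln (4 / k). Bounds up to an additive constant suffice, since
  they will be divided by \<open>2 ^ n\<close>.\<close>

lemma ellK_compl_bounds:
  fixes k :: real
  assumes k: "0 < k" "k < 1"
  shows "ln (1 / k) \<le> ellK (sqrt (1 - k\<^sup>2))"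
    and "ellK (sqrt (1 - k\<^sup>2)) \<le> (ln (3 / k) + pi/2) / sqrt (1 - k\<^sup>2)"
proof -
  have k2: "0 < 1 - k\<^sup>2" "k\<^sup>2 < 1" using k by (simp_all add: power_less_one_iff)
  have kc: "\<bar>sqrt (1 - k\<^sup>2)\<bar> < 1" using k k2 by (simp add: real_sqrt_lt_1_iff)
  have E: "ellK (sqrt (1 - k\<^sup>2)) = integral {0..pi/2} (\<lambda>t. 1 / sqrt (k\<^sup>2 + (1 - k\<^sup>2) * (cos t)\<^sup>2))"
    unfolding ellK_def ellK_compl_arg[OF k] ..
  have I: "(\<lambda>t. 1 / sqrt (k\<^sup>2 + (1 - k\<^sup>2) * (cos t)\<^sup>2)) integrable_on {0..pi/2}"
    using ellK_integrable[OF kc] unfolding ellK_compl_arg[OF k] .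
  have pos: "0 < k\<^sup>2 + (1 - k\<^sup>2) * (cos t)\<^sup>2" for t
    using k k2 by (intro add_pos_nonneg) auto
  note A = arsinh_cos_has_integral[OF k(1)]
  have "arsinh (1 / k) \<le> ellK (sqrt (1 - k\<^sup>2))"
    unfolding E integral_unique[OF A, symmetric]
  proof (rule integral_le)
    fix t :: real
    have "(1 - k\<^sup>2) * (cos t)\<^sup>2 \<le> 1 * (cos t)\<^sup>2" using k by (intro mult_right_mono) auto
    thus "sin t / sqrt (k\<^sup>2 + (cos t)\<^sup>2) \<le> 1 / sqrt (k\<^sup>2 + (1 - k\<^sup>2) * (cos t)\<^sup>2)"
      using pos[of t] by (intro frac_le) auto
  qed (use A I in \<open>auto simp: has_integral_iff\<close>)
  thus "ln (1 / k) \<le> ellK (sqrt (1 - k\<^sup>2))" using arsinh_inverse_bounds[OF k] by linarith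
  \<comment> \<open>Taking \<open>1 - k\<^sup>2\<close> out of the radicand leaves
    \<open>a\<^sup>2 + (cos t)\<^sup>2\<close>. The integrand is then compared through
    \<open>1 - sin t \<le> sqrt W\<close>.\<close>
  define a where "a = k / sqrt (1 - k\<^sup>2)"
  have a: "a > 0" using k k2 by (simp add: a_def)
  note B = arsinh_cos_has_integral[OF a]
  have "((\<lambda>t. (sin t / sqrt (a\<^sup>2 + (cos t)\<^sup>2) + 1) / sqrt (1 - k\<^sup>2)) has_integral (arsinh (1 / a) + pi/2) / sqrt (1 - k\<^sup>2)) {0..pi/2}"
  proof -
    have "((\<lambda>t::real. 1) has_integral pi/2) {0..pi/2}" using has_integral_const_real[of "1::real" 0 "pi/2"] by simp
    from has_integral_divide[OF has_integral_add[OF B this], of "sqrt (1 - k\<^sup>2)"] show ?thesis by simp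
  qed
  moreover have "1 / sqrt (k\<^sup>2 + (1 - k\<^sup>2) * (cos t)\<^sup>2) \<le> (sin t / sqrt (a\<^sup>2 + (cos t)\<^sup>2) + 1) / sqrt (1 - k\<^sup>2)"
    if "t \<in> {0..pi/2}" for t
  proof -
    define s where "s = sin t"
    have s: "0 \<le> s" "s \<le> 1" using that by (auto simp: s_def intro!: sin_ge_zero)
    define W where "W = a\<^sup>2 + (cos t)\<^sup>2"
    have W: "W > 0" using a by (auto simp: W_def intro: add_pos_nonneg)
    have eq: "sqrt (k\<^sup>2 + (1 - k\<^sup>2) * (cos t)\<^sup>2) = sqrt (1 - k\<^sup>2) * sqrt W"
    proof -
      have "k\<^sup>2 + (1 - k\<^sup>2) * (cos t)\<^sup>2 = (1 - k\<^sup>2) * W" using k2 by (simp add: W_def a_def power_divide field_simps)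
      thus ?thesis by (simp add: real_sqrt_mult)
    qed
    have "1 - s \<le> sqrt W"
    proof (rule real_le_rsqrt)
      have "(1 - s)\<^sup>2 \<le> (1 - s) * (1 + s)" unfolding power2_eq_square using s by (intro mult_left_mono) auto
      also have "\<dots> = (cos t)\<^sup>2" by (simp add: cos_squared_eq s_def power2_eq_square algebra_simps)
      finally show "(1 - s)\<^sup>2 \<le> W" by (simp add: W_def add_increasing)
    qed
    hence "1 / sqrt W \<le> s / sqrt W + 1" using W by (simp add: field_simps)
    hence "1 / sqrt W / sqrt (1 - k\<^sup>2) \<le> (s / sqrt W + 1) / sqrt (1 - k\<^sup>2)" using k2 by (intro divide_right_mono) auto
    thus ?thesis unfolding eq W_def s_def by (simp add: mult.commute)
  qed
  ultimately have "ellK (sqrt (1 - k\<^sup>2)) \<le> (arsinh (1 / a) + pi/2) / sqrt (1 - k\<^sup>2)"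
    unfolding E using has_integral_le[OF integrable_integral[OF I]] by blast
  also have "arsinh (1 / a) \<le> arsinh (1 / k)"
  proof -
    have "1 / a \<le> 1 / k" using k k2 by (simp add: a_def field_simps)
    thus ?thesis using arsinh_less_iff_real[of "1/k" "1/a"] by linarith
  qed
  hence "(arsinh (1 / a) + pi/2) / sqrt (1 - k\<^sup>2) \<le> (ln (3 / k) + pi/2) / sqrt (1 - k\<^sup>2)"
    using arsinh_inverse_bounds[OF k] k2 by (intro divide_right_mono) auto
  finally show "ellK (sqrt (1 - k\<^sup>2)) \<le> (ln (3 / k) + pi/2) / sqrt (1 - k\<^sup>2)" .
qed

text \<open>As the modulus grows, the numerator of the ratio falls and its denominator rises, so no
  value is taken twice.\<close>

lemma sing_mod_eqI:
  assumes r: "r > 0" and k: "0 < k" "k < 1" and eq: "ellK (sqrt (1 - k\<^sup>2)) / ellK k = sqrt r"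
  shows "sing_mod r = k"
proof -
  have less: "ellK (sqrt (1 - l\<^sup>2)) / ellK l < ellK (sqrt (1 - k\<^sup>2)) / ellK k" if "0 < k" "k < l" "l < 1" for k l :: real
  proof -
    have "k\<^sup>2 < l\<^sup>2" "l\<^sup>2 < 1" using that by (auto intro: power_strict_mono simp: power_less_one_iff)
    hence "ellK (sqrt (1 - l\<^sup>2)) < ellK (sqrt (1 - k\<^sup>2))" using that
      by (intro ellK_strict_mono) (auto simp: real_sqrt_lt_1_iff)
    moreover have "ellK k < ellK l" using that by (intro ellK_strict_mono) auto
    moreover have "ellK k > 0" using ellK_bounds(1)[of k] that pi_gt_zero by (smt (verit) field_sum_of_halves)
    moreover have "ellK (sqrt (1 - l\<^sup>2)) > 0"
      using ellK_bounds(1)[of "sqrt (1 - l\<^sup>2)"] that \<open>l\<^sup>2 < 1\<close> pi_half_gt_zero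
      by (intro less_le_trans[OF pi_half_gt_zero]) (auto simp: real_sqrt_lt_1_iff)
    ultimately show ?thesis by (intro frac_less) auto
  qed
  show ?thesis unfolding sing_mod_def
  proof (rule the_equality)
    fix l assume l: "0 < l \<and> l < 1 \<and> ellK (sqrt (1 - l\<^sup>2)) / ellK l = sqrt r"
    thus "l = k" using less[of l k] less[of k l] k eq by (cases l k rule: linorder_cases) auto
  qed (use assms in auto)
qed

section \<open>The Rogers-Ramanujan recurrence\<close>

lemma rra_Suc: "rra (int (Suc r)) = rra (int r) + 5 * r + 3"
proof -
  have "int (rra (int (Suc r))) = int (rra (int r) + 5 * r + 3)"
    using two_rra[of "int (Suc r)"] two_rra[of "int r"] by (simp add: power2_eq_square algebra_simps)
  thus ?thesis by (simp only: of_nat_eq_iff)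
qed

lemma rra_ge: "r \<le> rra (int r)"
proof (induction r)
  case (Suc r)
  thus ?case unfolding rra_Suc by linarith
qed auto

lemma int_split_has_sum:
  fixes f :: "int \<Rightarrow> real"
  assumes f: "(f has_sum S) UNIV"
    and g: "g sums T" and eq: "\<And>r. g r = f (int r) + f (- int r - 1)"
  shows "S = T"
proof -
  have s: "f summable_on A" for A using f summable_on_subset_banach[of f UNIV] has_sum_imp_summable by blast
  have 1: "infsum f {0..} = infsum (\<lambda>n. f (int n)) UNIV"
    by (rule infsum_reindex_bij_witness[of _ int nat]) auto
  have 2: "infsum f {..<0} = infsum (\<lambda>n. f (- int n - 1)) UNIV"
    by (rule infsum_reindex_bij_witness[of _ "\<lambda>n. - int n - 1" "\<lambda>n. nat (- n - 1)"]) auto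
  have 3: "(\<lambda>n. f (int n)) summable_on UNIV"
    using summable_on_reindex[of int UNIV f] s by (simp add: o_def)
  have 4: "(\<lambda>n. f (- int n - 1)) summable_on UNIV"
    using summable_on_reindex[of "\<lambda>n::nat. - int n - 1" UNIV f] s by (simp add: o_def inj_def)
  have "({0..} \<union> {..<0}) = (UNIV :: int set)" by auto
  hence "S = infsum f ({0..} \<union> {..<0})" using f by (simp add: infsumI)
  also have "\<dots> = infsum f {0..} + infsum f {..<0}"
    by (intro infsum_Un_disjoint s) auto
  also have "\<dots> = infsum g UNIV"
    unfolding 1 2 using infsum_add[OF 3 4] by (simp add: eq[abs_def])
  also have "(g has_sum infsum g UNIV) UNIV"
    using summable_on_add[OF 3 4] by (simp add: eq[abs_def])
  hence "infsum g UNIV = T" using has_sum_imp_sums g sums_unique2 by blast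
  finally show ?thesis .
qed

text \<open>The terms of the Rogers-Selberg series at \<open>a = q ^ (i + 1)\<close>, multiplied by \<open>eul q\<close> so that the products
  become finite.\<close>

definition rr_win :: "real \<Rightarrow> nat \<Rightarrow> nat \<Rightarrow> real" where
  "rr_win q i r = (\<Prod>s<i. 1 - q ^ (r + 1 + s))"

definition rr_G :: "real \<Rightarrow> nat \<Rightarrow> nat \<Rightarrow> real" where
  "rr_G q i r = (- 1) ^ r * q ^ (rra (int r) + 2 * i * r) * (1 - q ^ (2 * (i + 1 + 2 * r))) * rr_win q i r"

definition rr_H :: "real \<Rightarrow> nat \<Rightarrow> nat \<Rightarrow> real" where
  "rr_H q i r = (- 1) ^ r * q ^ (rra (int r) + (2 * i + 1) * r) * (1 - q ^ (i + 1 + 2 * r)) * rr_win q i r"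

lemma rr_win_Suc: "rr_win q (Suc i) r = rr_win q i r * (1 - q ^ (r + 1 + i))"
  by (simp add: rr_win_def)

lemma rr_win_shift: "rr_win q (Suc i) r = (1 - q ^ (r + 1)) * rr_win q i (Suc r)"
  unfolding rr_win_def by (subst prod.lessThan_Suc_shift) simp

text \<open>The boundary term \<open>B i r\<close> vanishes at \<open>r = 0\<close> and in the
  limit, so both series have the same sum. The splitting is \<open>1 - q ^ (i + 1 + 2 * r) = q ^ r *
  (1 - q ^ (r + 1 + i)) + (1 - q ^ r)\<close>.\<close>

lemma rr_H_telescope:
  fixes q :: real
  defines "B \<equiv> \<lambda>i r. (- 1) ^ r * q ^ (rra (int r) + (2 * i + 1) * r) * (1 - q ^ r) * rr_win q i r"
  shows "rr_H q i r = rr_G q (Suc i) r + (B i r - B i (Suc r))"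
proof -
  define A where "A = (- 1) ^ r * q ^ (rra (int r) + (2 * i + 2) * r) * rr_win q (Suc i) r"
  have "rr_H q i r = A + B i r"
  proof -
    define X x y where "X = q ^ (rra (int r) + (2 * i + 1) * r)" "x = q ^ r" "y = q ^ (i + 1)"
    have p: "q ^ (i + 1 + 2 * r) = y * x\<^sup>2" "q ^ (r + 1 + i) = x * y" "q ^ (rra (int r) + (2 * i + 2) * r) = X * x"
      unfolding X_x_y_def power_add[symmetric] power_mult[symmetric] by (simp_all add: algebra_simps)
    show ?thesis
      unfolding rr_H_def A_def B_def rr_win_Suc p X_x_y_def(1,2)[symmetric]
      by (simp add: algebra_simps eval_nat_numeral)
  qed
  moreover have "rr_G q (Suc i) r = A + B i (Suc r)"
  proof -
    have "B i (Suc r) = - ((- 1) ^ r * q ^ (rra (int r) + 5 * r + 3 + (2 * i + 1) * Suc r) * rr_win q (Suc i) r)"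
      unfolding B_def rra_Suc rr_win_shift by simp
    moreover have "rra (int r) + 5 * r + 3 + (2 * i + 1) * Suc r = rra (int r) + 2 * Suc i * r + 2 * (Suc i + 1 + 2 * r)"
      "(2 * i + 2) * r = 2 * Suc i * r"
      by simp_all
    moreover have "a * x * (1 - y) * w = a * x * w + - (a * (x * y) * w)" for a x y w :: real
      by (simp add: algebra_simps)
    ultimately show ?thesis unfolding A_def rr_G_def
      by (simp only: power_add[of q "rra (int r) + _"])
  qed
  ultimately show ?thesis by simp
qed

lemma rr_G_telescope:
  fixes q :: real
  defines "B \<equiv> \<lambda>i r. (- 1) ^ r * q ^ (rra (int r) + 2 * i * r) * (1 - q ^ r) * rr_win q i r"
  shows "rr_G q i r = rr_H q i r + q ^ (i + 1) * rr_H q (Suc i) r + (B i r - B i (Suc r))"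
proof -
  \<comment> \<open>With \<open>x = q ^ r\<close> and \<open>y = q ^ (i + 1)\<close> the splitting
    behind this term is \<open>(1 - y\<^sup>2 * x ^ 4) - x * (1 - y * x\<^sup>2) = (1 - x) + y * x ^
    3 * (1 - x * y)\<close>.\<close>
  define A where "A = (- 1) ^ r * q ^ (rra (int r) + 2 * i * r + (i + 1 + 3 * r)) * rr_win q (Suc i) r"
  have "rr_G q i r - rr_H q i r = A + B i r"
  proof -
    have 1: "rra (int r) + (2 * i + 1) * r = rra (int r) + 2 * i * r + r" by simp
    define X x y where "X = q ^ (rra (int r) + 2 * i * r)" "x = q ^ r" "y = q ^ (i + 1)"
    have p: "q ^ (2 * (i + 1 + 2 * r)) = y\<^sup>2 * x ^ 4" "q ^ (i + 1 + 2 * r) = y * x\<^sup>2" "q ^ (i + 1 + 3 * r) = y * x ^ 3"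
      "q ^ (r + 1 + i) = x * y" "q ^ (rra (int r) + 2 * i * r + r) = X * x"
      unfolding X_x_y_def power_add[symmetric] power_mult[symmetric] by (simp_all add: algebra_simps)
    have q: "q ^ (rra (int r) + 2 * i * r + (i + 1 + 3 * r)) = X * (y * x ^ 3)"
      unfolding power_add[of q "rra (int r) + 2 * i * r"] p(3) X_x_y_def ..
    show ?thesis
      unfolding rr_G_def rr_H_def A_def B_def rr_win_Suc 1 q p X_x_y_def(1,2)[symmetric]
      by (simp add: algebra_simps eval_nat_numeral)
  qed
  moreover have "q ^ (i + 1) * rr_H q (Suc i) r = A + B i (Suc r)"
  proof -
    have "B i (Suc r) = - ((- 1) ^ r * q ^ (rra (int r) + 5 * r + 3 + 2 * i * Suc r) * rr_win q (Suc i) r)"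
      unfolding B_def rra_Suc rr_win_shift by simp
    moreover have "q ^ (rra (int r) + 5 * r + 3 + 2 * i * Suc r) = q ^ (i + 1) * q ^ (rra (int r) + (2 * Suc i + 1) * r) * q ^ (Suc i + 1 + 2 * r)"
      unfolding power_add[symmetric] by (rule arg_cong[of _ _ "\<lambda>n. q ^ n"]) simp
    moreover have "q ^ (rra (int r) + 2 * i * r + (i + 1 + 3 * r)) = q ^ (i + 1) * q ^ (rra (int r) + (2 * Suc i + 1) * r)"
      unfolding power_add[symmetric] by (rule arg_cong[of _ _ "\<lambda>n. q ^ n"]) simp
    ultimately show ?thesis unfolding A_def rr_H_def
      by (simp only: algebra_simps)
  qed
  ultimately show ?thesis by simp
qed

section \<open>Summation of the Rogers-Selberg series and convergence of the continued
  fraction\<close>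

context
  fixes q :: real
  assumes q: "0 < q" "q < 1"
begin

lemma pow01: "0 \<le> q ^ n" "q ^ n \<le> 1"
  using q by (auto intro: power_le_one)

lemma one_minus_pow01: "0 \<le> 1 - q ^ n" "1 - q ^ n \<le> 1"
  using pow01[of n] by auto

lemma rr_win_01: "0 \<le> rr_win q i r" "rr_win q i r \<le> 1"
  unfolding rr_win_def by (intro prod_nonneg prod_le_1 conjI ballI one_minus_pow01)+

lemma rr_bound:
  assumes "0 \<le> x" "x \<le> 1"
  shows "\<bar>(- 1) ^ r * q ^ (rra (int r) + k) * x * rr_win q i r\<bar> \<le> q ^ r * q ^ k"
proof -
  have "\<bar>(- 1) ^ r * q ^ (rra (int r) + k) * x * rr_win q i r\<bar> = q ^ rra (int r) * q ^ k * x * rr_win q i r"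
    using rr_win_01[of i r] assms q by (simp add: abs_mult power_add)
  also have "\<dots> \<le> q ^ r * q ^ k * 1 * 1"
    using rr_win_01[of i r] assms q rra_ge[of r] pow01 by (intro mult_mono power_decreasing) auto
  finally show ?thesis by simp
qed

lemma rr_bound':
  assumes "0 \<le> x" "x \<le> 1"
  shows "\<bar>(- 1) ^ r * q ^ (rra (int r) + k) * x * rr_win q i r\<bar> \<le> q ^ r"
proof -
  have "q ^ r * q ^ k \<le> q ^ r * 1" using pow01 by (intro mult_left_mono) auto
  thus ?thesis using rr_bound[OF assms, of r k i] by simp
qed

lemma geometric_q: "summable (\<lambda>r. q ^ r)"
  using q by (intro summable_geometric) auto

lemma rr_abs_summable: "summable (\<lambda>r. \<bar>rr_G q i r\<bar>)" "summable (\<lambda>r. \<bar>rr_H q i r\<bar>)"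
  unfolding rr_G_def rr_H_def
  by (rule summable_comparison_test[OF _ geometric_q], intro exI[of _ 0] allI impI,
      unfold real_norm_def abs_idempotent, intro rr_bound' one_minus_pow01)+

lemma rr_summable: "summable (rr_G q i)" "summable (rr_H q i)"
  using rr_abs_summable[of i] summable_rabs_cancel by blast+

lemma rr_boundary_LIMSEQ: 
  "(\<lambda>r. (- 1) ^ r * q ^ (rra (int r) + k r) * (1 - q ^ r) * rr_win q i r) \<longlonglongrightarrow> 0"
proof (rule Lim_null_comparison)
  show "\<forall>\<^sub>F r in sequentially. norm ((- 1) ^ r * q ^ (rra (int r) + k r) * (1 - q ^ r) * rr_win q i r) \<le> q ^ r"
    using rr_bound'[OF one_minus_pow01] by (intro always_eventually) auto
  show "(\<lambda>r. q ^ r) \<longlonglongrightarrow> 0" using q by (intro LIMSEQ_power_zero) auto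
qed

definition rr_P :: "nat \<Rightarrow> real" where "rr_P i = suminf (rr_G q i)"

lemma rr_H_suminf: "suminf (rr_H q i) = rr_P (Suc i)"
proof -
  let ?B = "\<lambda>r. (- 1) ^ r * q ^ (rra (int r) + (2 * i + 1) * r) * (1 - q ^ r) * rr_win q i r"
  have "(\<lambda>r. rr_G q (Suc i) r + (?B r - ?B (Suc r))) sums (rr_P (Suc i) + (?B 0 - 0))"
    unfolding rr_P_def by (intro sums_add summable_sums rr_summable telescope_sums' rr_boundary_LIMSEQ)
  hence "rr_H q i sums (rr_P (Suc i) + (?B 0 - 0))" using rr_H_telescope[of q i] by (simp cong: sums_cong)
  thus ?thesis by (simp add: sums_iff)
qed

text \<open>Divided by \<open>rr_P (Suc i)\<close>, this is the recursion of \<open>rr_denom\<close>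
  for the quotients of consecutive values.\<close>

lemma rr_P_rec: "rr_P i = rr_P (Suc i) + q ^ (i + 1) * rr_P (Suc (Suc i))"
proof -
  let ?B = "\<lambda>r. (- 1) ^ r * q ^ (rra (int r) + 2 * i * r) * (1 - q ^ r) * rr_win q i r"
  have "(\<lambda>r. rr_H q i r + q ^ (i + 1) * rr_H q (Suc i) r + (?B r - ?B (Suc r))) sums 
        (suminf (rr_H q i) + q ^ (i + 1) * suminf (rr_H q (Suc i)) + (?B 0 - 0))"
    by (intro sums_add sums_mult summable_sums rr_summable telescope_sums' rr_boundary_LIMSEQ)
  hence "rr_G q i sums (suminf (rr_H q i) + q ^ (i + 1) * suminf (rr_H q (Suc i)) + (?B 0 - 0))"
    using rr_G_telescope[of q i] by (simp cong: sums_cong)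
  thus ?thesis unfolding rr_H_suminf by (simp add: sums_iff rr_P_def)
qed

text \<open>Only the term for \<open>r = 0\<close> survives; the rest is at most
  \<open>q ^ i\<close> times a geometric series. The limit serves to show positivity.\<close>

lemma rr_P_LIMSEQ: "rr_P \<longlonglongrightarrow> eul q"
proof -
  have head: "(\<lambda>i. rr_G q i 0) \<longlonglongrightarrow> eul q"
  proof -
    have "(\<lambda>i. (1 - q\<^sup>2 * (q\<^sup>2) ^ i) * (\<Prod>s<i. 1 - q * q ^ s)) \<longlonglongrightarrow> (1 - q\<^sup>2 * 0) * eul q"
      using q by (intro tendsto_intros qp_LIMSEQ LIMSEQ_power_zero) (auto simp: power_less_one_iff)
    moreover have "rr_G q i 0 = (1 - q\<^sup>2 * (q\<^sup>2) ^ i) * (\<Prod>s<i. 1 - q * q ^ s)" for i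
      unfolding rr_G_def rr_win_def rra_def power_mult[symmetric] power_add[symmetric] by simp
    ultimately show ?thesis by simp
  qed
  have "(\<lambda>i. rr_P i - rr_G q i 0) \<longlonglongrightarrow> 0"
  proof (rule Lim_null_comparison)
    show "(\<lambda>i. q ^ i * (\<Sum>r. q ^ r)) \<longlonglongrightarrow> 0"
      using q by (intro tendsto_mult_left_zero LIMSEQ_power_zero) auto
    have "\<bar>rr_P i - rr_G q i 0\<bar> \<le> q ^ i * (\<Sum>r. q ^ r)" for i
    proof -
      have b: "\<bar>rr_G q i (Suc r)\<bar> \<le> q ^ i * q ^ r" for r
      proof -
        have "\<bar>rr_G q i (Suc r)\<bar> \<le> q ^ Suc r * q ^ (2 * i * Suc r)"
          unfolding rr_G_def by (intro rr_bound one_minus_pow01)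
        also have "\<dots> \<le> q ^ r * q ^ i"
          using q pow01 by (intro mult_mono power_decreasing) auto
        finally show ?thesis by (simp add: mult.commute)
      qed
      have s: "summable (\<lambda>r. \<bar>rr_G q i (Suc r)\<bar>)" using rr_abs_summable(1)[of i] by (subst summable_Suc_iff)
      have "rr_P i - rr_G q i 0 = (\<Sum>r. rr_G q i (Suc r))"
        unfolding rr_P_def using suminf_split_head[OF rr_summable(1)] by simp
      also have "\<bar>\<dots>\<bar> \<le> (\<Sum>r. \<bar>rr_G q i (Suc r)\<bar>)" by (rule summable_rabs[OF s])
      also have "\<dots> \<le> (\<Sum>r. q ^ i * q ^ r)" by (intro suminf_le b s summable_mult geometric_q)
      also have "\<dots> = q ^ i * (\<Sum>r. q ^ r)" by (rule suminf_mult[OF geometric_q])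
      finally show ?thesis .
    qed
    thus "\<forall>\<^sub>F i in sequentially. norm (rr_P i - rr_G q i 0) \<le> q ^ i * (\<Sum>r. q ^ r)" by (intro always_eventually) simp
  qed
  from tendsto_add[OF this head] show ?thesis by simp
qed

text \<open>The positive limit gives positivity for large indices, and the recurrence, having
  positive coefficients, carries it down to all smaller ones.\<close>

lemma rr_P_pos: "rr_P i > 0"
proof -
  have "eul q > 0" using q by (intro qp_pos) auto
  hence "\<forall>\<^sub>F i in sequentially. rr_P i > 0" by (rule order_tendstoD[OF rr_P_LIMSEQ])
  then obtain N where N: "\<And>i. i \<ge> N \<Longrightarrow> rr_P i > 0" by (auto simp: eventually_sequentially)
  have "\<forall>i. i + n \<ge> N \<longrightarrow> rr_P i > 0" for n
  proof (induction n)
    case (Suc n)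
    show ?case
    proof (intro allI impI)
      fix i assume "i + Suc n \<ge> N"
      hence "rr_P (Suc i) > 0" "rr_P (Suc (Suc i)) > 0" using Suc by auto
      thus "rr_P i > 0" using rr_P_rec[of i] q by (simp add: add_pos_nonneg)
    qed
  qed (use N in auto)
  from this[of N] show ?thesis by simp
qed

lemma rr_denom_ge_1: "rr_denom q j n \<ge> 1"
  by (induction n arbitrary: j) (use q in \<open>force intro: divide_nonneg_nonneg order.trans[OF zero_le_one]\<close>)+

text \<open>One level of the fraction multiplies the error by at most \<open>q\<close>, because both
  denominators are at least 1. At depth 0 the error lies between 0 and 1 in absolute value.\<close>

lemma rr_denom_error: "\<bar>rr_denom q j n - rr_P j / rr_P (Suc j)\<bar> \<le> q ^ n"
proof -
  define c where "c = (\<lambda>j. rr_P j / rr_P (Suc j))"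
  have c: "c j = 1 + q ^ (j + 1) / c (j + 1)" for j
    using rr_P_rec[of j] rr_P_pos[of "Suc j"] by (simp add: c_def field_simps)
  have c1: "c j \<ge> 1" for j
  proof -
    have "c (j + 1) > 0" using rr_P_pos by (simp add: c_def)
    thus ?thesis using c[of j] q by simp
  qed
  have "\<bar>rr_denom q j n - c j\<bar> \<le> q ^ n"
  proof (induction n arbitrary: j)
    case 0
    have "q ^ (j + 1) / c (j + 1) \<le> 1" using c1[of "j + 1"] pow01[of "j + 1"] by (simp add: divide_le_eq)
    moreover have "q ^ (j + 1) / c (j + 1) \<ge> 0" using c1[of "j + 1"] q by simp
    ultimately show ?case by (simp add: c[of j])
  next
    case (Suc n)
    let ?d = "rr_denom q (j + 1) n" and ?c = "c (j + 1)"
    have d1: "?d \<ge> 1" by (rule rr_denom_ge_1)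
    have "rr_denom q j (Suc n) - c j = q ^ (j + 1) * (?c - ?d) / (?d * ?c)"
      using d1 c1[of "j + 1"] by (subst c) (simp add: divide_simps, simp add: algebra_simps)
    also have "\<bar>\<dots>\<bar> = q ^ (j + 1) * \<bar>?d - ?c\<bar> / (?d * ?c)"
      using d1 c1[of "j + 1"] q by (simp add: abs_mult abs_minus_commute)
    also have "\<dots> \<le> q ^ (j + 1) * \<bar>?d - ?c\<bar> / 1"
      using d1 c1[of "j + 1"] q mult_mono[of 1 ?d 1 ?c] by (intro divide_left_mono) auto
    also have "\<dots> \<le> q * q ^ n"
      using q Suc[of "j + 1"] power_decreasing[of 1 "j + 1" q] by (simp del: power_Suc add: mult_mono)
    finally show ?case by simp
  qed
  thus ?thesis by (simp add: c_def)
qed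

text \<open>The finite products \<open>rr_win\<close> are empty at \<open>i = 0\<close>, and pairing
  \<open>n\<close> with \<open>- n - 1\<close> in the theta series produces the terms of
  \<open>rr_G q 0\<close> and \<open>rr_H q 0\<close>. The latter sum to
  \<open>rr_P 1\<close>.\<close>

lemma rrA_eq: "rrA q = rr_P 0" and rrB_eq: "rrB q = rr_P 1"
proof -
  have n: "norm (- (q ^ 3) * - (q\<^sup>2)) < 1" "norm (- (q ^ 4) * - q) < 1"
    using norm_power_less_1[of q 5] q by (simp_all flip: power_add power_Suc2)
  have e1: "rra (- int r - 1) = rra (int r) + 2 * (1 + 2 * r)" for r
  proof -
    have "int (rra (- int r - 1)) = int (rra (int r) + 2 * (1 + 2 * r))"
      using two_rra[of "- int r - 1"] two_rra[of "int r"] by (simp add: power2_eq_square algebra_simps)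
    thus ?thesis by (simp only: of_nat_eq_iff)
  qed
  have e2: "rrb (int r) = rra (int r) + r" for r
  proof -
    have "int (rrb (int r)) = int (rra (int r) + r)"
      using two_rra[of "int r"] two_rrb[of "int r"] by (simp add: power2_eq_square algebra_simps)
    thus ?thesis by (simp only: of_nat_eq_iff)
  qed
  have e3: "rrb (- int r - 1) = rra (int r) + r + (1 + 2 * r)" for r
  proof -
    have "int (rrb (- int r - 1)) = int (rra (int r) + r + (1 + 2 * r))"
      using two_rra[of "int r"] two_rrb[of "- int r - 1"] by (simp add: power2_eq_square algebra_simps)
    thus ?thesis by (simp only: of_nat_eq_iff)
  qed
  have sg: "alt_sign (int r) = (- 1 :: real) ^ r" "alt_sign (- int r - 1) = - ((- 1 :: real) ^ r)" for r
    by (auto simp: alt_sign_def)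
  show "rrA q = rr_P 0"
    unfolding rrA_def
  proof (rule int_split_has_sum[OF ftheta_has_sum[OF n(1)]])
    show "rr_G q 0 sums rr_P 0" unfolding rr_P_def by (intro summable_sums rr_summable)
    show "rr_G q 0 r = theta_term (- (q ^ 3)) (- q\<^sup>2) (int r) + theta_term (- (q ^ 3)) (- q\<^sup>2) (- int r - 1)" for r
      unfolding rrA_term e1 sg rr_G_def rr_win_def by (simp add: power_add algebra_simps)
  qed
  show "rrB q = rr_P 1"
    unfolding rrB_def
  proof (rule int_split_has_sum[OF ftheta_has_sum[OF n(2)]])
    show "rr_H q 0 sums rr_P 1" using summable_sums[OF rr_summable(2)[of 0]] unfolding rr_H_suminf by simp
    show "rr_H q 0 r = theta_term (- (q ^ 4)) (- q) (int r) + theta_term (- (q ^ 4)) (- q) (- int r - 1)" for r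
    proof -
      have "q ^ (r * 3) = q ^ r * q ^ (r * 2)" by (simp add: mult.commute flip: power_add)
      thus ?thesis unfolding rrB_term e2 e3 sg rr_H_def rr_win_def by (simp add: power_add algebra_simps)
    qed
  qed
qed

lemma rrA_pos: "rrA q > 0" and rrB_pos: "rrB q > 0"
  by (simp_all add: rrA_eq rrB_eq rr_P_pos)

theorem rr_cfrac_eq: "rr_cfrac q = q powr (1/5) * rrB q / rrA q"
proof -
  have "(\<lambda>n. rr_denom q 0 n - rr_P 0 / rr_P 1) \<longlonglongrightarrow> 0"
  proof (rule Lim_null_comparison)
    show "\<forall>\<^sub>F n in sequentially. norm (rr_denom q 0 n - rr_P 0 / rr_P 1) \<le> q ^ n"
      using rr_denom_error[of 0] by (intro always_eventually) simp
    show "(\<lambda>n. q ^ n) \<longlonglongrightarrow> 0" using q by (intro LIMSEQ_power_zero) auto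
  qed
  hence "(\<lambda>n. rr_denom q 0 n) \<longlonglongrightarrow> rr_P 0 / rr_P 1" by (simp add: LIM_zero_iff)
  hence "(\<lambda>n. q powr (1/5) / rr_denom q 0 n) \<longlonglongrightarrow> q powr (1/5) / (rr_P 0 / rr_P 1)"
    using rr_P_pos[of 0] rr_P_pos[of 1] by (intro tendsto_intros) auto
  thus ?thesis unfolding rr_cfrac_def rrA_eq rrB_eq by (simp add: limI)
qed

end

section \<open>The value of the continued fraction\<close>

lemma primitive_fifth_root_exists: "\<exists>z::complex. 1 + z + z ^ 2 + z ^ 3 + z ^ 4 = 0"
proof
  define z where "z = cis (2 * pi / 5)"
  have "z ^ 5 = cis (real 5 * (2 * pi / 5))" unfolding z_def by (rule Complex.DeMoivre)
  also have "real 5 * (2 * pi / 5) = 2 * pi" by simp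
  also have "cis (2 * pi) = 1" by (rule cis_2pi)
  finally have "z ^ 5 = 1" .
  moreover have "z ^ 5 - 1 = (z - 1) * (1 + z + z ^ 2 + z ^ 3 + z ^ 4)"
    by (simp add: algebra_simps eval_nat_numeral)
  ultimately have "(z - 1) * (1 + z + z ^ 2 + z ^ 3 + z ^ 4) = 0" by simp
  moreover have "z \<noteq> 1"
  proof
    assume "z = 1"
    hence "sin (2 * pi / 5) = 0" by (auto simp: z_def complex_eq_iff)
    moreover have "sin (2 * pi / 5) > 0" by (rule sin_gt_zero) auto
    ultimately show False by simp
  qed
  ultimately show "1 + cis (2 * pi / 5) + cis (2 * pi / 5) ^ 2 + cis (2 * pi / 5) ^ 3 + cis (2 * pi / 5) ^ 4 = 0"
    by (simp add: z_def)
qed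

lemma fifth_root_prod':
  fixes z x y :: "'a::field"
  assumes "1 + z + z ^ 2 + z ^ 3 + z ^ 4 = 0" "y \<noteq> 0"
  shows "(\<Prod>j<5. y - z ^ j * x) = y ^ 5 - x ^ 5"
proof -
  have "y - z ^ j * x = y * (1 - z ^ j * (x / y))" for j using assms(2) by (simp add: field_simps)
  hence "(\<Prod>j<5. y - z ^ j * x) = y ^ 5 * (\<Prod>j<5. 1 - z ^ j * (x / y))"
    by (simp only: prod.distrib prod_constant card_lessThan)
  also have "(\<Prod>j<5. 1 - z ^ j * (x / y)) = 1 - (x / y) ^ 5"
    using fifth_root_prod[OF assms(1), of "x / y"] unfolding lessThan_5 by (simp add: mult_ac)
  finally show ?thesis using assms(2) by (simp add: power_divide right_diff_distrib)
qed

text \<open>Each factor splits as \<open>(y - a z\<^sup>j x) (y - b z\<^sup>j x)\<close> with \<open>a, b = (1 \<plusminus> sqrt 5) / 2\<close>, and \<open>a\<^sup>5 + b\<^sup>5 = 11\<close>.\<close>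

lemma fifth_root_icosahedral:
  fixes z x y :: complex
  assumes z: "1 + z + z ^ 2 + z ^ 3 + z ^ 4 = 0" and y: "y \<noteq> 0"
  shows "(\<Prod>j<5. y\<^sup>2 - z ^ j * x * y - (z ^ j * x)\<^sup>2) = y ^ 10 - 11 * x ^ 5 * y ^ 5 - x ^ 10"
proof -
  define a b :: complex where "a = (1 + of_real (sqrt 5)) / 2" "b = (1 - of_real (sqrt 5)) / 2"
  have s5: "complex_of_real (sqrt 5) * of_real (sqrt 5) = 5"
    by (metis of_real_mult of_real_numeral real_sqrt_mult_self abs_numeral)
  have ab: "a + b = 1" "a * b = - 1"
    using s5 unfolding a_b_def by (simp_all add: field_simps)
  have "(\<Prod>j<5. y\<^sup>2 - z ^ j * x * y - (z ^ j * x)\<^sup>2) = (\<Prod>j<5. (y - z ^ j * (a * x)) * (y - z ^ j * (b * x)))"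
  proof (rule prod.cong[OF refl])
    fix j
    have "(y - z ^ j * (a * x)) * (y - z ^ j * (b * x)) = y\<^sup>2 - (a + b) * (z ^ j * x * y) + (a * b) * (z ^ j * x)\<^sup>2"
      by (simp add: algebra_simps power2_eq_square)
    thus "y\<^sup>2 - z ^ j * x * y - (z ^ j * x)\<^sup>2 = (y - z ^ j * (a * x)) * (y - z ^ j * (b * x))"
      unfolding ab by simp
  qed
  also have "\<dots> = (y ^ 5 - (a * x) ^ 5) * (y ^ 5 - (b * x) ^ 5)"
    unfolding prod.distrib fifth_root_prod'[OF z y] ..
  also have "\<dots> = y ^ 10 - (a ^ 5 + b ^ 5) * x ^ 5 * y ^ 5 + (a * b) ^ 5 * x ^ 10"
    by (simp add: power_mult_distrib algebra_simps flip: power_add)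
  also have "a ^ 5 + b ^ 5 = 11"
  proof -
    have "a\<^sup>2 + b\<^sup>2 = (a + b)\<^sup>2 - 2 * (a * b)" by (simp add: power2_eq_square algebra_simps)
    hence 2: "a\<^sup>2 + b\<^sup>2 = 3" by (simp add: ab)
    have "a ^ 3 + b ^ 3 = (a + b) * (a\<^sup>2 + b\<^sup>2 - a * b)" by (simp add: eval_nat_numeral algebra_simps)
    hence 3: "a ^ 3 + b ^ 3 = 4" unfolding 2 ab by simp
    have "a ^ 5 + b ^ 5 = (a\<^sup>2 + b\<^sup>2) * (a ^ 3 + b ^ 3) - (a * b)\<^sup>2 * (a + b)"
      by (simp add: eval_nat_numeral algebra_simps)
    thus ?thesis unfolding 2 3 ab by simp
  qed
  finally show ?thesis by (simp add: ab)
qed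

text \<open>Replacing \<open>p\<close> by \<open>z ^ j * p\<close> leaves \<open>p ^ 5\<close>, and
  so \<open>rrA (p ^ 5)\<close> and \<open>rrB (p ^ 5)\<close>, unchanged; the five instances of the
  dissection differ only in the explicit \<open>p\<close>.\<close>

lemma rr_quintic_complex:
  fixes p :: complex
  assumes p: "norm p < 1" and A: "rrA (p ^ 5) \<noteq> 0"
  shows "(rrA (p ^ 5) ^ 10 - 11 * p ^ 5 * rrA (p ^ 5) ^ 5 * rrB (p ^ 5) ^ 5 - p ^ 10 * rrB (p ^ 5) ^ 10) * eul (p ^ 25)
         = eul (p ^ 5) ^ 11"
proof -
  obtain z :: complex where z: "1 + z + z ^ 2 + z ^ 3 + z ^ 4 = 0" using primitive_fifth_root_exists by blast
  define A B where "A = rrA (p ^ 5)" "B = rrB (p ^ 5)"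
  have "(\<Prod>j<5. A\<^sup>2 - z ^ j * (p * B) * A - (z ^ j * (p * B))\<^sup>2) = (\<Prod>j<5. eul (z ^ j * p) * eul (p ^ 5))"
  proof (rule prod.cong[OF refl])
    fix j
    have n: "norm (z ^ j * p) < 1" using p norm_fifth_root[OF z] by (simp add: norm_mult norm_power)
    have 5: "(z ^ j * p) ^ 5 = p ^ 5"
      using fifth_root_power_eq_1[OF z] by (metis (no_types, lifting) mult.commute mult_1 power_mult power_mult_distrib power_one)
    show "A\<^sup>2 - z ^ j * (p * B) * A - (z ^ j * (p * B))\<^sup>2 = eul (z ^ j * p) * eul (p ^ 5)"
      using rr_dissection[OF n] unfolding rrA_mult_rrB[OF n] unfolding 5 A_B_def
      by (simp add: power_mult_distrib mult_ac)
  qed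
  also have "\<dots> = (\<Prod>j<5. eul (z ^ j * p)) * eul (p ^ 5) ^ 5" by (simp add: prod.distrib)
  finally have "(A ^ 10 - 11 * (p * B) ^ 5 * A ^ 5 - (p * B) ^ 10) * eul (p ^ 25) = 
      ((\<Prod>j<5. eul (z ^ j * p)) * eul (p ^ 25)) * eul (p ^ 5) ^ 5"
    using A fifth_root_icosahedral[OF z, of A "p * B"] by (simp add: A_B_def)
  also have "\<dots> = eul (p ^ 5) ^ 11"
    unfolding eul_fifth_roots[OF z p] by (simp flip: power_add)
  finally show ?thesis by (simp add: A_B_def power_mult_distrib mult_ac)
qed

lemma of_real_rr:
  fixes q :: real
  assumes q: "\<bar>q\<bar> < 1"
  shows "(rrA (of_real q) :: complex) = of_real (rrA q)" "(rrB (of_real q) :: complex) = of_real (rrB q)"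
proof -
  have n: "norm (- (q ^ 3) * - (q\<^sup>2)) < 1" "norm (- (q ^ 4) * - q) < 1"
    using norm_power_less_1[of q 5] q by (simp_all flip: power_add power_Suc2)
  show "(rrA (of_real q) :: complex) = of_real (rrA q)" "(rrB (of_real q) :: complex) = of_real (rrB q)"
    using of_real_ftheta[OF n(1), where 'a = complex] of_real_ftheta[OF n(2), where 'a = complex]
    by (simp_all add: rrA_def rrB_def)
qed

lemma rr_quintic:
  fixes q :: real
  assumes q: "0 < q" "q < 1"
  shows "rrA q ^ 10 - 11 * q * rrA q ^ 5 * rrB q ^ 5 - q\<^sup>2 * rrB q ^ 10 = eul q ^ 11 / eul (q ^ 5)"
proof -
  define p where "p = q powr (1/5)"
  have p: "0 < p" "p < 1" using q by (auto simp: p_def intro: powr_less_mono2[of "1/5" q 1, simplified])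
  have p5: "p ^ 5 = q" unfolding p_def using q by (simp add: powr_power)
  define P where "P = complex_of_real p"
  have P5: "P ^ 5 = of_real q" unfolding P_def p5[symmetric] by simp
  have "P ^ 10 = (P ^ 5)\<^sup>2" "P ^ 25 = (P ^ 5) ^ 5" by (simp_all flip: power_mult)
  hence P10: "P ^ 10 = of_real (q\<^sup>2)" and P25: "P ^ 25 = of_real (q ^ 5)" unfolding P5 by simp_all
  have q5: "\<bar>q ^ 5\<bar> < 1" using norm_power_less_1[of q 5] q by simp
  have "norm P < 1" using p by (simp add: P_def)
  moreover have "rrA (P ^ 5) \<noteq> 0" unfolding P5 using rrA_pos[OF q] q by (simp add: of_real_rr)
  moreover have "eul (complex_of_real (q ^ 5)) = of_real (eul (q ^ 5))" by (rule of_real_qp[OF q5])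
  ultimately have "complex_of_real ((rrA q ^ 10 - 11 * q * rrA q ^ 5 * rrB q ^ 5 - q\<^sup>2 * rrB q ^ 10) * eul (q ^ 5)) = of_real (eul q ^ 11)"
    using rr_quintic_complex[of P] q unfolding P10 P25 P5 by (simp add: of_real_rr of_real_qp del: of_real_power flip: of_real_power)
  hence "(rrA q ^ 10 - 11 * q * rrA q ^ 5 * rrB q ^ 5 - q\<^sup>2 * rrB q ^ 10) * eul (q ^ 5) = eul q ^ 11"
    unfolding of_real_eq_iff .
  moreover have "eul (q ^ 5) \<noteq> 0" using q5 by (intro eul_nonzero) simp
  ultimately show ?thesis by (simp add: field_simps)
qed

lemma rr_cfrac_closed_form:
  fixes q :: real
  assumes q: "0 < q" "q < 1"
  defines "a \<equiv> eul q ^ 6 / (q * eul (q ^ 5) ^ 6)"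
  shows "rr_cfrac q = (- 11/2 - a / 2 + 1/2 * sqrt (125 + 22 * a + a\<^sup>2)) powr (1/5)"
proof -
  define A B where "A = rrA q" "B = rrB q"
  have AB: "A > 0" "B > 0" using rrA_pos[OF q] rrB_pos[OF q] by (simp_all add: A_B_def)
  have e: "eul q > 0" "eul (q ^ 5) > 0" using q norm_power_less_1[of q 5] by (auto intro!: qp_pos)
  have m: "A * B = eul q * eul (q ^ 5)" using rrA_mult_rrB[of q] q by (simp add: A_B_def)
  define x where "x = q * B ^ 5 / A ^ 5"
  have x: "x > 0" using AB q by (simp add: x_def)
  have "A ^ 10 - 11 * q * A ^ 5 * B ^ 5 - q\<^sup>2 * B ^ 10 = eul q ^ 11 / eul (q ^ 5)"
    using rr_quintic[OF q] by (simp add: A_B_def)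
  \<comment> \<open>Five factors \<open>A * B\<close> are split off, so that division by
    \<open>A ^ 10\<close> leaves \<open>a * x\<close>.\<close>
  also have "\<dots> = (eul q * eul (q ^ 5)) ^ 5 * eul q ^ 6 / eul (q ^ 5) ^ 6"
  proof -
    have "eul q ^ 11 = eul q ^ 5 * eul q ^ 6" "eul (q ^ 5) ^ 6 = eul (q ^ 5) ^ 5 * eul (q ^ 5)"
      by (simp_all flip: power_add power_Suc2)
    thus ?thesis using e by (simp add: power_mult_distrib)
  qed
  also have "\<dots> = a * q * (A ^ 5 * B ^ 5)"
    unfolding m[symmetric] power_mult_distrib a_def using q by simp
  finally have quintic: "A ^ 10 - 11 * q * A ^ 5 * B ^ 5 - q\<^sup>2 * B ^ 10 = a * q * (A ^ 5 * B ^ 5)" .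
  have "1 - 11 * x - x\<^sup>2 = (A ^ 10 - 11 * q * A ^ 5 * B ^ 5 - q\<^sup>2 * B ^ 10) / A ^ 10"
  proof -
    have "A ^ 10 = A ^ 5 * A ^ 5" "B ^ 10 = B ^ 5 * B ^ 5" by (simp_all flip: power_add)
    thus ?thesis using AB unfolding x_def by (simp add: field_simps power2_eq_square)
  qed
  also have "\<dots> = a * x"
  proof -
    have "A ^ 10 = A ^ 5 * A ^ 5" by (simp flip: power_add)
    thus ?thesis unfolding quintic x_def using AB by (simp add: field_simps)
  qed
  finally have quad: "x\<^sup>2 + (11 + a) * x = 1" by (simp add: algebra_simps)
  have a: "a > 0" using e q by (simp add: a_def)
  \<comment> \<open>Completing the square, with 125 = 11^2 + 4. Positivity of \<open>x\<close> and
    \<open>a\<close> then selects the positive root.\<close>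
  have "(2 * x + (11 + a))\<^sup>2 = 4 * (x\<^sup>2 + (11 + a) * x) + (11 + a)\<^sup>2"
    by (simp add: power2_eq_square algebra_simps)
  also have "\<dots> = 125 + 22 * a + a\<^sup>2" unfolding quad by (simp add: power2_eq_square algebra_simps)
  finally have "sqrt (125 + 22 * a + a\<^sup>2) = 2 * x + (11 + a)" using x a by (intro real_sqrt_unique) auto
  hence "- 11/2 - a / 2 + 1/2 * sqrt (125 + 22 * a + a\<^sup>2) = x" by (simp add: field_simps)
  moreover have "x powr (1/5) = q powr (1/5) * B / A"
  proof -
    have "(y ^ 5) powr (1/5) = y" if "y > 0" for y :: real
    proof -
      have "y ^ 5 = y powr 5" using powr_realpow[of y 5] that by simp
      thus ?thesis using that by (simp only: powr_powr) simp
    qed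
    thus ?thesis unfolding x_def using AB q by (simp add: powr_mult powr_divide)
  qed
  ultimately show ?thesis using rr_cfrac_eq[OF q] by (simp add: A_B_def)
qed

section \<open>Theta parametrisation of the singular modulus\<close>

text \<open>All terms are dominated by those of the convergent theta series at the bounds
  \<open>A\<close> and \<open>B\<close>.\<close>

lemma ftheta_LIMSEQ:
  fixes a b :: "nat \<Rightarrow> 'a::{real_normed_field,banach}"
  assumes "a \<longlonglongrightarrow> a0" "b \<longlonglongrightarrow> b0" and bd: "\<And>n. norm (a n) \<le> A" "\<And>n. norm (b n) \<le> B" and AB: "A * B < 1"
  shows "(\<lambda>n. ftheta (a n) (b n)) \<longlonglongrightarrow> ftheta a0 b0"
  unfolding ftheta_def
proof (rule tannery_int)
  have nonneg: "0 \<le> A" "0 \<le> B" using bd[of 0] norm_ge_zero order.trans by blast+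
  show "(\<lambda>N. theta_term (a N) (b N) n) \<longlonglongrightarrow> theta_term a0 b0 n" for n
    unfolding theta_term_def by (intro tendsto_intros assms)
  show "norm (theta_term (a N) (b N) n) \<le> theta_term A B n" for N n
    unfolding theta_term_def norm_mult norm_power using bd nonneg by (intro mult_mono power_mono) auto
  have "norm (A * B) < 1" using nonneg AB by simp
  thus "theta_term A B summable_on UNIV" by (rule theta_term_summable)
qed

lemma tri_eq_0_iff: "tri n = 0 \<longleftrightarrow> n = 0 \<or> n = - 1"
  using two_tri[of n] by auto

lemma tri_pos: "n \<noteq> 0 \<Longrightarrow> n \<noteq> - 1 \<Longrightarrow> 0 < tri n"
  using tri_eq_0_iff by blast

lemma phi_0: "phi (0::'a::{real_normed_field,banach}) = 1"
proof -
  have "phi (0::'a) = infsum (theta_term 0 0) {0}"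
    unfolding ftheta_def by (rule infsum_cong_neutral) (auto simp: theta_term_def tri_pos dest: tri_pos)
  thus ?thesis by (simp add: theta_term_def)
qed

lemma ftheta_0_1: "ftheta (0::'a::{real_normed_field,banach}) 1 = 2"
proof -
  have "ftheta (0::'a) 1 = infsum (theta_term 0 1) {0, - 1}"
    unfolding ftheta_def by (rule infsum_cong_neutral) (auto simp: theta_term_def tri_pos)
  thus ?thesis by (simp add: theta_term_def)
qed

text \<open>\<open>kmod q = \<theta>\<^sub>2(q)\<^sup>2 / \<theta>\<^sub>3(q)\<^sup>2\<close> and \<open>kmod' q = \<theta>\<^sub>4(q)\<^sup>2 / \<theta>\<^sub>3(q)\<^sup>2\<close>.\<close>

definition kmod :: "real \<Rightarrow> real" where
  "kmod q = sqrt q * (ftheta (q\<^sup>2) 1)\<^sup>2 / (phi q)\<^sup>2"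

definition kmod' :: "real \<Rightarrow> real" where
  "kmod' q = (phi (- q))\<^sup>2 / (phi q)\<^sup>2"

context
  fixes q :: real
  assumes q: "0 < q" "q < 1"
begin

lemma norm_q: "norm q < 1" using q by simp

lemma eul_pow_pos: "m > 0 \<Longrightarrow> eul (q ^ m) > 0"
  using norm_power_less_1[OF norm_q, of m] by (auto intro: qp_pos)

lemma theta_pos: "phi q > 0" "phi (- q) > 0" "ftheta q 1 > 0"
  using eul_pow_pos[of 1] eul_pow_pos[of 2] eul_pow_pos[of 4]
  by (simp_all add: phi_eul[OF norm_q] phi_uminus_eul[OF norm_q] ftheta_one_eul[OF norm_q])

end

text \<open>At \<open>s = sqrt q\<close>, multiply the even-odd splittings of
  \<open>(phi s)\<^sup>2\<close> and \<open>(phi (- s))\<^sup>2\<close>: the right sides form a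
  difference of squares, and the left is a power of \<open>phi (- q)\<close> by
  \<open>phi_mult_phi_uminus\<close>.\<close>

lemma jacobi_identity:
  assumes q: "0 < q" "q < (1::real)"
  shows "phi q ^ 4 = phi (- q) ^ 4 + q * ftheta (q\<^sup>2) 1 ^ 4"
proof -
  define s where "s = sqrt q"
  have s: "0 < s" "s < 1" "s\<^sup>2 = q" "s ^ 4 = q\<^sup>2"
    using q by (auto simp: s_def real_sqrt_lt_1_iff power4_eq_xxxx power2_eq_square)
  hence n: "norm s < 1" by simp
  have "(phi (- (s\<^sup>2)))\<^sup>2 ^ 2 = ((phi (s\<^sup>2))\<^sup>2 + s * (ftheta (s ^ 4) 1)\<^sup>2) * ((phi (s\<^sup>2))\<^sup>2 - s * (ftheta (s ^ 4) 1)\<^sup>2)"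
    unfolding phi_mult_phi_uminus[OF n, symmetric] phi_uminus_sq[OF n, symmetric] by (simp add: power_mult_distrib)
  also have "\<dots> = ((phi (s\<^sup>2))\<^sup>2)\<^sup>2 - s\<^sup>2 * ((ftheta (s ^ 4) 1)\<^sup>2)\<^sup>2"
    by (simp add: power2_eq_square algebra_simps)
  finally show ?thesis unfolding s by simp
qed

lemma kmod_facts:
  assumes q: "0 < q" "q < 1"
  shows "0 < kmod q" "kmod q < 1" "0 < kmod' q" "kmod' q < 1"
    "kmod' q = sqrt (1 - (kmod q)\<^sup>2)" "kmod q = sqrt (1 - (kmod' q)\<^sup>2)"
proof -
  have q2: "0 < q\<^sup>2" "q\<^sup>2 < 1" using q by (auto simp: power_less_one_iff)
  note pos = theta_pos(1,2)[OF q] theta_pos(3)[OF q2]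
  show k: "0 < kmod q" and k': "0 < kmod' q" using pos q by (auto simp: kmod_def kmod'_def)
  have "(kmod q)\<^sup>2 + (kmod' q)\<^sup>2 = (phi (- q) ^ 4 + q * ftheta (q\<^sup>2) 1 ^ 4) / phi q ^ 4"
    using q by (simp add: kmod_def kmod'_def power_divide power_mult_distrib add_divide_distrib flip: power_mult)
  hence sum: "(kmod q)\<^sup>2 + (kmod' q)\<^sup>2 = 1" unfolding jacobi_identity[OF q, symmetric] using pos by simp
  show "kmod' q = sqrt (1 - (kmod q)\<^sup>2)" "kmod q = sqrt (1 - (kmod' q)\<^sup>2)"
    using sum k k' by (auto intro!: real_sqrt_unique[symmetric])
  have "0 < (kmod q)\<^sup>2" "0 < (kmod' q)\<^sup>2" using k k' by simp_all
  hence "(kmod q)\<^sup>2 < 1\<^sup>2" "(kmod' q)\<^sup>2 < 1\<^sup>2" using sum unfolding power_one by linarith+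
  thus "kmod q < 1" "kmod' q < 1" using power2_less_imp_less[of "kmod q" 1] power2_less_imp_less[of "kmod' q" 1] by auto
qed

text \<open>Squaring the nome is Landen's descending step: the sum and difference of
  \<open>(phi q)\<^sup>2\<close> and \<open>(phi (- q))\<^sup>2\<close> are twice the even and the
  odd part of the lattice sum.\<close>

lemma kmod_square:
  assumes q: "0 < q" "q < 1"
  shows "kmod (q\<^sup>2) = (1 - kmod' q) / (1 + kmod' q)" "1 + kmod' q = 2 * (phi (q\<^sup>2))\<^sup>2 / (phi q)\<^sup>2"
proof -
  have n: "norm q < 1" using q by simp
  have q2: "0 < q\<^sup>2" "q\<^sup>2 < 1" using q by (auto simp: power_less_one_iff)
  note pos = theta_pos(1,2)[OF q] theta_pos(1)[OF q2]
  have "(phi q)\<^sup>2 + (phi (- q))\<^sup>2 = 2 * (phi (q\<^sup>2))\<^sup>2" "(phi q)\<^sup>2 - (phi (- q))\<^sup>2 = 2 * (q * (ftheta (q ^ 4) 1)\<^sup>2)"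
    unfolding phi_uminus_sq[OF n] by simp_all
  moreover have "1 + kmod' q = ((phi q)\<^sup>2 + (phi (- q))\<^sup>2) / (phi q)\<^sup>2" "1 - kmod' q = ((phi q)\<^sup>2 - (phi (- q))\<^sup>2) / (phi q)\<^sup>2"
    using pos by (simp_all add: kmod'_def field_simps)
  ultimately have p: "1 + kmod' q = 2 * (phi (q\<^sup>2))\<^sup>2 / (phi q)\<^sup>2" and m: "1 - kmod' q = 2 * (q * (ftheta (q ^ 4) 1)\<^sup>2) / (phi q)\<^sup>2"
    by simp_all
  show "1 + kmod' q = 2 * (phi (q\<^sup>2))\<^sup>2 / (phi q)\<^sup>2" by (rule p)
  show "kmod (q\<^sup>2) = (1 - kmod' q) / (1 + kmod' q)"
    unfolding p m kmod_def using pos q by simp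
qed

text \<open>Landen's transformation is used at \<open>c = kmod' q\<close> for the first integral and
  at \<open>c = kmod (q\<^sup>2)\<close> for the complementary one, where it leads back to
  \<open>kmod' q\<close>.\<close>

lemma ellK_kmod_square:
  assumes q: "0 < q" "q < 1"
  shows "ellK (kmod (q\<^sup>2)) / (phi (q\<^sup>2))\<^sup>2 = ellK (kmod q) / (phi q)\<^sup>2"
    and "ellK (kmod' (q\<^sup>2)) / ellK (kmod (q\<^sup>2)) = 2 * (ellK (kmod' q) / ellK (kmod q))"
proof -
  have q2: "0 < q\<^sup>2" "q\<^sup>2 < 1" using q by (auto simp: power_less_one_iff)
  note K = kmod_facts[OF q] and K2 = kmod_facts[OF q2]
  note pos = theta_pos(1,2)[OF q] theta_pos(1)[OF q2]
  have 1: "2 * ellK (kmod (q\<^sup>2)) = (1 + kmod' q) * ellK (kmod q)"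
    using landen_transformation[of "kmod' q"] K(3,4)
    unfolding K(6)[symmetric] kmod_square(1)[OF q, symmetric] by simp
  thus "ellK (kmod (q\<^sup>2)) / (phi (q\<^sup>2))\<^sup>2 = ellK (kmod q) / (phi q)\<^sup>2"
    using pos by (simp add: kmod_square(2)[OF q] field_simps)
  have "(1 - kmod (q\<^sup>2)) / (1 + kmod (q\<^sup>2)) = kmod' q"
    using K(3,4) by (simp add: kmod_square(1)[OF q] divide_simps)
  hence "2 * ellK (kmod' q) = (1 + kmod (q\<^sup>2)) * ellK (kmod' (q\<^sup>2))"
    using landen_transformation[of "kmod (q\<^sup>2)"] K2(1,2) unfolding K2(5)[symmetric] by simp
  moreover have "1 + kmod (q\<^sup>2) = 2 / (1 + kmod' q)"
    using K(3,4) by (simp add: kmod_square(1)[OF q] divide_simps)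
  ultimately have 2: "ellK (kmod' (q\<^sup>2)) = (1 + kmod' q) * ellK (kmod' q)"
    using K(3,4) by (simp add: field_simps)
  have 3: "ellK (kmod (q\<^sup>2)) = (1 + kmod' q) * ellK (kmod q) / 2" using 1 by simp
  show "ellK (kmod' (q\<^sup>2)) / ellK (kmod (q\<^sup>2)) = 2 * (ellK (kmod' q) / ellK (kmod q))"
    unfolding 2 3 using K(3,4) by simp
qed

text \<open>Both claims follow by iterating \<open>q \<mapsto> q\<^sup>2\<close>: the quotient of \<open>ellK\<close> and \<open>phi\<^sup>2\<close> is invariant, while the ratio
  of the two integrals doubles, so that only its logarithmic growth as the modulus tends to 0 matters.\<close>

lemma ellK_kmod:
  assumes q: "0 < q" "q < 1"
  shows "ellK (kmod q) = pi / 2 * (phi q)\<^sup>2" "ellK (kmod' q) / ellK (kmod q) = - ln q / pi"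
proof -
  define Q where "Q = (\<lambda>n::nat. q ^ (2 ^ n))"
  have Q: "0 < Q n" "Q n < 1" "Q n \<le> q" for n
    using q power_decreasing[of 1 "2 ^ n" q] by (auto simp: Q_def power_less_one_iff)
  have QS: "Q (Suc n) = (Q n)\<^sup>2" for n by (simp add: Q_def mult.commute flip: power_mult)
  have Qlim: "Q \<longlonglongrightarrow> 0"
    unfolding Q_def by (rule filterlim_compose[OF LIMSEQ_power_zero filterlim_subseq]) (use q in \<open>auto simp: strict_mono_def\<close>)
  \<comment> \<open>This is \<open>kmod (Q n) / sqrt (Q n)\<close>. Its limit 4 is positive, so
    \<open>ln (c n)\<close> disappears on division by \<open>2 ^ n\<close>.\<close>
  define c where "c = (\<lambda>n. (ftheta ((Q n)\<^sup>2) 1)\<^sup>2 / (phi (Q n))\<^sup>2)"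
  have plim: "(\<lambda>n. phi (Q n)) \<longlonglongrightarrow> 1"
    unfolding phi_0[symmetric]
    by (rule ftheta_LIMSEQ[OF Qlim Qlim, where A = q and B = q])
       (use Q q norm_power_less_1[of q 2] in \<open>auto simp: less_imp_le abs_of_pos power2_eq_square\<close>)
  have "(\<lambda>n. (Q n)\<^sup>2) \<longlonglongrightarrow> 0\<^sup>2" by (intro tendsto_intros Qlim)
  hence "(\<lambda>n. ftheta ((Q n)\<^sup>2) 1) \<longlonglongrightarrow> 2"
    unfolding ftheta_0_1[symmetric]
    by (intro ftheta_LIMSEQ[where A = "q\<^sup>2" and B = 1])
       (use Q q norm_power_less_1[of q 2] in \<open>auto simp: less_imp_le intro: power_mono\<close>)
  hence "c \<longlonglongrightarrow> 2\<^sup>2 / 1\<^sup>2"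
    unfolding c_def by (intro tendsto_intros plim) auto
  hence clim: "c \<longlonglongrightarrow> 4" by simp
  have c_pos: "c n > 0" for n
    using theta_pos[OF Q(1,2)[of n]] theta_pos(3)[of "(Q n)\<^sup>2"] Q(1,2)[of n] by (simp add: c_def power_less_one_iff)
  have kc: "kmod (Q n) = sqrt (Q n) * c n" for n by (simp add: kmod_def c_def)
  have "(\<lambda>n. sqrt (Q n) * c n) \<longlonglongrightarrow> sqrt 0 * 4" by (intro tendsto_intros Qlim clim)
  hence klim: "(\<lambda>n. kmod (Q n)) \<longlonglongrightarrow> 0" unfolding kc by simp
  note K = kmod_facts[OF Q(1,2)]
  have Klim: "(\<lambda>n. ellK (kmod (Q n))) \<longlonglongrightarrow> pi/2"
  proof (rule tendsto_sandwich[where f = "\<lambda>_. pi/2"])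
    have "(\<lambda>n. pi/2 / sqrt (1 - (kmod (Q n))\<^sup>2)) \<longlonglongrightarrow> pi/2 / sqrt (1 - 0\<^sup>2)"
      by (intro tendsto_intros klim) auto
    thus "(\<lambda>n. pi/2 / sqrt (1 - (kmod (Q n))\<^sup>2)) \<longlonglongrightarrow> pi/2" by simp
    have k1: "\<bar>kmod (Q n)\<bar> < 1" for n using K(1,2)[of n] by simp
    show "\<forall>\<^sub>F n in sequentially. pi/2 \<le> ellK (kmod (Q n))"
      by (intro always_eventually allI ellK_bounds k1)
    show "\<forall>\<^sub>F n in sequentially. ellK (kmod (Q n)) \<le> pi/2 / sqrt (1 - (kmod (Q n))\<^sup>2)"
      by (intro always_eventually allI ellK_bounds k1)
  qed auto
  have inv: "ellK (kmod (Q n)) / (phi (Q n))\<^sup>2 = ellK (kmod q) / (phi q)\<^sup>2" for n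
  proof (induction n)
    case (Suc n)
    thus ?case unfolding QS ellK_kmod_square(1)[OF Q(1,2)] .
  qed (simp add: Q_def)
  have "(\<lambda>n. ellK (kmod (Q n)) / (phi (Q n))\<^sup>2) \<longlonglongrightarrow> pi/2 / 1\<^sup>2"
    by (intro tendsto_intros Klim plim) auto
  hence "ellK (kmod q) / (phi q)\<^sup>2 = pi/2" unfolding inv by (simp add: LIMSEQ_const_iff)
  thus "ellK (kmod q) = pi / 2 * (phi q)\<^sup>2" using theta_pos(1)[OF q] by (simp add: field_simps)
  define L where "L = ellK (kmod' q) / ellK (kmod q)"
  have ratio: "ellK (kmod' (Q n)) / ellK (kmod (Q n)) = 2 ^ n * L" for n
  proof (induction n)
    case (Suc n)
    thus ?case unfolding QS ellK_kmod_square(2)[OF Q(1,2)] by simp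
  qed (simp add: Q_def L_def)
  have Kpos: "ellK (kmod (Q n)) > 0" for n
    using ellK_bounds(1)[of "kmod (Q n)"] K(1,2)[of n] less_le_trans[OF pi_half_gt_zero] by simp
  have K'eq: "ellK (kmod' (Q n)) / 2 ^ n = L * ellK (kmod (Q n))" for n
    using ratio[of n] Kpos[of n] by (simp add: field_simps)
  have lnk: "ln (kmod (Q n)) / 2 ^ n = ln q / 2 + ln (c n) * (1/2) ^ n" for n
  proof -
    have "ln (kmod (Q n)) = 2 ^ n * ln q / 2 + ln (c n)"
      unfolding kc using Q(1)[of n] c_pos[of n] q by (simp add: ln_mult ln_sqrt Q_def ln_realpow)
    thus ?thesis by (simp add: add_divide_distrib power_one_over)
  qed
  have half: "(\<lambda>n. (1/2::real) ^ n) \<longlonglongrightarrow> 0" by (intro LIMSEQ_power_zero) auto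
  have "(\<lambda>n. ln q / 2 + ln (c n) * (1/2) ^ n) \<longlonglongrightarrow> ln q / 2 + ln 4 * 0"
    by (intro tendsto_intros clim half) auto
  hence lnlim: "(\<lambda>n. ln (kmod (Q n)) / 2 ^ n) \<longlonglongrightarrow> ln q / 2" unfolding lnk by simp
  \<comment> \<open>The additive constants of \<open>ellK_compl_bounds\<close> vanish on division by
    \<open>2 ^ n\<close>. Comparison with the limit obtained from \<open>K'eq\<close> determines
    \<open>L\<close>.\<close>
  have "(\<lambda>n. ellK (kmod' (Q n)) / 2 ^ n) \<longlonglongrightarrow> - (ln q / 2)"
  proof (rule tendsto_sandwich)
    show "(\<lambda>n. - (ln (kmod (Q n)) / 2 ^ n)) \<longlonglongrightarrow> - (ln q / 2)" by (intro tendsto_intros lnlim)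
    have "(\<lambda>n. (- (ln (kmod (Q n)) / 2 ^ n) + (ln 3 + pi/2) * (1/2) ^ n) / sqrt (1 - (kmod (Q n))\<^sup>2)) \<longlonglongrightarrow> 
        (- (ln q / 2) + (ln 3 + pi/2) * 0) / sqrt (1 - 0\<^sup>2)"
      by (intro tendsto_intros lnlim klim half) auto
    thus "(\<lambda>n. (- (ln (kmod (Q n)) / 2 ^ n) + (ln 3 + pi/2) * (1/2) ^ n) / sqrt (1 - (kmod (Q n))\<^sup>2)) \<longlonglongrightarrow> - (ln q / 2)"
      by simp
    show "\<forall>\<^sub>F n in sequentially. - (ln (kmod (Q n)) / 2 ^ n) \<le> ellK (kmod' (Q n)) / 2 ^ n"
    proof (intro always_eventually allI)
      fix n
      have "- ln (kmod (Q n)) \<le> ellK (kmod' (Q n))"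
        using ellK_compl_bounds(1)[OF K(1,2)[of n]] K(1)[of n] unfolding K(5)[symmetric] by (simp add: ln_div)
      hence "- ln (kmod (Q n)) / 2 ^ n \<le> ellK (kmod' (Q n)) / 2 ^ n" by (rule divide_right_mono) simp
      thus "- (ln (kmod (Q n)) / 2 ^ n) \<le> ellK (kmod' (Q n)) / 2 ^ n" by simp
    qed
    show "\<forall>\<^sub>F n in sequentially. ellK (kmod' (Q n)) / 2 ^ n \<le> 
        (- (ln (kmod (Q n)) / 2 ^ n) + (ln 3 + pi/2) * (1/2) ^ n) / sqrt (1 - (kmod (Q n))\<^sup>2)"
    proof (intro always_eventually allI)
      fix n
      have "ellK (kmod' (Q n)) \<le> (- ln (kmod (Q n)) + (ln 3 + pi/2)) / sqrt (1 - (kmod (Q n))\<^sup>2)"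
        using ellK_compl_bounds(2)[OF K(1,2)[of n]] K(1)[of n] unfolding K(5)[symmetric] by (simp add: ln_div algebra_simps)
      hence "ellK (kmod' (Q n)) / 2 ^ n \<le> (- ln (kmod (Q n)) + (ln 3 + pi/2)) / sqrt (1 - (kmod (Q n))\<^sup>2) / 2 ^ n"
        by (rule divide_right_mono) simp
      also have "\<dots> = (- ln (kmod (Q n)) + (ln 3 + pi/2)) / 2 ^ n / sqrt (1 - (kmod (Q n))\<^sup>2)" by simp
      also have "(- ln (kmod (Q n)) + (ln 3 + pi/2)) / 2 ^ n = - (ln (kmod (Q n)) / 2 ^ n) + (ln 3 + pi/2) * (1/2) ^ n"
        by (simp add: add_divide_distrib diff_divide_distrib power_one_over)
      finally show "ellK (kmod' (Q n)) / 2 ^ n \<le> 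
        (- (ln (kmod (Q n)) / 2 ^ n) + (ln 3 + pi/2) * (1/2) ^ n) / sqrt (1 - (kmod (Q n))\<^sup>2)" .
    qed
  qed
  moreover have "(\<lambda>n. ellK (kmod' (Q n)) / 2 ^ n) \<longlonglongrightarrow> L * (pi/2)"
    unfolding K'eq by (intro tendsto_intros Klim)
  ultimately have "L * (pi/2) = - (ln q / 2)" using LIMSEQ_unique by blast
  thus "ellK (kmod' q) / ellK (kmod q) = - ln q / pi" by (simp add: L_def field_simps)
qed

text \<open>The nome is chosen so that \<open>- ln q / pi\<close> is \<open>sqrt r\<close>. The
  theta quotient thus supplies the existence of the singular modulus.\<close>

lemma sing_mod_eq_kmod:
  assumes r: "r > 0"
  shows "sing_mod r = kmod (exp (- pi * sqrt r))" "sing_mod' r = kmod' (exp (- pi * sqrt r))"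
proof -
  define q where "q = exp (- pi * sqrt r)"
  have q: "0 < q" "q < 1" using r by (auto simp: q_def)
  note K = kmod_facts[OF q]
  have "ellK (sqrt (1 - (kmod q)\<^sup>2)) / ellK (kmod q) = sqrt r"
    unfolding K(5)[symmetric] ellK_kmod(2)[OF q] by (simp add: q_def)
  hence "sing_mod r = kmod q" by (intro sing_mod_eqI r K)
  thus "sing_mod r = kmod (exp (- pi * sqrt r))" "sing_mod' r = kmod' (exp (- pi * sqrt r))"
    using K(5) by (simp_all add: q_def sing_mod'_def)
qed

section \<open>The multiplier of degree five\<close>

lemma five_phi_sq_diff_eul_real:
  fixes q :: real
  assumes q: "\<bar>q\<bar> < 1"
  shows "5 * (phi (q ^ 5))\<^sup>2 - (phi q)\<^sup>2 = 4 * (eul q * eul (q ^ 4) * eul (q ^ 10) ^ 2 / (eul (q ^ 5) * eul (q ^ 20)))"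
proof -
  obtain z :: complex where z: "1 + z + z ^ 2 + z ^ 3 + z ^ 4 = 0" using primitive_fifth_root_exists by blast
  have n: "\<bar>q ^ m\<bar> < 1" if "m > 0" for m using norm_power_less_1[of q m] q that by simp
  have E: "eul (complex_of_real q ^ m) = of_real (eul (q ^ m))" if "m > 0" for m
    using of_real_qp[OF n[OF that], of "q ^ m", where 'a = complex] by simp
  have P: "phi (complex_of_real q ^ m) = of_real (phi (q ^ m))" if "m > 0" for m
    using of_real_ftheta[of "q ^ m" "q ^ m", where 'a = complex] n[of "m + m"] that by (simp add: power_add)
  have "5 * (phi (complex_of_real q ^ 5))\<^sup>2 - (phi (complex_of_real q ^ 1))\<^sup>2 = 
        4 * (eul (complex_of_real q ^ 1) * eul (complex_of_real q ^ 4) * eul (complex_of_real q ^ 10) ^ 2 / 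
          (eul (complex_of_real q ^ 5) * eul (complex_of_real q ^ 20)))"
    using five_phi_sq_diff_eul[OF z, of "of_real q"] q by simp
  hence "complex_of_real (5 * (phi (q ^ 5))\<^sup>2 - (phi (q ^ 1))\<^sup>2) = 
     of_real (4 * (eul (q ^ 1) * eul (q ^ 4) * eul (q ^ 10) ^ 2 / (eul (q ^ 5) * eul (q ^ 20))))"
    by (simp only: E P of_real_diff of_real_mult of_real_power of_real_divide of_real_numeral zero_less_numeral zero_less_one)
  thus ?thesis unfolding of_real_eq_iff by simp
qed

theorem theorem2p1:
  fixes r q :: real
  assumes "r > 0" and "q = exp (- pi * sqrt r)"
  shows "(5 * M5 r - 1) ^ 5 * (1 - M5 r) = 256 * (sing_mod r)\<^sup>2 * (sing_mod' r)\<^sup>2 * M5 r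
         \<and> rr_cfrac q = (- 11/2 - a_r r / 2 + 1/2 * sqrt (125 + 22 * a_r r + (a_r r)\<^sup>2)) powr (1/5)"
proof -
  have q: "0 < q" "q < 1" using assms by auto
  have q5: "0 < q ^ 5" "q ^ 5 < 1" using q by (auto simp: power_less_one_iff)
  have n: "norm q < 1" and n5: "norm (q ^ 5) < 1" and n2: "norm (q\<^sup>2) < 1" and n10: "norm (q ^ 10) < 1"
    using q norm_power_less_1[of q] by auto
  have exp5: "exp (- pi * sqrt (25 * r)) = q ^ 5"
    using assms by (simp add: real_sqrt_mult exp_of_nat_mult[symmetric] algebra_simps)
  have sm: "sing_mod r = kmod q" "sing_mod' r = kmod' q" 
    "sing_mod (25 * r) = kmod (q ^ 5)" "sing_mod' (25 * r) = kmod' (q ^ 5)"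
    using sing_mod_eq_kmod[of r] sing_mod_eq_kmod[of "25 * r"] assms unfolding exp5 by simp_all
  \<comment> \<open>Apart from powers of \<open>q\<close> and \<open>sqrt q\<close>, everything
    below is a monomial in these six values.\<close>
  define e1 e2 e4 e5 e10 e20 where "e1 = eul q" "e2 = eul (q ^ 2)" "e4 = eul (q ^ 4)" 
    "e5 = eul (q ^ 5)" "e10 = eul (q ^ 10)" "e20 = eul (q ^ 20)"
  note e_def = e1_e2_e4_e5_e10_e20_def
  have e: "e1 > 0" "e2 > 0" "e4 > 0" "e5 > 0" "e10 > 0" "e20 > 0"
    using eul_pow_pos[OF q] eul_pow_pos[OF q, of 1] by (auto simp: e_def)
  define f f5 where "f = phi q" "f5 = phi (q ^ 5)"
  have pos: "f > 0" "f5 > 0" using theta_pos(1)[OF q] theta_pos(1)[OF q5] by (simp_all add: f_f5_def)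
  have f: "f = e2 ^ 5 / (e1 ^ 2 * e4 ^ 2)" unfolding f_f5_def e_def by (rule phi_eul[OF n])
  have f5: "f5 = e10 ^ 5 / (e5 ^ 2 * e20 ^ 2)" unfolding f_f5_def e_def
    using phi_eul[OF n5] by (simp flip: power_mult)
  have g: "phi (- q) = e1 ^ 2 / e2" unfolding e_def by (rule phi_uminus_eul[OF n])
  have g5: "phi (- (q ^ 5)) = e5 ^ 2 / e10" unfolding e_def using phi_uminus_eul[OF n5] by (simp flip: power_mult)
  have h: "ftheta (q\<^sup>2) 1 = 2 * e4 ^ 2 / e2" unfolding e_def using ftheta_one_eul[OF n2] by (simp flip: power_mult)
  have h5: "ftheta ((q ^ 5)\<^sup>2) 1 = 2 * e20 ^ 2 / e10" unfolding e_def using ftheta_one_eul[OF n10] by (simp flip: power_mult)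
  have M: "M5 r = f5\<^sup>2 / f\<^sup>2"
    unfolding M5_def sm ellK_kmod(1)[OF q] ellK_kmod(1)[OF q5] f_f5_def by simp
  have P: "f\<^sup>2 - f5\<^sup>2 = 4 * q * (e2 ^ 2 * e5 * e20 / (e1 * e4))"
    unfolding f_f5_def e_def by (rule phi_sq_diff_eul[OF n])
  have R: "5 * f5\<^sup>2 - f\<^sup>2 = 4 * (e1 * e4 * e10 ^ 2 / (e5 * e20))"
    unfolding f_f5_def e_def using five_phi_sq_diff_eul_real[of q] q by simp
  have "(5 * M5 r - 1) ^ 5 * (1 - M5 r) = 256 * (sing_mod r)\<^sup>2 * (sing_mod' r)\<^sup>2 * M5 r"
  proof -
    have 1: "5 * M5 r - 1 = (5 * f5\<^sup>2 - f\<^sup>2) / f\<^sup>2" "1 - M5 r = (f\<^sup>2 - f5\<^sup>2) / f\<^sup>2"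
      unfolding M using pos by (simp_all add: field_simps)
    have k2: "(sing_mod r)\<^sup>2 = q * (2 * e4 ^ 2 / e2) ^ 4 / f ^ 4" "(sing_mod' r)\<^sup>2 = (e1 ^ 2 / e2) ^ 4 / f ^ 4"
      unfolding sm kmod_def kmod'_def h g f_f5_def(1)[symmetric] using q
      by (simp_all add: power_divide power_mult_distrib flip: power_mult)
    have "(5 * f5\<^sup>2 - f\<^sup>2) ^ 5 * (f\<^sup>2 - f5\<^sup>2) = 256 * q * (2 * e4 ^ 2 / e2) ^ 4 * (e1 ^ 2 / e2) ^ 4 * f5\<^sup>2 * f\<^sup>2"
    proof -
      have 8: "e1 ^ 8 = e1 ^ 4 * e1 ^ 4" "e4 ^ 8 = e4 ^ 4 * e4 ^ 4" "e2 ^ 10 = e2 ^ 8 * e2 ^ 2"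
        and 5: "e1 ^ 5 = e1 ^ 4 * e1" "e4 ^ 5 = e4 ^ 4 * e4" "e5 ^ 5 = e5 ^ 4 * e5" "e20 ^ 5 = e20 ^ 4 * e20"
        by (simp_all flip: power_add power_Suc2)
      show ?thesis unfolding P R unfolding f f5 using e 5 q(1)
        by (simp add: power_divide power_mult_distrib flip: power_mult, simp add: frac_eq_eq, simp only: 8, simp only: mult_ac)
    qed
    moreover have "(x / f\<^sup>2) ^ 5 * (y / f\<^sup>2) = 256 * (q * u / f ^ 4) * (v / f ^ 4) * (f5\<^sup>2 / f\<^sup>2)"
      if "x ^ 5 * y = 256 * q * u * v * f5\<^sup>2 * f\<^sup>2" for x y u v
    proof -
      have "(x / f\<^sup>2) ^ 5 * (y / f\<^sup>2) = x ^ 5 * y / f ^ 12"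
        by (simp add: power_divide flip: power_mult power_add)
      also have "\<dots> = 256 * q * u * v * f5\<^sup>2 / f ^ 10"
        unfolding that using pos by (simp add: divide_simps flip: power_add)
      also have "\<dots> = 256 * (q * u / f ^ 4) * (v / f ^ 4) * (f5\<^sup>2 / f\<^sup>2)"
        by (simp flip: power_add)
      finally show ?thesis .
    qed
    ultimately show ?thesis unfolding 1 k2 unfolding M by blast
  qed
  moreover have "a_r r = e1 ^ 6 / (q * e5 ^ 6)"
  proof -
    have s: "sqrt (q ^ 5) = q\<^sup>2 * sqrt q"
    proof -
      have "sqrt (q ^ 5) = sqrt ((q\<^sup>2)\<^sup>2 * q)" by (simp flip: power_mult power_Suc2)
      thus ?thesis by (simp only: real_sqrt_mult real_sqrt_abs abs_power2)
    qed
    \<comment> \<open>The quotient is written as a square, with \<open>sqrt q / sqrt (q ^ 5)\<close>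
      equal to the square of \<open>1 / q\<close>, so that the root in \<open>a_r\<close> can be
      read off.\<close>
    have "kmod q / kmod (q ^ 5) = (((2 * e4 ^ 2 / e2) * f5) / (q * (2 * e20 ^ 2 / e10) * f))\<^sup>2"
      unfolding kmod_def h h5 f_f5_def[symmetric] s using q e pos
      by (simp add: power_divide power_mult_distrib divide_simps)
    moreover have "((2 * e4 ^ 2 / e2) * f5) / (q * (2 * e20 ^ 2 / e10) * f) > 0" using q e pos by simp
    ultimately have sq: "sqrt (kmod q / kmod (q ^ 5)) = ((2 * e4 ^ 2 / e2) * f5) / (q * (2 * e20 ^ 2 / e10) * f)"
      by (intro real_sqrt_unique) (auto intro: less_imp_le)
    have powi: "x powi (- 3) = 1 / x ^ 3" for x :: real by (simp add: power_int_minus divide_inverse)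
    have k': "kmod' q / kmod' (q ^ 5) = (e1 ^ 4 * e10 ^ 2 * f5 ^ 2) / (e2 ^ 2 * e5 ^ 4 * f ^ 2)"
      unfolding kmod'_def g g5 f_f5_def[symmetric] using q e pos
      by (simp add: power_divide mult_ac flip: power_mult)
    have "a_r r = ((e1 ^ 4 * e10 ^ 2 * f5 ^ 2) / (e2 ^ 2 * e5 ^ 4 * f ^ 2))\<^sup>2 * 
        ((2 * e4 ^ 2 / e2) * f5 / (q * (2 * e20 ^ 2 / e10) * f)) * (1 / (f5\<^sup>2 / f\<^sup>2) ^ 3)"
      unfolding a_r_def sm sq k' powi M ..
    also have "\<dots> = (e1 ^ 8 * e10 ^ 5 * e4 ^ 2) / (e2 ^ 5 * e5 ^ 8 * e20 ^ 2 * q) * (f / f5)"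
    proof -
      have "f ^ 6 = f ^ 4 * f * f" "f5 ^ 6 = f5 ^ 4 * f5 * f5" "e10 ^ 5 = e10 ^ 4 * e10" "e2 ^ 5 = e2 ^ 4 * e2"
        by (simp_all add: eval_nat_numeral)
      thus ?thesis using q(1) e pos by (simp add: power_divide power_mult_distrib field_simps flip: power_mult)
    qed
    also have "\<dots> = e1 ^ 6 / (q * e5 ^ 6)"
      unfolding f f5 using q(1) e by (simp add: field_simps)
    finally show ?thesis .
  qed
  ultimately show ?thesis using rr_cfrac_closed_form[OF q] by (simp add: e_def)
qed

end
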